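(* Let $\beta>0$ and let $X=(X_t)_{t\in[0,\infty)}$ be a continuous $\beta$-self-similar Volterra Gaussian process with non-degenerate Volterra kernel $z_X$, defined on its coordinate space $(\Omega,\mathcal{F},\mathbb{P})$. Let $\alpha>-\frac12$. Then the transformation $$\mathcal{Z}^{\alpha}_t(X)\ :=\ X_t-(2\alpha+1)\,t^{\beta-\alpha-\frac12}\int_0^t s^{\alpha-\beta-\frac12}X_s\,ds,\qquad t\in[0,\infty),$$ is an automorphism on the coordinate space of $X$. Its inverse is given by $$\mathcal{Z}^{\alpha,-1}_t(X)\ =\ X_t-(2\alpha+1)\,t^{\alpha+\beta+\frac12}\int_t^{\infty} X_s\, s^{-\beta-\alpha-\frac32}\,ds,\quad \text{a.s.},\ t\in[0,\infty).$$ The integrals on the right-hand sides are $L^2(\mathbb{P})$-limits of Riemann sums.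
   Context: Setting. $X=(X_t)_{t\in[0,\infty)}$ is a continuous Volterra Gaussian process on a complete probability space: $X_t=\int_0^t z_X(t,s)\,dW_s$ a.s. for every $t\ge 0$, where $W$ is a standard Brownian motion and $z_X\in L^2_{\mathrm{loc}}([0,\infty)^2)$ is a deterministic kernel which is Volterra, i.e. $z_X(t,s)=0$ for $s\ge t$, with $z_X(t,\cdot)\in L^2([0,\infty))$ for each $t$. So $X$ is centered Gaussian with covariance $R^X(s,t)=\int_0^s z_X(s,u)z_X(t,u)\,du$, $0\le s\le t$. $z_X$ is non-degenerate if the family $\{z_X(t,\cdot): t\in(0,\infty)\}$ is linearly independent and its linear span is dense in $L^2([0,\infty))$. $X$ is $\beta$-self-similar if for every $a>0$ the processes $(X_{at})_{t\ge0}$ and $(a^{\beta}X_t)_{t\ge0}$ have the same finite-dimensional distributions. Coordinate space of $X$: $\Omega=\{\omega:[0,\infty)\to\mathbb{R}\mid \omega \text{ continuous}\}$, $X_t(\omega)=\omega(t)$, $\mathcal{F}=\sigma(X_t: t\ge 0)$ (completed), and $\mathbb{P}$ is the probability measure under which the coordinate process is centered Gaussian with covariance $R^X$. A measurable map $\mathcal{Z}:(\Omega,\mathcal{F},\mathbb{P})\to(\Omega,\mathcal{F},\mathbb{P})$, $X(\omega)\mapsto\mathcal{Z}(X(\omega))$, is measure-preserving if the image measure satisfies $\mathbb{P}^{\mathcal{Z}}=\mathbb{P}$, equivalently if $\mathcal{Z}(X)$ has the same law as $X$. It is an automorphism if moreover it is bijective and $\mathcal{Z}^{-1}$ is measurable.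 All this is understood modulo $\mathbb{P}$-null sets (the path transformations being defined almost surely). At $t=0$ both transformations are understood to take the value $0$ (note $X_0=0$ a.s.). *)

theory Defs
  imports "HOL-Probability.Probability"
begin

section \<open>Square integrable functions\<close>

definition square_integrable :: "'a measure \<Rightarrow> ('a \<Rightarrow> real) \<Rightarrow> bool" where
  "square_integrable M f \<longleftrightarrow> f \<in> borel_measurable M \<and> integrable M (\<lambda>x. (f x)\<^sup>2)"

definition L2_tendsto ::
  "'a measure \<Rightarrow> ('i \<Rightarrow> 'a \<Rightarrow> real) \<Rightarrow> ('a \<Rightarrow> real) \<Rightarrow> 'i filter \<Rightarrow> bool" where
  "L2_tendsto M f g F \<longleftrightarrow>
     square_integrable M g \<and> (\<forall>\<^sub>F i in F. square_integrable M (f i)) \<and>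
     ((\<lambda>i. \<integral>x. (f i x - g x)\<^sup>2 \<partial>M) \<longlongrightarrow> 0) F"

section \<open>Brownian motion and the Wiener integral\<close>

text \<open>Processes indexed by \<open>[0,\<infinity>)\<close> are functions of a real time parameter of which only the
  values at nonnegative times are ever used.\<close>

definition standard_brownian_motion :: "'a measure \<Rightarrow> (real \<Rightarrow> 'a \<Rightarrow> real) \<Rightarrow> bool" where
  "standard_brownian_motion M W \<longleftrightarrow>
     (\<forall>t\<ge>0. W t \<in> borel_measurable M) \<and>
     (AE \<omega> in M. W 0 \<omega> = 0) \<and>
     (\<forall>(n::nat) (t::nat \<Rightarrow> real). 0 \<le> t 0 \<and> (\<forall>i<n. t i \<le> t (Suc i)) \<longrightarrow>
        prob_space.indep_vars M (\<lambda>_. borel) (\<lambda>i \<omega>. W (t (Suc i)) \<omega> - W (t i) \<omega>) {..<n}) \<and>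
     (\<forall>s t. 0 \<le> s \<and> s < t \<longrightarrow>
        distributed M lborel (\<lambda>\<omega>. W t \<omega> - W s \<omega>) (normal_density 0 (sqrt (t - s)))) \<and>
     (AE \<omega> in M. continuous_on {0..} (\<lambda>t. W t \<omega>))"

text \<open>A list of triples \<open>(c, a, b)\<close> encodes the step function \<open>\<Sum> c 1\<^bsub>(a,b]\<^esub>\<close>.\<close>

definition step_function :: "(real \<times> real \<times> real) list \<Rightarrow> real \<Rightarrow> real" where
  "step_function xs s = (\<Sum>(c, a, b)\<leftarrow>xs. c * indicator {a<..b} s)"

definition step_integral ::
  "(real \<Rightarrow> 'a \<Rightarrow> real) \<Rightarrow> (real \<times> real \<times> real) list \<Rightarrow> 'a \<Rightarrow> real" where
  "step_integral W xs \<omega> = (\<Sum>(c, a, b)\<leftarrow>xs. c * (W b \<omega> - W a \<omega>))"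

text \<open>\<open>Y\<close> is a version of \<open>\<integral>\<^sub>0\<^sup>\<infinity> f(s) dW\<^sub>s\<close>; this determines \<open>Y\<close> up to almost sure equality.\<close>

definition is_wiener_integral ::
  "'a measure \<Rightarrow> (real \<Rightarrow> 'a \<Rightarrow> real) \<Rightarrow> (real \<Rightarrow> real) \<Rightarrow> ('a \<Rightarrow> real) \<Rightarrow> bool" where
  "is_wiener_integral M W f Y \<longleftrightarrow>
     (\<exists>xs :: nat \<Rightarrow> (real \<times> real \<times> real) list.
        (\<forall>n. \<forall>(c, a, b)\<in>set (xs n). 0 \<le> a \<and> a \<le> b) \<and>
        L2_tendsto (lebesgue_on {0..}) (\<lambda>n. step_function (xs n)) f sequentially \<and>
        L2_tendsto M (\<lambda>n. step_integral W (xs n)) Y sequentially)"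

section \<open>Volterra Gaussian processes\<close>

definition volterra_kernel :: "(real \<Rightarrow> real \<Rightarrow> real) \<Rightarrow> bool" where
  "volterra_kernel z \<longleftrightarrow>
     (\<forall>T\<ge>0. square_integrable (lebesgue_on ({0..T} \<times> {0..T})) (\<lambda>(t, s). z t s)) \<and>
     (\<forall>t\<ge>0. \<forall>s\<ge>t. z t s = 0) \<and>
     (\<forall>t\<ge>0. square_integrable (lebesgue_on {0..}) (z t))"

text \<open>Linear independence and density refer to \<open>L\<^sup>2([0,\<infinity>))\<close>, i.e. to functions modulo
  equality almost everywhere; the first clause concerns the family, so it also forces
  \<open>z t\<close> and \<open>z t'\<close> to differ for distinct \<open>t\<close> and \<open>t'\<close>.\<close>

definition nondegenerate_kernel :: "(real \<Rightarrow> real \<Rightarrow> real) \<Rightarrow> bool" where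
  "nondegenerate_kernel z \<longleftrightarrow>
     (\<forall>J c. finite J \<and> J \<subseteq> {0<..} \<and>
        (AE s in lebesgue_on {0..}. (\<Sum>t\<in>J. c t * z t s) = 0) \<longrightarrow> (\<forall>t\<in>J. c t = 0)) \<and>
     (\<forall>f. square_integrable (lebesgue_on {0..}) f \<longrightarrow>
        (\<forall>e>0. \<exists>J c. finite J \<and> J \<subseteq> {0<..} \<and>
           (\<integral>s. (f s - (\<Sum>t\<in>J. c t * z t s))\<^sup>2 \<partial>lebesgue_on {0..}) < e))"

definition volterra_gaussian_process ::
  "'a measure \<Rightarrow> (real \<Rightarrow> 'a \<Rightarrow> real) \<Rightarrow> (real \<Rightarrow> real \<Rightarrow> real) \<Rightarrow> (real \<Rightarrow> 'a \<Rightarrow> real) \<Rightarrow> bool" where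
  "volterra_gaussian_process M W z X \<longleftrightarrow>
     prob_space M \<and> complete_measure M \<and> standard_brownian_motion M W \<and> volterra_kernel z \<and>
     (\<forall>t\<ge>0. is_wiener_integral M W (\<lambda>s. indicator {0..t} s * z t s) (X t))"

definition volterra_covariance :: "(real \<Rightarrow> real \<Rightarrow> real) \<Rightarrow> real \<Rightarrow> real \<Rightarrow> real" where
  "volterra_covariance z s t = (\<integral>u. z s u * z t u \<partial>lebesgue_on {0..min s t})"

definition continuous_process :: "'a measure \<Rightarrow> (real \<Rightarrow> 'a \<Rightarrow> real) \<Rightarrow> bool" where
  "continuous_process M X \<longleftrightarrow> (AE \<omega> in M. continuous_on {0..} (\<lambda>t. X t \<omega>))"

definition self_similar :: "'a measure \<Rightarrow> real \<Rightarrow> (real \<Rightarrow> 'a \<Rightarrow> real) \<Rightarrow> bool" where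
  "self_similar M \<beta> X \<longleftrightarrow>
     (\<forall>a>0. \<forall>J. finite J \<and> J \<subseteq> {0..} \<longrightarrow>
        distr M (Pi\<^sub>M J (\<lambda>_. borel)) (\<lambda>\<omega>. \<lambda>t\<in>J. X (a * t) \<omega>) =
        distr M (Pi\<^sub>M J (\<lambda>_. borel)) (\<lambda>\<omega>. \<lambda>t\<in>J. a powr \<beta> * X t \<omega>))"

section \<open>The coordinate space\<close>

text \<open>A centered Gaussian variable may be degenerate, that is, almost surely zero.\<close>

definition centered_gaussian :: "'a measure \<Rightarrow> ('a \<Rightarrow> real) \<Rightarrow> bool" where
  "centered_gaussian M Y \<longleftrightarrow> Y \<in> borel_measurable M \<and>
     ((AE \<omega> in M. Y \<omega> = 0) \<or> (\<exists>\<sigma>>0. distributed M lborel Y (normal_density 0 \<sigma>)))"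

definition centered_gaussian_process ::
  "'a measure \<Rightarrow> (real \<Rightarrow> 'a \<Rightarrow> real) \<Rightarrow> (real \<Rightarrow> real \<Rightarrow> real) \<Rightarrow> bool" where
  "centered_gaussian_process M X R \<longleftrightarrow>
     (\<forall>J c. finite J \<and> J \<subseteq> {0..} \<longrightarrow> centered_gaussian M (\<lambda>\<omega>. \<Sum>t\<in>J. c t * X t \<omega>)) \<and>
     (\<forall>s\<ge>0. \<forall>t\<ge>0. (\<integral>\<omega>. X s \<omega> * X t \<omega> \<partial>M) = R s t)"

text \<open>A function on \<open>[0,\<infinity>)\<close> is represented by its extension that is \<open>undefined\<close> at negative
  times, so that paths agreeing on \<open>[0,\<infinity>)\<close> are equal.\<close>

definition paths :: "(real \<Rightarrow> real) set" where
  "paths = {\<omega> \<in> extensional {0..}. continuous_on {0..} \<omega>}"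

text \<open>The trace on \<^const>\<open>paths\<close> of the product \<open>\<sigma>\<close>-algebra, i.e. the \<open>\<sigma>\<close>-algebra generated by
  the coordinate maps.\<close>

definition path_algebra :: "(real \<Rightarrow> real) measure" where
  "path_algebra = restrict_space (Pi\<^sub>M {0..} (\<lambda>_. borel)) paths"

definition is_coordinate_space ::
  "(real \<Rightarrow> real \<Rightarrow> real) \<Rightarrow> (real \<Rightarrow> real) measure \<Rightarrow> bool" where
  "is_coordinate_space R P \<longleftrightarrow>
     prob_space P \<and>
     (\<exists>P0. sets P0 = sets path_algebra \<and> P = completion P0) \<and>
     centered_gaussian_process P (\<lambda>t \<omega>. \<omega> t) R"

text \<open>\<open>T\<close>, considered modulo null sets, is a measure-preserving bijection with measurable inverse:
  it is so as a map from \<open>A\<close> onto \<open>B\<close>, two sets of full measure.\<close>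

definition automorphism_between :: "'a measure \<Rightarrow> 'a set \<Rightarrow> 'a set \<Rightarrow> ('a \<Rightarrow> 'a) \<Rightarrow> bool" where
  "automorphism_between P A B T \<longleftrightarrow>
     A \<in> sets P \<and> B \<in> sets P \<and> (AE \<omega> in P. \<omega> \<in> A) \<and> (AE \<omega> in P. \<omega> \<in> B) \<and>
     T \<in> restrict_space P A \<rightarrow>\<^sub>M P \<and> distr (restrict_space P A) P T = P \<and>
     bij_betw T A B \<and> the_inv_into A T \<in> restrict_space P B \<rightarrow>\<^sub>M P"

section \<open>The path transformations\<close>

definition Z_integrand :: "real \<Rightarrow> real \<Rightarrow> real \<Rightarrow> (real \<Rightarrow> real) \<Rightarrow> real" where
  "Z_integrand \<beta> \<alpha> s \<omega> = s powr (\<alpha> - \<beta> - 1/2) * \<omega> s"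

definition Z_transform :: "real \<Rightarrow> real \<Rightarrow> (real \<Rightarrow> real) \<Rightarrow> real \<Rightarrow> real" where
  "Z_transform \<beta> \<alpha> \<omega> = (\<lambda>t\<in>{0..}. if t = 0 then 0 else
     \<omega> t - (2 * \<alpha> + 1) * t powr (\<beta> - \<alpha> - 1/2) * (LBINT s:{0..t}. Z_integrand \<beta> \<alpha> s \<omega>))"

definition Z_inv_integrand :: "real \<Rightarrow> real \<Rightarrow> real \<Rightarrow> (real \<Rightarrow> real) \<Rightarrow> real" where
  "Z_inv_integrand \<beta> \<alpha> s \<omega> = \<omega> s * s powr (- \<beta> - \<alpha> - 3/2)"

definition Z_inv_transform :: "real \<Rightarrow> real \<Rightarrow> (real \<Rightarrow> real) \<Rightarrow> real \<Rightarrow> real" where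
  "Z_inv_transform \<beta> \<alpha> \<omega> = (\<lambda>t\<in>{0..}. if t = 0 then 0 else
     \<omega> t - (2 * \<alpha> + 1) * t powr (\<alpha> + \<beta> + 1/2) * (LBINT s:{t..}. Z_inv_integrand \<beta> \<alpha> s \<omega>))"

section \<open>Riemann integrals in the mean square sense\<close>

text \<open>Convergence of all tagged Riemann sums of \<open>Y\<close> over \<open>[a,b]\<close> as the mesh tends to zero:
  fineness for the constant gauge \<open>\<lambda>x. ball x d\<close> is a bound on the mesh.\<close>

definition L2_riemann_integral ::
  "'a measure \<Rightarrow> (real \<Rightarrow> 'a \<Rightarrow> real) \<Rightarrow> real \<Rightarrow> real \<Rightarrow> ('a \<Rightarrow> real) \<Rightarrow> bool" where
  "L2_riemann_integral P Y a b I \<longleftrightarrow>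
     square_integrable P I \<and>
     (\<forall>e>0. \<exists>d>0. \<forall>p. p tagged_division_of {a..b} \<and> (\<lambda>x. ball x d) fine p \<longrightarrow>
        square_integrable P (\<lambda>\<omega>. \<Sum>(x, K)\<in>p. measure lborel K * Y x \<omega>) \<and>
        (\<integral>\<omega>. ((\<Sum>(x, K)\<in>p. measure lborel K * Y x \<omega>) - I \<omega>)\<^sup>2 \<partial>P) < e)"

text \<open>The integrands may be singular at \<open>0\<close> and the domain \<open>[t,\<infinity>)\<close> is unbounded, so the integrals are
  improper Riemann integrals.\<close>

definition L2_riemann_integral_from_0 ::
  "'a measure \<Rightarrow> (real \<Rightarrow> 'a \<Rightarrow> real) \<Rightarrow> real \<Rightarrow> ('a \<Rightarrow> real) \<Rightarrow> bool" where
  "L2_riemann_integral_from_0 P Y t I \<longleftrightarrow>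
     (\<exists>J. (\<forall>r. 0 < r \<and> r < t \<longrightarrow> L2_riemann_integral P Y r t (J r)) \<and>
          L2_tendsto P J I (at_right 0))"

definition L2_riemann_integral_to_infinity ::
  "'a measure \<Rightarrow> (real \<Rightarrow> 'a \<Rightarrow> real) \<Rightarrow> real \<Rightarrow> ('a \<Rightarrow> real) \<Rightarrow> bool" where
  "L2_riemann_integral_to_infinity P Y t I \<longleftrightarrow>
     (\<exists>J. (\<forall>r>t. L2_riemann_integral P Y t r (J r)) \<and> L2_tendsto P J I at_top)"

end

theory Submission
  imports Defs
begin

text \<open>
  Write \<open>p = \<alpha> + 1/2 > 0\<close> and \<open>I t = \<integral> s powr (p-1-\<beta>) * X s ds\<close> over \<open>[0,t]\<close>, so that
  \<open>Z t = X t - 2p * t powr (\<beta>-p) * I t\<close>.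

  The Volterra process enters through its covariance \<open>R\<close>. By the Wiener isometry \<open>R s t = E (X s * X t)\<close>,
  and self-similarity then makes \<open>R\<close> homogeneous of degree \<open>2\<beta>\<close> (\<open>volterra_covariance_homogeneous\<close>). In
  particular \<open>X t\<close> has \<open>L\<^sup>2\<close> norm \<open>\<sigma> * t powr \<beta>\<close>. Minkowski's integral inequality therefore bounds both improper
  integrals in mean square: the norms of their integrands are multiples of \<open>s powr (p-1)\<close> near \<open>0\<close> and of
  \<open>s powr (-p-1)\<close> near infinity. Their Riemann sums converge because \<open>X\<close> is mean square continuous, and it is so
  because its paths are continuous and almost sure convergence of Gaussian variables implies
  convergence in mean square (\<open>mean_square_uniformly_continuous\<close>).

  The law of \<open>Z\<close> is that of \<open>X\<close>. As a mean square limit of linear combinations of values of \<open>X\<close>,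
  the process \<open>Z\<close> is Gaussian, so its covariance decides (\<open>expectation_cos_L2_span\<close>, and
  \<open>distr_PiM_eqI_cos\<close> to pass from linear combinations to the joint law). With \<open>H s t = E (X s * I t)\<close>
  (\<open>cross_cov\<close>) and \<open>G s t = E (I s * I t)\<close> one finds that \<open>E (Z s * Z t) - R s t\<close> is a multiple of
  \<open>s powr (p-\<beta>) * H s t + t powr (p-\<beta>) * H t s - 2p * G s t\<close>.
  The first two terms are \<open>s * \<partial>\<^sub>s G + t * \<partial>\<^sub>t G\<close>, and \<open>G\<close> is homogeneous of degree \<open>2p\<close>, so the difference is
  \<open>0\<close> by Euler's identity (\<open>Z_integral_euler\<close>).

  The inversion is calculus on a single path: the integrand of the inverse transformation, evaluated at
  \<open>Z\<close>, is the derivative of \<open>t powr (-2p) * I t\<close>, and a similar formula holds in the other direction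
  (\<open>Z_inv_transform_Z_transform\<close>, \<open>Z_transform_Z_inv_transform\<close>). What remains is to find sets of full measure
  between which the two maps are mutually inverse (\<open>Z_automorphism\<close>). There the equality of laws is used
  again, since continuity of \<open>Z\<close> at time \<open>0\<close> is known only almost surely.
\<close>

section \<open>Square integrable functions\<close>

lemma square_integrable_mult:
  assumes "square_integrable M f" "square_integrable M g"
  shows "integrable M (\<lambda>x. f x * g x)"
proof (rule Bochner_Integration.integrable_bound)
  show "integrable M (\<lambda>x. (f x)\<^sup>2 + (g x)\<^sup>2)"
    using assms by (simp add: square_integrable_def)
  show "(\<lambda>x. f x * g x) \<in> borel_measurable M"
    using assms by (auto simp: square_integrable_def)
  have "\<bar>a * b\<bar> \<le> a\<^sup>2 + b\<^sup>2" for a b :: real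
    using sum_squares_bound[of "\<bar>a\<bar>" "\<bar>b\<bar>"] mult_nonneg_nonneg[of "\<bar>a\<bar>" "\<bar>b\<bar>"]
    by (simp add: abs_mult del: mult_nonneg_nonneg)
  then show "AE x in M. norm (f x * g x) \<le> norm ((f x)\<^sup>2 + (g x)\<^sup>2)"
    by (auto simp: abs_of_nonneg)
qed

lemma square_integrable_cmult:
  assumes "square_integrable M f"
  shows "square_integrable M (\<lambda>x. c * f x)"
  using assms by (auto simp: square_integrable_def power_mult_distrib)

lemma square_integrable_add:
  assumes "square_integrable M f" "square_integrable M g"
  shows "square_integrable M (\<lambda>x. f x + g x)"
proof -
  have "integrable M (\<lambda>x. (f x)\<^sup>2 + (g x)\<^sup>2 + 2 * (f x * g x))"
    using assms square_integrable_mult[OF assms] unfolding square_integrable_def by simp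
  then show ?thesis
    using assms by (auto simp: square_integrable_def power2_sum mult.assoc)
qed

lemma square_integrable_diff:
  assumes "square_integrable M f" "square_integrable M g"
  shows "square_integrable M (\<lambda>x. f x - g x)"
  using square_integrable_add[OF assms(1) square_integrable_cmult[OF assms(2), of "-1"]] by simp

lemma square_integrable_zero: "square_integrable M (\<lambda>x. 0)"
  by (simp add: square_integrable_def)

lemma square_integrable_sum:
  assumes "\<And>i. i \<in> S \<Longrightarrow> square_integrable M (f i)"
  shows "square_integrable M (\<lambda>x. \<Sum>i\<in>S. f i x)"
  using assms
proof (induction S rule: infinite_finite_induct)
  case (insert a S)
  then have "square_integrable M (\<lambda>x. f a x + (\<Sum>i\<in>S. f i x))"
    by (intro square_integrable_add) simp_all
  then show ?case using insert.hyps by simp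
qed (simp_all add: square_integrable_zero)

lemma (in finite_measure) square_integrable_imp_integrable:
  "square_integrable M f \<Longrightarrow> integrable M f"
  using square_integrable_mult[of M f "\<lambda>_. 1"] by (simp add: square_integrable_def)

lemma square_integrableI_nn_integral:
  assumes "f \<in> borel_measurable M" "(\<integral>\<^sup>+x. ennreal ((f x)\<^sup>2) \<partial>M) < \<infinity>"
  shows "square_integrable M f"
proof -
  have "integrable M (\<lambda>x. (f x)\<^sup>2)"
    using assms by (intro integrableI_nonneg) simp_all
  then show ?thesis using assms by (simp add: square_integrable_def)
qed

lemma square_integrable_cong_AE:
  assumes "AE x in M. f x = g x" "f \<in> borel_measurable M" "square_integrable M g"
  shows "square_integrable M f"
proof -
  have "integrable M (\<lambda>x. (f x)\<^sup>2) \<longleftrightarrow> integrable M (\<lambda>x. (g x)\<^sup>2)"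
  proof (rule integrable_cong_AE)
    show "(\<lambda>x. (f x)\<^sup>2) \<in> borel_measurable M" using assms by simp
    show "(\<lambda>x. (g x)\<^sup>2) \<in> borel_measurable M" using assms by (auto simp: square_integrable_def)
    show "AE x in M. (f x)\<^sup>2 = (g x)\<^sup>2" using assms(1) by eventually_elim simp
  qed
  then show ?thesis using assms by (simp add: square_integrable_def)
qed

text \<open>The discriminant argument: \<open>\<integral>(u f - v g)\<^sup>2 \<ge> 0\<close> for \<open>u = \<integral>g\<^sup>2\<close>, \<open>v = \<integral>f g\<close>.\<close>

lemma Cauchy_Schwarz_integral:
  assumes f: "square_integrable M f" and g: "square_integrable M g"
  shows "(\<integral>x. f x * g x \<partial>M)\<^sup>2 \<le> (\<integral>x. (f x)\<^sup>2 \<partial>M) * (\<integral>x. (g x)\<^sup>2 \<partial>M)"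
proof -
  let ?a = "\<integral>x. (f x)\<^sup>2 \<partial>M" and ?b = "\<integral>x. f x * g x \<partial>M" and ?c = "\<integral>x. (g x)\<^sup>2 \<partial>M"
  have int: "integrable M (\<lambda>x. (f x)\<^sup>2)" "integrable M (\<lambda>x. (g x)\<^sup>2)" "integrable M (\<lambda>x. f x * g x)"
    using f g square_integrable_mult[OF f g] by (auto simp: square_integrable_def)
  have quad: "0 \<le> u\<^sup>2 * ?a - 2 * u * v * ?b + v\<^sup>2 * ?c" for u v
  proof -
    have "0 \<le> (\<integral>x. (u * f x - v * g x)\<^sup>2 \<partial>M)" by simp
    also have "(\<lambda>x. (u * f x - v * g x)\<^sup>2) = (\<lambda>x. u\<^sup>2 * (f x)\<^sup>2 - (2 * u * v) * (f x * g x) + v\<^sup>2 * (g x)\<^sup>2)"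
      by (auto simp: power2_eq_square algebra_simps)
    also have "(\<integral>x. u\<^sup>2 * (f x)\<^sup>2 - (2 * u * v) * (f x * g x) + v\<^sup>2 * (g x)\<^sup>2 \<partial>M)
       = u\<^sup>2 * ?a - 2 * u * v * ?b + v\<^sup>2 * ?c"
      using int by simp
    finally show ?thesis .
  qed
  have a: "?a \<ge> 0" and c: "?c \<ge> 0" by simp_all
  show ?thesis
  proof (cases "?c = 0")
    case True
    have "?b = 0"
    proof (rule ccontr)
      assume "?b \<noteq> 0"
      have "0 \<le> ?a - 2 * ((?a + 1) / (2 * ?b)) * ?b"
        using quad[of 1 "(?a + 1) / (2 * ?b)"] True by simp
      also have "\<dots> = -1" using \<open>?b \<noteq> 0\<close> by (simp add: field_simps)
      finally show False by simp
    qed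
    then show ?thesis using True by simp
  next
    case False
    have "0 \<le> ?c\<^sup>2 * ?a - 2 * ?c * ?b * ?b + ?b\<^sup>2 * ?c" using quad[of ?c ?b] .
    also have "\<dots> = ?c * (?a * ?c - ?b\<^sup>2)" by (simp add: power2_eq_square algebra_simps)
    finally have "0 \<le> ?a * ?c - ?b\<^sup>2" using False c by (simp add: zero_le_mult_iff)
    then show ?thesis by simp
  qed
qed

lemma abs_integral_mult_le:
  assumes f: "square_integrable M f" and g: "square_integrable M g"
  shows "\<bar>\<integral>x. f x * g x \<partial>M\<bar> \<le> sqrt (\<integral>x. (f x)\<^sup>2 \<partial>M) * sqrt (\<integral>x. (g x)\<^sup>2 \<partial>M)"
  using Cauchy_Schwarz_integral[OF assms]
  by (metis real_sqrt_abs real_sqrt_le_iff real_sqrt_mult)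

lemma integral_square_add_le:
  assumes f: "square_integrable M f" and g: "square_integrable M g"
  shows "(\<integral>x. (f x + g x)\<^sup>2 \<partial>M) \<le> 2 * (\<integral>x. (f x)\<^sup>2 \<partial>M) + 2 * (\<integral>x. (g x)\<^sup>2 \<partial>M)"
proof -
  have "(\<integral>x. (f x + g x)\<^sup>2 \<partial>M) \<le> (\<integral>x. 2 * (f x)\<^sup>2 + 2 * (g x)\<^sup>2 \<partial>M)"
    using f g square_integrable_add[OF f g]
    by (intro integral_mono) (auto simp: square_integrable_def power2_sum intro: order_trans[OF sum_squares_bound])
  also have "\<dots> = 2 * (\<integral>x. (f x)\<^sup>2 \<partial>M) + 2 * (\<integral>x. (g x)\<^sup>2 \<partial>M)"
    using f g by (simp add: square_integrable_def)
  finally show ?thesis .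
qed

lemma L2_tendsto_integral_mult:
  assumes f: "L2_tendsto M f f' F" and g: "L2_tendsto M g g' F"
  shows "((\<lambda>i. \<integral>x. f i x * g i x \<partial>M) \<longlongrightarrow> (\<integral>x. f' x * g' x \<partial>M)) F"
proof -
  let ?n = "\<lambda>h. sqrt (\<integral>x. (h x)\<^sup>2 \<partial>M)"
  let ?u = "\<lambda>i x. f i x - f' x" and ?v = "\<lambda>i x. g i x - g' x"
  let ?B = "\<lambda>i. ?n (?u i) * ?n (?v i) + ?n (?u i) * ?n g' + ?n f' * ?n (?v i)"
  have "(?B \<longlongrightarrow> sqrt 0 * sqrt 0 + sqrt 0 * ?n g' + ?n f' * sqrt 0) F"
    using f g unfolding L2_tendsto_def by (intro tendsto_intros) auto
  then have B: "(?B \<longlongrightarrow> 0) F" by simp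
  have "\<forall>\<^sub>F i in F. \<bar>(\<integral>x. f i x * g i x \<partial>M) - (\<integral>x. f' x * g' x \<partial>M)\<bar> \<le> ?B i"
  proof -
    have "\<forall>\<^sub>F i in F. square_integrable M (f i) \<and> square_integrable M (g i)"
      using f g by (auto simp: L2_tendsto_def eventually_conj_iff)
    then show ?thesis
    proof eventually_elim
      case (elim i)
      have s: "square_integrable M f'" "square_integrable M g'" using f g by (auto simp: L2_tendsto_def)
      have uv: "square_integrable M (?u i)" "square_integrable M (?v i)"
        using elim s by (auto intro: square_integrable_diff)
      have i: "integrable M (\<lambda>x. ?u i x * ?v i x)" "integrable M (\<lambda>x. ?u i x * g' x)" "integrable M (\<lambda>x. f' x * ?v i x)"
        "integrable M (\<lambda>x. f i x * g i x)" "integrable M (\<lambda>x. f' x * g' x)"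
        using elim s uv by (auto intro: square_integrable_mult)
      have "(\<integral>x. f i x * g i x \<partial>M) - (\<integral>x. f' x * g' x \<partial>M) = (\<integral>x. f i x * g i x - f' x * g' x \<partial>M)"
        using i by simp
      also have "\<dots> = (\<integral>x. ?u i x * ?v i x + ?u i x * g' x + f' x * ?v i x \<partial>M)"
        by (intro Bochner_Integration.integral_cong) (auto simp: algebra_simps)
      also have "\<dots> = (\<integral>x. ?u i x * ?v i x \<partial>M) + (\<integral>x. ?u i x * g' x \<partial>M) + (\<integral>x. f' x * ?v i x \<partial>M)"
        using i by simp
      finally have "\<bar>(\<integral>x. f i x * g i x \<partial>M) - (\<integral>x. f' x * g' x \<partial>M)\<bar> \<le>
          \<bar>\<integral>x. ?u i x * ?v i x \<partial>M\<bar> + \<bar>\<integral>x. ?u i x * g' x \<partial>M\<bar> + \<bar>\<integral>x. f' x * ?v i x \<partial>M\<bar>" by linarith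
      also have "\<dots> \<le> ?B i"
        by (intro add_mono abs_integral_mult_le uv s)
      finally show ?case .
    qed
  qed
  then have "((\<lambda>i. (\<integral>x. f i x * g i x \<partial>M) - (\<integral>x. f' x * g' x \<partial>M)) \<longlongrightarrow> 0) F"
    by (intro Lim_null_comparison[OF _ B]) simp
  then show ?thesis by (rule LIM_zero_cancel)
qed

lemma nn_integral_abs_mult_le:
  assumes [measurable]: "f \<in> borel_measurable M" "g \<in> borel_measurable M"
    and f: "(\<integral>\<^sup>+x. ennreal ((f x)\<^sup>2) \<partial>M) \<le> ennreal (a\<^sup>2)" and g: "(\<integral>\<^sup>+x. ennreal ((g x)\<^sup>2) \<partial>M) \<le> ennreal (b\<^sup>2)"
    and "0 \<le> a" "0 \<le> b"
  shows "(\<integral>\<^sup>+x. ennreal \<bar>f x * g x\<bar> \<partial>M) \<le> ennreal (a * b)"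
proof -
  have sf: "square_integrable M f" and sg: "square_integrable M g"
    using f g by (auto intro!: square_integrableI_nn_integral simp: le_less_trans)
  have If: "(\<integral>x. \<bar>f x\<bar>\<^sup>2 \<partial>M) \<le> a\<^sup>2" and Ig: "(\<integral>x. \<bar>g x\<bar>\<^sup>2 \<partial>M) \<le> b\<^sup>2"
    using f g sf sg by (auto simp: square_integrable_def nn_integral_eq_integral)
  have s': "square_integrable M (\<lambda>x. \<bar>f x\<bar>)" "square_integrable M (\<lambda>x. \<bar>g x\<bar>)"
    using sf sg by (auto simp: square_integrable_def)
  have "(\<integral>\<^sup>+x. ennreal \<bar>f x * g x\<bar> \<partial>M) = ennreal (\<integral>x. \<bar>f x\<bar> * \<bar>g x\<bar> \<partial>M)"
    using square_integrable_mult[OF s'] by (subst nn_integral_eq_integral[symmetric]) (auto simp: abs_mult)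
  also have "\<dots> \<le> ennreal (a * b)"
  proof (rule ennreal_leI)
    have "(\<integral>x. \<bar>f x\<bar> * \<bar>g x\<bar> \<partial>M) \<le> sqrt (\<integral>x. \<bar>f x\<bar>\<^sup>2 \<partial>M) * sqrt (\<integral>x. \<bar>g x\<bar>\<^sup>2 \<partial>M)"
      using abs_integral_mult_le[OF s'] by linarith
    also have "\<dots> \<le> a * b"
      using If Ig assms(5,6) by (intro mult_mono real_le_lsqrt real_sqrt_ge_zero) auto
    finally show "(\<integral>x. \<bar>f x\<bar> * \<bar>g x\<bar> \<partial>M) \<le> a * b" .
  qed
  finally show ?thesis .
qed

text \<open>Minkowski's integral inequality for the exponent \<open>2\<close>: square, exchange expectation and
  integrations (Tonelli), and apply Cauchy-Schwarz to each product \<open>U s * U t\<close>.\<close>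

lemma Minkowski_integral_inequality_2:
  fixes U :: "'b \<Rightarrow> 'a \<Rightarrow> real"
  assumes "sigma_finite_measure M" "sigma_finite_measure N"
    and U[measurable]: "(\<lambda>(x, s). U s x) \<in> borel_measurable (M \<Otimes>\<^sub>M N)"
    and b[measurable]: "b \<in> borel_measurable N"
    and b0: "\<And>s. s \<in> space N \<Longrightarrow> 0 \<le> b s"
    and Ub: "\<And>s. s \<in> space N \<Longrightarrow> (\<integral>\<^sup>+x. ennreal ((U s x)\<^sup>2) \<partial>M) \<le> ennreal ((b s)\<^sup>2)"
  shows "(\<integral>\<^sup>+x. (\<integral>\<^sup>+s. ennreal \<bar>U s x\<bar> \<partial>N)\<^sup>2 \<partial>M) \<le> (\<integral>\<^sup>+s. ennreal (b s) \<partial>N)\<^sup>2"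
proof -
  interpret M: sigma_finite_measure M by fact
  interpret N: sigma_finite_measure N by fact
  interpret MN: pair_sigma_finite M N ..
  interpret NM: pair_sigma_finite N M ..
  define V where "V = (\<lambda>(x, s). U s x)"
  have V[measurable]: "V \<in> borel_measurable (M \<Otimes>\<^sub>M N)" using U by (simp add: V_def)
  have UV: "U s x = V (x, s)" for s x by (simp add: V_def)
  have "(\<integral>\<^sup>+x. (\<integral>\<^sup>+s. ennreal \<bar>U s x\<bar> \<partial>N)\<^sup>2 \<partial>M) = (\<integral>\<^sup>+x. \<integral>\<^sup>+s. \<integral>\<^sup>+t. ennreal \<bar>U s x * U t x\<bar> \<partial>N \<partial>N \<partial>M)"
  proof (rule nn_integral_cong)
    fix x assume x[measurable]: "x \<in> space M"
    have "(\<integral>\<^sup>+s. \<integral>\<^sup>+t. ennreal \<bar>U s x * U t x\<bar> \<partial>N \<partial>N) = (\<integral>\<^sup>+s. ennreal \<bar>U s x\<bar> * (\<integral>\<^sup>+t. ennreal \<bar>U t x\<bar> \<partial>N) \<partial>N)"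
      unfolding UV by (simp add: abs_mult ennreal_mult nn_integral_cmult)
    also have "\<dots> = (\<integral>\<^sup>+s. ennreal \<bar>U s x\<bar> \<partial>N)\<^sup>2"
      unfolding UV by (simp add: nn_integral_multc power2_eq_square)
    finally show "(\<integral>\<^sup>+s. ennreal \<bar>U s x\<bar> \<partial>N)\<^sup>2 = (\<integral>\<^sup>+s. \<integral>\<^sup>+t. ennreal \<bar>U s x * U t x\<bar> \<partial>N \<partial>N)" ..
  qed
  also have "\<dots> = (\<integral>\<^sup>+s. \<integral>\<^sup>+x. \<integral>\<^sup>+t. ennreal \<bar>U s x * U t x\<bar> \<partial>N \<partial>M \<partial>N)"
    unfolding UV by (rule NM.Fubini') measurable
  also have "\<dots> = (\<integral>\<^sup>+s. \<integral>\<^sup>+t. \<integral>\<^sup>+x. ennreal \<bar>U s x * U t x\<bar> \<partial>M \<partial>N \<partial>N)"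
    unfolding UV by (intro nn_integral_cong NM.Fubini') measurable
  also have "\<dots> \<le> (\<integral>\<^sup>+s. \<integral>\<^sup>+t. ennreal (b s * b t) \<partial>N \<partial>N)"
    using V by (intro nn_integral_mono nn_integral_abs_mult_le Ub b0) (simp_all add: UV)
  also have "\<dots> = (\<integral>\<^sup>+s. ennreal (b s) * (\<integral>\<^sup>+t. ennreal (b t) \<partial>N) \<partial>N)"
    by (intro nn_integral_cong) (simp add: b0 ennreal_mult nn_integral_cmult[symmetric] cong: nn_integral_cong)
  also have "\<dots> = (\<integral>\<^sup>+s. ennreal (b s) \<partial>N)\<^sup>2"
    by (simp add: nn_integral_multc power2_eq_square)
  finally show ?thesis .
qed

section \<open>The Wiener isometry and the covariance of a Volterra process\<close>

lemma (in prob_space) normal_second_moment: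
  assumes "0 < \<sigma>" and D: "distributed M lborel Y (normal_density 0 \<sigma>)"
  shows "square_integrable M Y" "expectation (\<lambda>x. (Y x)\<^sup>2) = \<sigma>\<^sup>2"
proof -
  have "integrable M (\<lambda>x. (Y x)\<^sup>2)"
    using distributed_integrable[OF D, of "\<lambda>x. x\<^sup>2"] integrable_normal_moment[OF assms(1), of 0 2] by simp
  moreover have "Y \<in> borel_measurable M"
    using distributed_measurable[OF D] by simp
  ultimately show "square_integrable M Y" by (simp add: square_integrable_def)
  show "expectation (\<lambda>x. (Y x)\<^sup>2) = \<sigma>\<^sup>2"
    using normal_distributed_variance[OF assms] normal_distributed_expectation[OF assms] by simp
qed

context
  fixes M :: "'a measure" and W :: "real \<Rightarrow> 'a \<Rightarrow> real"
  assumes M: "prob_space M" and BM: "standard_brownian_motion M W"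
begin

interpretation prob_space M by (rule M)

lemma brownian_motion_increment:
  assumes "0 \<le> s" "s \<le> t"
  shows "square_integrable M (\<lambda>\<omega>. W t \<omega> - W s \<omega>)" "(\<integral>\<omega>. (W t \<omega> - W s \<omega>)\<^sup>2 \<partial>M) = t - s"
proof -
  have "square_integrable M (\<lambda>\<omega>. W t \<omega> - W s \<omega>) \<and> (\<integral>\<omega>. (W t \<omega> - W s \<omega>)\<^sup>2 \<partial>M) = t - s"
  proof (cases "s = t")
    case False
    then have "distributed M lborel (\<lambda>\<omega>. W t \<omega> - W s \<omega>) (normal_density 0 (sqrt (t - s)))"
      using BM assms by (auto simp: standard_brownian_motion_def)
    from normal_second_moment[OF _ this] False assms show ?thesis by simp
  qed (simp add: square_integrable_zero)
  then show "square_integrable M (\<lambda>\<omega>. W t \<omega> - W s \<omega>)" "(\<integral>\<omega>. (W t \<omega> - W s \<omega>)\<^sup>2 \<partial>M) = t - s" by auto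
qed

lemma square_integrable_brownian_motion:
  assumes "0 \<le> t" shows "square_integrable M (W t)"
proof (rule square_integrable_cong_AE)
  show "square_integrable M (\<lambda>\<omega>. W t \<omega> - W 0 \<omega>)" by (rule brownian_motion_increment) (use assms in auto)
  show "W t \<in> borel_measurable M" using BM assms by (auto simp: standard_brownian_motion_def)
  have "AE \<omega> in M. W 0 \<omega> = 0" using BM by (auto simp: standard_brownian_motion_def)
  then show "AE \<omega> in M. W t \<omega> = W t \<omega> - W 0 \<omega>" by eventually_elim simp
qed

text \<open>Polarisation of \<open>E (W t - W s)\<^sup>2 = t - s\<close>; the starting value \<open>W 0 = 0\<close> supplies the second moments.\<close>

lemma brownian_motion_covariance:
  assumes "0 \<le> s" "0 \<le> t"
  shows "(\<integral>\<omega>. W s \<omega> * W t \<omega> \<partial>M) = min s t"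
proof -
  have W0: "AE \<omega> in M. W 0 \<omega> = 0" using BM by (auto simp: standard_brownian_motion_def)
  have var: "(\<integral>\<omega>. (W t \<omega>)\<^sup>2 \<partial>M) = t" if "0 \<le> t" for t
  proof -
    have "(\<integral>\<omega>. (W t \<omega>)\<^sup>2 \<partial>M) = (\<integral>\<omega>. (W t \<omega> - W 0 \<omega>)\<^sup>2 \<partial>M)"
    proof (rule integral_cong_AE)
      show "AE \<omega> in M. (W t \<omega>)\<^sup>2 = (W t \<omega> - W 0 \<omega>)\<^sup>2" using W0 by eventually_elim simp
    qed (use that square_integrable_brownian_motion[of t] square_integrable_brownian_motion[of 0]
         in \<open>auto simp: square_integrable_def\<close>)
    then show ?thesis using brownian_motion_increment[of 0 t] that by simp
  qed
  have *: "(\<integral>\<omega>. W s \<omega> * W t \<omega> \<partial>M) = s" if "0 \<le> s" "s \<le> t" for s t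
  proof -
    have sq: "square_integrable M (W s)" "square_integrable M (W t)"
      using that by (auto intro: square_integrable_brownian_motion)
    then have i: "integrable M (\<lambda>\<omega>. (W s \<omega>)\<^sup>2)" "integrable M (\<lambda>\<omega>. (W t \<omega>)\<^sup>2)" "integrable M (\<lambda>\<omega>. W s \<omega> * W t \<omega>)"
      using square_integrable_mult[OF sq] by (auto simp: square_integrable_def)
    have "t - s = (\<integral>\<omega>. (W t \<omega> - W s \<omega>)\<^sup>2 \<partial>M)" using brownian_motion_increment[OF that] by simp
    also have "\<dots> = (\<integral>\<omega>. (W t \<omega>)\<^sup>2 + (W s \<omega>)\<^sup>2 - 2 * (W s \<omega> * W t \<omega>) \<partial>M)"
      by (intro Bochner_Integration.integral_cong) (auto simp: power2_eq_square algebra_simps)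
    also have "\<dots> = t + s - 2 * (\<integral>\<omega>. W s \<omega> * W t \<omega> \<partial>M)"
      using i var that by simp
    finally show ?thesis by simp
  qed
  show ?thesis
  proof (cases "s \<le> t")
    case False
    then show ?thesis using *[of t s] assms by (simp add: mult.commute)
  qed (use *[of s t] assms in simp)
qed

lemma brownian_motion_increments_covariance:
  assumes "0 \<le> a" "a \<le> b" "0 \<le> c" "c \<le> d"
  shows "(\<integral>\<omega>. (W b \<omega> - W a \<omega>) * (W d \<omega> - W c \<omega>) \<partial>M)
    = (\<integral>s. indicator {a<..b} s * indicator {c<..d} s \<partial>lebesgue_on {0..})"
proof -
  have [intro]: "0 \<le> s \<Longrightarrow> 0 \<le> t \<Longrightarrow> integrable M (\<lambda>\<omega>. W s \<omega> * W t \<omega>)" for s t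
    by (intro square_integrable_mult square_integrable_brownian_motion)
  have 0: "0 \<le> b" "0 \<le> d" using assms by auto
  have "(\<integral>\<omega>. (W b \<omega> - W a \<omega>) * (W d \<omega> - W c \<omega>) \<partial>M)
     = (\<integral>\<omega>. W b \<omega> * W d \<omega> - W b \<omega> * W c \<omega> - (W a \<omega> * W d \<omega> - W a \<omega> * W c \<omega>) \<partial>M)"
    by (intro Bochner_Integration.integral_cong) (auto simp: algebra_simps)
  also have "\<dots> = min b d - min b c - (min a d - min a c)"
    using assms 0 by (subst Bochner_Integration.integral_diff, force, force)+
      (simp add: brownian_motion_covariance)
  also have "\<dots> = max 0 (min b d - max a c)"
    using assms by (auto simp: min_def max_def)
  also have "\<dots> = measure lebesgue ({a<..b} \<inter> {c<..d} \<inter> {0..})"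
  proof -
    have "{a<..b} \<inter> {c<..d} \<inter> {0..} = {max a c<..min b d}" using assms by auto
    moreover have "measure lebesgue {u<..v} = max 0 (v - u)" for u v :: real
      by (cases "u \<le> v") simp_all
    ultimately show ?thesis by simp
  qed
  also have "\<dots> = (\<integral>s. indicator ({a<..b} \<inter> {c<..d}) s \<partial>lebesgue_on {0..})"
    by (subst integral_restrict_space) (simp_all flip: indicator_inter_arith add: Int_commute)
  finally show ?thesis unfolding indicator_inter_arith .
qed

lemma square_integrable_step_function:
  "square_integrable (lebesgue_on {0..}) (step_function xs)"
proof (induction xs)
  case (Cons x xs)
  obtain c a b where x: "x = (c, a, b)" by (cases x)
  have "integrable (lebesgue_on {0..}) (indicator {a<..b} :: real \<Rightarrow> real)"
  proof -
    have "{0..} \<inter> {a<..b} \<in> lmeasurable"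
      by (intro fmeasurableI2[OF lmeasurable_cbox[of a b]]) auto
    then have "integrable lebesgue (indicator ({0..} \<inter> {a<..b}) :: real \<Rightarrow> real)"
      by (subst integrable_indicator_iff) (simp_all add: fmeasurable_def)
    then show ?thesis
      by (simp add: integrable_restrict_space flip: indicator_inter_arith)
  qed
  then have "square_integrable (lebesgue_on {0..}) (indicator {a<..b})"
  proof -
    have "(\<lambda>s. (indicator {a<..b} s :: real)\<^sup>2) = indicator {a<..b}" by (auto simp: indicator_def)
    moreover assume "integrable (lebesgue_on {0..}) (indicator {a<..b} :: real \<Rightarrow> real)"
    ultimately show ?thesis using borel_measurable_integrable unfolding square_integrable_def by metis
  qed
  then have "square_integrable (lebesgue_on {0..}) (\<lambda>s. c * indicator {a<..b} s + step_function xs s)"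
    using Cons by (intro square_integrable_add square_integrable_cmult)
  then show ?case by (simp add: x step_function_def)
qed (simp add: step_function_def square_integrable_zero)

lemma integral_cmult_add_mult:
  assumes "integrable N (\<lambda>x. f x * h x)" "integrable N (\<lambda>x. g x * h x)"
  shows "(\<integral>x. (c * f x + g x) * h x \<partial>N) = c * (\<integral>x. f x * h x \<partial>N) + (\<integral>x. g x * h x \<partial>N :: real)"
  using assms by (simp add: distrib_right mult.assoc)

lemma square_integrable_step_integral:
  assumes "\<forall>(c, a, b)\<in>set xs. 0 \<le> a \<and> a \<le> b"
  shows "square_integrable M (step_integral W xs)"
  using assms
proof (induction xs)
  case (Cons x xs)
  obtain c a b where x: "x = (c, a, b)" by (cases x)
  have "square_integrable M (\<lambda>\<omega>. c * (W b \<omega> - W a \<omega>) + step_integral W xs \<omega>)"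
    using Cons x by (intro square_integrable_add square_integrable_cmult brownian_motion_increment) auto
  then show ?case by (simp add: x step_integral_def)
next
  case Nil
  have "step_integral W [] = (\<lambda>_. 0)" by (auto simp: step_integral_def)
  then show ?case by (simp add: square_integrable_zero)
qed

text \<open>Both sides are bilinear in the step functions, which reduces the identity to single intervals.\<close>

lemma step_integral_isometry:
  assumes xs: "\<forall>(c, a, b)\<in>set xs. 0 \<le> a \<and> a \<le> b" and ys: "\<forall>(c, a, b)\<in>set ys. 0 \<le> a \<and> a \<le> b"
  shows "(\<integral>\<omega>. step_integral W xs \<omega> * step_integral W ys \<omega> \<partial>M)
    = (\<integral>s. step_function xs s * step_function ys s \<partial>lebesgue_on {0..})"
proof -
  let ?L = "lebesgue_on {0::real..}"
  have Cons_eq: "step_integral W ((c, a, b) # zs) = (\<lambda>\<omega>. c * (W b \<omega> - W a \<omega>) + step_integral W zs \<omega>)"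
    "step_function ((c, a, b) # zs) = (\<lambda>s. c * indicator {a<..b} s + step_function zs s)" for c a b zs
    by (auto simp: step_integral_def step_function_def)
  have ind: "square_integrable ?L (indicator {a<..b})" for a b :: real
    using square_integrable_step_function[of "[(1, a, b)]"] by (simp add: step_function_def[abs_def])
  have single: "(\<integral>\<omega>. (W b \<omega> - W a \<omega>) * step_integral W ys \<omega> \<partial>M)
      = (\<integral>s. indicator {a<..b} s * step_function ys s \<partial>?L)" if ab: "0 \<le> a" "a \<le> b" for a b
    using ys
  proof (induction ys)
    case (Cons y ys)
    obtain c' a' b' where y: "y = (c', a', b')" by (cases y)
    with Cons have *: "0 \<le> a'" "a' \<le> b'" "\<forall>(c, a, b)\<in>set ys. 0 \<le> a \<and> a \<le> b" by auto
    have "(\<integral>\<omega>. (c' * (W b' \<omega> - W a' \<omega>) + step_integral W ys \<omega>) * (W b \<omega> - W a \<omega>) \<partial>M)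
       = c' * (\<integral>\<omega>. (W b' \<omega> - W a' \<omega>) * (W b \<omega> - W a \<omega>) \<partial>M) + (\<integral>\<omega>. step_integral W ys \<omega> * (W b \<omega> - W a \<omega>) \<partial>M)"
      by (intro integral_cmult_add_mult square_integrable_mult brownian_motion_increment
           square_integrable_step_integral ab *)
    also have "\<dots> = c' * (\<integral>s. indicator {a'<..b'} s * indicator {a<..b} s \<partial>?L) + (\<integral>s. step_function ys s * indicator {a<..b} s \<partial>?L)"
      using Cons.IH[OF *(3)] brownian_motion_increments_covariance[OF *(1,2) ab] by (simp add: mult.commute)
    also have "\<dots> = (\<integral>s. (c' * indicator {a'<..b'} s + step_function ys s) * indicator {a<..b} s \<partial>?L)"
      by (intro integral_cmult_add_mult[symmetric] square_integrable_mult ind square_integrable_step_function)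
    finally show ?case by (simp add: y Cons_eq mult.commute)
  qed (simp add: step_integral_def step_function_def)
  show ?thesis using xs
  proof (induction xs)
    case (Cons x xs)
    obtain c a b where x: "x = (c, a, b)" by (cases x)
    with Cons have *: "0 \<le> a" "a \<le> b" "\<forall>(c, a, b)\<in>set xs. 0 \<le> a \<and> a \<le> b" by auto
    have "(\<integral>\<omega>. (c * (W b \<omega> - W a \<omega>) + step_integral W xs \<omega>) * step_integral W ys \<omega> \<partial>M)
       = c * (\<integral>\<omega>. (W b \<omega> - W a \<omega>) * step_integral W ys \<omega> \<partial>M) + (\<integral>\<omega>. step_integral W xs \<omega> * step_integral W ys \<omega> \<partial>M)"
      by (intro integral_cmult_add_mult square_integrable_mult brownian_motion_increment
           square_integrable_step_integral * ys)
    also have "\<dots> = c * (\<integral>s. indicator {a<..b} s * step_function ys s \<partial>?L) + (\<integral>s. step_function xs s * step_function ys s \<partial>?L)"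
      using Cons.IH[OF *(3)] single[OF *(1,2)] by simp
    also have "\<dots> = (\<integral>s. (c * indicator {a<..b} s + step_function xs s) * step_function ys s \<partial>?L)"
      by (intro integral_cmult_add_mult[symmetric] square_integrable_mult ind square_integrable_step_function)
    finally show ?case by (simp add: x Cons_eq)
  qed (simp add: step_integral_def step_function_def)
qed

text \<open>Inner products are continuous for mean square convergence, so the isometry passes from step functions
  to their limits.\<close>

lemma Wiener_isometry:
  assumes "is_wiener_integral M W f Y" "is_wiener_integral M W g V"
  shows "(\<integral>\<omega>. Y \<omega> * V \<omega> \<partial>M) = (\<integral>s. f s * g s \<partial>lebesgue_on {0..})"
proof -
  let ?L = "lebesgue_on {0::real..}"
  obtain xs where xs: "\<And>n. \<forall>(c, a, b)\<in>set (xs n). 0 \<le> a \<and> a \<le> b"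
    "L2_tendsto ?L (\<lambda>n. step_function (xs n)) f sequentially"
    "L2_tendsto M (\<lambda>n. step_integral W (xs n)) Y sequentially"
    using assms(1) unfolding is_wiener_integral_def by blast
  obtain ys where ys: "\<And>n. \<forall>(c, a, b)\<in>set (ys n). 0 \<le> a \<and> a \<le> b"
    "L2_tendsto ?L (\<lambda>n. step_function (ys n)) g sequentially"
    "L2_tendsto M (\<lambda>n. step_integral W (ys n)) V sequentially"
    using assms(2) unfolding is_wiener_integral_def by blast
  have "(\<lambda>n. \<integral>\<omega>. step_integral W (xs n) \<omega> * step_integral W (ys n) \<omega> \<partial>M) \<longlonglongrightarrow> (\<integral>s. f s * g s \<partial>?L)"
    unfolding step_integral_isometry[OF xs(1) ys(1)] by (rule L2_tendsto_integral_mult[OF xs(2) ys(2)])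
  with L2_tendsto_integral_mult[OF xs(3) ys(3)] show ?thesis by (rule LIMSEQ_unique)
qed

end

lemma volterra_process_covariance:
  assumes X: "volterra_gaussian_process M W z X" and st: "0 \<le> s" "0 \<le> t"
  shows "(\<integral>\<omega>. X s \<omega> * X t \<omega> \<partial>M) = volterra_covariance z s t"
proof -
  have "(\<integral>\<omega>. X s \<omega> * X t \<omega> \<partial>M) = (\<integral>u. (indicator {0..s} u * z s u) * (indicator {0..t} u * z t u) \<partial>lebesgue_on {0..})"
  proof (rule Wiener_isometry)
    show "prob_space M" "standard_brownian_motion M W"
      using X by (simp_all only: volterra_gaussian_process_def)
    show "is_wiener_integral M W (\<lambda>u. indicator {0..s} u * z s u) (X s)"
      "is_wiener_integral M W (\<lambda>u. indicator {0..t} u * z t u) (X t)"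
      using X st by (simp_all only: volterra_gaussian_process_def)
  qed
  also have "\<dots> = (\<integral>u. indicator {0..min s t} u *\<^sub>R (z s u * z t u) \<partial>lebesgue)"
    by (subst integral_restrict_space, simp, rule Bochner_Integration.integral_cong)
      (auto simp: indicator_def)
  also have "\<dots> = (\<integral>u. z s u * z t u \<partial>lebesgue_on {0..min s t})"
    by (rule integral_restrict_space[symmetric]) simp
  finally show ?thesis by (simp add: volterra_covariance_def)
qed

text \<open>Equality of the laws of \<open>(X (a s), X (a t))\<close> and \<open>a\<^sup>\<beta> (X s, X t)\<close> gives equality of the expected products.\<close>

lemma volterra_covariance_homogeneous:
  assumes X: "volterra_gaussian_process M W z X" and ss: "self_similar M \<beta> X"
    and a: "0 < a" and st: "0 \<le> s" "0 \<le> t"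
  shows "volterra_covariance z (a * s) (a * t) = a powr (2 * \<beta>) * volterra_covariance z s t"
proof -
  let ?J = "{s, t}" and ?N = "Pi\<^sub>M {s, t} (\<lambda>_. borel :: real measure)"
  have mX: "X u \<in> borel_measurable M" if "0 \<le> u" for u
  proof -
    have "is_wiener_integral M W (\<lambda>s. indicator {0..u} s * z u s) (X u)"
      using X that unfolding volterra_gaussian_process_def by simp
    then show ?thesis
      unfolding is_wiener_integral_def L2_tendsto_def square_integrable_def by (elim exE conjE)
  qed
  have g[measurable]: "(\<lambda>x. x s * x t) \<in> borel_measurable ?N"
    by (intro borel_measurable_times measurable_component_singleton) auto
  have m1: "(\<lambda>\<omega>. \<lambda>u\<in>?J. X (a * u) \<omega>) \<in> measurable M ?N"
    by (rule measurable_restrict, rule mX) (use a st in auto)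
  have m2: "(\<lambda>\<omega>. \<lambda>u\<in>?J. a powr \<beta> * X u \<omega>) \<in> measurable M ?N"
    by (rule measurable_restrict, rule borel_measurable_times[OF borel_measurable_const mX]) (use st in auto)
  have "distr M ?N (\<lambda>\<omega>. \<lambda>u\<in>?J. X (a * u) \<omega>) = distr M ?N (\<lambda>\<omega>. \<lambda>u\<in>?J. a powr \<beta> * X u \<omega>)"
    using ss[unfolded self_similar_def, rule_format, of a ?J] a st by simp
  then have "(\<integral>x. x s * x t \<partial>distr M ?N (\<lambda>\<omega>. \<lambda>u\<in>?J. X (a * u) \<omega>)) = (\<integral>x. x s * x t \<partial>distr M ?N (\<lambda>\<omega>. \<lambda>u\<in>?J. a powr \<beta> * X u \<omega>))"
    by simp
  then have "(\<integral>\<omega>. X (a * s) \<omega> * X (a * t) \<omega> \<partial>M) = (\<integral>\<omega>. (a powr \<beta>)\<^sup>2 * (X s \<omega> * X t \<omega>) \<partial>M)"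
    unfolding integral_distr[OF m1 g] integral_distr[OF m2 g] by (simp add: power2_eq_square mult_ac)
  moreover have "(a powr \<beta>)\<^sup>2 = a powr (2 * \<beta>)" by (simp add: power2_eq_square powr_add[symmetric])
  ultimately show ?thesis using volterra_process_covariance[OF X] a st by simp
qed

section \<open>Laws determined by linear combinations\<close>

text \<open>The nonnegative weights \<open>1 + cos (\<theta> x + \<psi>)\<close> carry the same information as the characteristic
  function, and nonnegativity allows an expectation weighted with them to be read as a measure.\<close>

definition trig_weight :: "real \<Rightarrow> real \<Rightarrow> real \<Rightarrow> real" where
  "trig_weight \<theta> \<psi> x = 1 + cos (\<theta> * x + \<psi>)"

lemma trig_weight_measurable[measurable]: "trig_weight \<theta> \<psi> \<in> borel_measurable borel"
  unfolding trig_weight_def by measurable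

lemma trig_weight_nonneg: "0 \<le> trig_weight \<theta> \<psi> x"
  unfolding trig_weight_def using cos_ge_minus_one[of "\<theta> * x + \<psi>"] by linarith

lemma trig_weight_le: "trig_weight \<theta> \<psi> x \<le> 2"
  unfolding trig_weight_def using cos_le_one[of "\<theta> * x + \<psi>"] by linarith

lemma prod_trig_weight_bounds:
  "0 \<le> (\<Prod>i\<in>S. trig_weight (\<theta> i) (\<psi> i) (x i))" "(\<Prod>i\<in>S. trig_weight (\<theta> i) (\<psi> i) (x i)) \<le> 2 ^ card S"
  using prod_mono[of S "\<lambda>i. trig_weight (\<theta> i) (\<psi> i) (x i)" "\<lambda>_. 2"]
  by (auto intro: prod_nonneg trig_weight_nonneg trig_weight_le)

lemma (in prob_space) integrable_cos_prod_trig_weight: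
  assumes [measurable]: "L \<in> borel_measurable M" and S: "\<And>i. i \<in> S \<Longrightarrow> X i \<in> borel_measurable M"
  shows "integrable M (\<lambda>\<omega>. cos (L \<omega>) * (\<Prod>i\<in>S. trig_weight (\<theta> i) (\<psi> i) (X i \<omega>)))"
proof (rule integrable_const_bound[where B="2 ^ card S"])
  show "AE \<omega> in M. norm (cos (L \<omega>) * (\<Prod>i\<in>S. trig_weight (\<theta> i) (\<psi> i) (X i \<omega>))) \<le> 2 ^ card S"
  proof (rule AE_I2)
    fix \<omega>
    have "\<bar>cos (L \<omega>)\<bar> * \<bar>\<Prod>i\<in>S. trig_weight (\<theta> i) (\<psi> i) (X i \<omega>)\<bar> \<le> 1 * 2 ^ card S"
      using prod_trig_weight_bounds[of \<theta> \<psi> "\<lambda>i. X i \<omega>" S]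
      by (intro mult_mono) (auto simp del: abs_prod)
    then show "norm (cos (L \<omega>) * (\<Prod>i\<in>S. trig_weight (\<theta> i) (\<psi> i) (X i \<omega>))) \<le> 2 ^ card S"
      by (simp only: real_norm_def abs_mult mult_1)
  qed
  have "(\<lambda>\<omega>. trig_weight (\<theta> i) (\<psi> i) (X i \<omega>)) \<in> borel_measurable M" if "i \<in> S" for i
    using measurable_compose[OF S[OF that] trig_weight_measurable] .
  then show "(\<lambda>\<omega>. cos (L \<omega>) * (\<Prod>i\<in>S. trig_weight (\<theta> i) (\<psi> i) (X i \<omega>))) \<in> borel_measurable M"
    by (intro borel_measurable_times borel_measurable_prod) simp_all
qed

text \<open>Product-to-sum formulas turn a product of cosines of linear forms into cosines of linear forms.\<close>

lemma trig_weights_expectation_eq: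
  fixes X :: "'i \<Rightarrow> 'a \<Rightarrow> real" and Y :: "'i \<Rightarrow> 'a \<Rightarrow> real"
  assumes "prob_space M" "prob_space N" and J: "finite J"
    and X: "\<And>i. i \<in> J \<Longrightarrow> X i \<in> borel_measurable M" and Y: "\<And>i. i \<in> J \<Longrightarrow> Y i \<in> borel_measurable N"
    and eq: "\<And>c \<phi>. (\<integral>\<omega>. cos ((\<Sum>j\<in>J. c j * X j \<omega>) + \<phi>) \<partial>M) = (\<integral>\<omega>. cos ((\<Sum>j\<in>J. c j * Y j \<omega>) + \<phi>) \<partial>N)"
    and S: "S \<subseteq> J"
  shows "(\<integral>\<omega>. cos ((\<Sum>j\<in>J. c j * X j \<omega>) + \<phi>) * (\<Prod>i\<in>S. trig_weight (\<theta> i) (\<psi> i) (X i \<omega>)) \<partial>M)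
    = (\<integral>\<omega>. cos ((\<Sum>j\<in>J. c j * Y j \<omega>) + \<phi>) * (\<Prod>i\<in>S. trig_weight (\<theta> i) (\<psi> i) (Y i \<omega>)) \<partial>N)"
proof -
  have "finite S" using S J finite_subset by blast
  then show ?thesis using S
  proof (induction S arbitrary: c \<phi> rule: finite_induct)
    case empty
    then show ?case using eq by simp
  next
    case (insert k S)
    then have k: "k \<in> J" "k \<notin> S" "S \<subseteq> J" by auto
    let ?c = "\<lambda>\<epsilon> j. c j + \<epsilon> * (if j = k then \<theta> k else 0)"
    have expand: "(\<integral>\<omega>. cos ((\<Sum>j\<in>J. c j * Z j \<omega>) + \<phi>) * (\<Prod>i\<in>insert k S. trig_weight (\<theta> i) (\<psi> i) (Z i \<omega>)) \<partial>Q)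
       = (\<integral>\<omega>. cos ((\<Sum>j\<in>J. c j * Z j \<omega>) + \<phi>) * (\<Prod>i\<in>S. trig_weight (\<theta> i) (\<psi> i) (Z i \<omega>)) \<partial>Q)
       + (\<integral>\<omega>. cos ((\<Sum>j\<in>J. ?c 1 j * Z j \<omega>) + (\<phi> + \<psi> k)) * (\<Prod>i\<in>S. trig_weight (\<theta> i) (\<psi> i) (Z i \<omega>)) \<partial>Q) / 2
       + (\<integral>\<omega>. cos ((\<Sum>j\<in>J. ?c (-1) j * Z j \<omega>) + (\<phi> - \<psi> k)) * (\<Prod>i\<in>S. trig_weight (\<theta> i) (\<psi> i) (Z i \<omega>)) \<partial>Q) / 2"
      if Q: "prob_space Q" and Z: "\<And>i. i \<in> J \<Longrightarrow> Z i \<in> borel_measurable Q" for Q :: "'a measure" and Z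
    proof -
      interpret Q: prob_space Q by fact
      have lin: "(\<Sum>j\<in>J. ?c \<epsilon> j * Z j \<omega>) = (\<Sum>j\<in>J. c j * Z j \<omega>) + \<epsilon> * (\<theta> k * Z k \<omega>)" for \<epsilon> \<omega>
        using k J by (simp add: distrib_right sum.distrib sum_distrib_left[symmetric] mult.assoc
            if_distrib[of "\<lambda>x. x * _"] if_distrib[of "\<lambda>x. _ * x"] sum.delta cong: if_cong)
      have pt: "cos ((\<Sum>j\<in>J. c j * Z j \<omega>) + \<phi>) * (\<Prod>i\<in>insert k S. trig_weight (\<theta> i) (\<psi> i) (Z i \<omega>))
         = cos ((\<Sum>j\<in>J. c j * Z j \<omega>) + \<phi>) * (\<Prod>i\<in>S. trig_weight (\<theta> i) (\<psi> i) (Z i \<omega>))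
          + (cos ((\<Sum>j\<in>J. ?c 1 j * Z j \<omega>) + (\<phi> + \<psi> k)) * (\<Prod>i\<in>S. trig_weight (\<theta> i) (\<psi> i) (Z i \<omega>))) / 2
          + (cos ((\<Sum>j\<in>J. ?c (-1) j * Z j \<omega>) + (\<phi> - \<psi> k)) * (\<Prod>i\<in>S. trig_weight (\<theta> i) (\<psi> i) (Z i \<omega>))) / 2" for \<omega>
      proof -
        have "cos (u + \<phi>) * (trig_weight a b z * p) = cos (u + \<phi>) * p + (cos (u + 1 * (a * z) + (\<phi> + b)) * p) / 2
            + (cos (u + (-1) * (a * z) + (\<phi> - b)) * p) / 2" for u a b z p
        proof -
          have "cos (u + 1 * (a * z) + (\<phi> + b)) + cos (u + (-1) * (a * z) + (\<phi> - b)) = 2 * (cos (u + \<phi>) * cos (a * z + b))"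
            by (simp add: cos_times_cos algebra_simps)
          then have "(cos (u + 1 * (a * z) + (\<phi> + b)) * p) / 2 + (cos (u + (-1) * (a * z) + (\<phi> - b)) * p) / 2
             = cos (u + \<phi>) * cos (a * z + b) * p"
            by (metis (no_types, lifting) add_divide_distrib distrib_right mult.assoc nonzero_mult_div_cancel_left zero_neq_numeral)
          then show ?thesis by (simp add: trig_weight_def algebra_simps)
        qed
        then show ?thesis unfolding lin using k insert.hyps by simp
      qed
      have int: "integrable Q (\<lambda>\<omega>. cos ((\<Sum>j\<in>J. d j * Z j \<omega>) + \<eta>) * (\<Prod>i\<in>S. trig_weight (\<theta> i) (\<psi> i) (Z i \<omega>)))" for d \<eta>
        using Z k by (intro Q.integrable_cos_prod_trig_weight) auto
      show ?thesis unfolding pt by (simp add: int)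
    qed
    show ?case
      using expand[of M X, OF assms(1) X] expand[of N Y, OF assms(2) Y] insert.IH[OF k(3)] by presburger
  qed
qed

text \<open>The measure with density \<open>g\<close> with respect to \<open>M\<close> is, after normalisation, a probability measure. The
  characteristic function of its image under \<open>U\<close> can be read off from the weighted expectations,
  so Levy's uniqueness theorem applies.\<close>

lemma indicator_expectation_eq_of_trig_weights:
  fixes U g :: "'a \<Rightarrow> real" and V h :: "'a \<Rightarrow> real"
  assumes "prob_space M" "prob_space N"
    and U[measurable]: "U \<in> borel_measurable M" and V[measurable]: "V \<in> borel_measurable N"
    and g: "integrable M g" "\<And>\<omega>. 0 \<le> g \<omega>" and h: "integrable N h" "\<And>\<omega>. 0 \<le> h \<omega>"
    and eq: "\<And>\<theta> \<psi>. (\<integral>\<omega>. trig_weight \<theta> \<psi> (U \<omega>) * g \<omega> \<partial>M) = (\<integral>\<omega>. trig_weight \<theta> \<psi> (V \<omega>) * h \<omega> \<partial>N)"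
    and A[measurable]: "A \<in> sets borel"
  shows "(\<integral>\<omega>. indicator A (U \<omega>) * g \<omega> \<partial>M) = (\<integral>\<omega>. indicator A (V \<omega>) * h \<omega> \<partial>N)"
proof -
  define m where "m = (\<integral>\<omega>. g \<omega> \<partial>M)"
  have [measurable]: "g \<in> borel_measurable M" "h \<in> borel_measurable N" using g h by auto
  \<comment> \<open>\<open>trig_weight 0 (\<pi>/2)\<close> is the constant \<open>1\<close>, so both total masses agree.\<close>
  have m: "(\<integral>\<omega>. h \<omega> \<partial>N) = m" using eq[of 0 "pi/2"] by (simp add: trig_weight_def m_def)
  have bounded: "integrable Q (\<lambda>\<omega>. f \<omega> * w \<omega>)" "integrable Q (\<lambda>\<omega>. w \<omega> * f \<omega>)"
    if [measurable]: "f \<in> borel_measurable Q" and "\<And>\<omega>. \<bar>f \<omega>\<bar> \<le> 1" "integrable Q w" for Q :: "'a measure" and f w :: "'a \<Rightarrow> real"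
  proof -
    show "integrable Q (\<lambda>\<omega>. f \<omega> * w \<omega>)"
      by (rule Bochner_Integration.integrable_bound[OF \<open>integrable Q w\<close>])
         (use that borel_measurable_integrable[OF that(3)] in \<open>auto simp: abs_mult intro!: mult_left_le_one_le\<close>)
    then show "integrable Q (\<lambda>\<omega>. w \<omega> * f \<omega>)" by (simp add: mult.commute)
  qed
  have cos_eq: "(\<integral>\<omega>. cos (\<theta> * U \<omega> + \<psi>) * g \<omega> \<partial>M) = (\<integral>\<omega>. cos (\<theta> * V \<omega> + \<psi>) * h \<omega> \<partial>N)" for \<theta> \<psi>
    using eq[of \<theta> \<psi>] g h bounded(1)[of "\<lambda>\<omega>. cos (\<theta> * U \<omega> + \<psi>)" M g] bounded(1)[of "\<lambda>\<omega>. cos (\<theta> * V \<omega> + \<psi>)" N h]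
    by (simp add: trig_weight_def distrib_right m m_def[symmetric])
  show ?thesis
  proof (cases "m = 0")
    case True
    have "AE \<omega> in M. g \<omega> = 0" "AE \<omega> in N. h \<omega> = 0"
      using True m g h integral_nonneg_eq_0_iff_AE[of M g] integral_nonneg_eq_0_iff_AE[of N h] by (simp_all add: m_def)
    then have "AE \<omega> in M. indicator A (U \<omega>) * g \<omega> = 0" "AE \<omega> in N. indicator A (V \<omega>) * h \<omega> = 0"
      by auto
    then have "(\<integral>\<omega>. indicator A (U \<omega>) * g \<omega> \<partial>M) = 0" "(\<integral>\<omega>. indicator A (V \<omega>) * h \<omega> \<partial>N) = 0"
      by (auto intro!: integral_eq_zero_AE)
    then show ?thesis by simp
  next
    case False
    moreover have "0 \<le> m" using g by (simp add: m_def)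
    ultimately have "m > 0" by simp
    have key: "real_distribution (distr (density Q (\<lambda>\<omega>. ennreal (w \<omega> / m))) borel u) \<and>
       (\<forall>t. char (distr (density Q (\<lambda>\<omega>. ennreal (w \<omega> / m))) borel u) t
          = Complex ((\<integral>\<omega>. cos (t * u \<omega> + 0) * w \<omega> \<partial>Q) / m) ((\<integral>\<omega>. cos (t * u \<omega> + - (pi / 2)) * w \<omega> \<partial>Q) / m)) \<and>
       measure (distr (density Q (\<lambda>\<omega>. ennreal (w \<omega> / m))) borel u) A = (\<integral>\<omega>. indicator A (u \<omega>) * w \<omega> \<partial>Q) / m"
      if [measurable]: "u \<in> borel_measurable Q" and w: "integrable Q w" "\<And>\<omega>. 0 \<le> w \<omega>" "(\<integral>\<omega>. w \<omega> \<partial>Q) = m"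
      for Q :: "'a measure" and u w
    proof -
      let ?D = "density Q (\<lambda>\<omega>. ennreal (w \<omega> / m))"
      have [measurable]: "w \<in> borel_measurable Q" using w by auto
      have nn: "0 \<le> w \<omega> / m" for \<omega> using w \<open>m > 0\<close> by simp
      have "emeasure ?D (space ?D) = (\<integral>\<^sup>+\<omega>. ennreal (w \<omega> / m) \<partial>Q)"
        by (subst emeasure_density) (auto intro!: nn_integral_cong)
      also have "\<dots> = ennreal (\<integral>\<omega>. w \<omega> / m \<partial>Q)"
        using w nn by (intro nn_integral_eq_integral) auto
      also have "\<dots> = 1" using w \<open>m > 0\<close> by simp
      finally have D: "prob_space ?D" by (rule prob_spaceI)
      interpret D: prob_space ?D by (rule D)
      have 1: "real_distribution (distr ?D borel u)"
        by (intro D.real_distribution_distr) simp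
      have 2: "char (distr ?D borel u) t = Complex ((\<integral>\<omega>. cos (t * u \<omega> + 0) * w \<omega> \<partial>Q) / m) ((\<integral>\<omega>. cos (t * u \<omega> + - (pi / 2)) * w \<omega> \<partial>Q) / m)" for t
      proof -
        have "char (distr ?D borel u) t = (CLINT \<omega>|?D. iexp (t * u \<omega>))"
          unfolding char_def by (subst integral_distr) auto
        also have "\<dots> = (CLINT \<omega>|Q. (w \<omega> / m) *\<^sub>R iexp (t * u \<omega>))"
          using nn by (intro integral_density) auto
        finally have ch: "char (distr ?D borel u) t = (CLINT \<omega>|Q. (w \<omega> / m) *\<^sub>R iexp (t * u \<omega>))" .
        have int: "integrable Q (\<lambda>\<omega>. (w \<omega> / m) *\<^sub>R iexp (t * u \<omega>))"
          by (rule Bochner_Integration.integrable_bound[of Q "\<lambda>\<omega>. w \<omega> / m"]) (use w in auto)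
        \<comment> \<open>The sine is written as a shifted cosine to match the form of the hypothesis.\<close>
        have "Re (CLINT \<omega>|Q. (w \<omega> / m) *\<^sub>R iexp (t * u \<omega>)) = (\<integral>\<omega>. cos (t * u \<omega> + 0) * w \<omega> / m \<partial>Q)"
          by (subst integral_Re[OF int, symmetric], intro Bochner_Integration.integral_cong) (auto simp: Re_exp)
        moreover have "Im (CLINT \<omega>|Q. (w \<omega> / m) *\<^sub>R iexp (t * u \<omega>)) = (\<integral>\<omega>. cos (t * u \<omega> + - (pi / 2)) * w \<omega> / m \<partial>Q)"
          by (subst integral_Im[OF int, symmetric], intro Bochner_Integration.integral_cong) (auto simp: Im_exp cos_diff)
        ultimately show ?thesis unfolding ch by (simp add: complex_eq_iff)
      qed
      have 3: "measure (distr ?D borel u) A = (\<integral>\<omega>. indicator A (u \<omega>) * w \<omega> \<partial>Q) / m"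
      proof -
        have "measure (distr ?D borel u) A = (\<integral>x. indicator A x \<partial>distr ?D borel u)"
          by simp
        also have "\<dots> = (\<integral>\<omega>. indicator A (u \<omega>) \<partial>?D)"
          by (rule integral_distr) auto
        also have "\<dots> = (\<integral>\<omega>. (w \<omega> / m) *\<^sub>R indicator A (u \<omega>) \<partial>Q)"
          using nn by (intro integral_density) auto
        also have "\<dots> = (\<integral>\<omega>. indicator A (u \<omega>) * w \<omega> / m \<partial>Q)"
          by (intro Bochner_Integration.integral_cong) auto
        finally show ?thesis by simp
      qed
      show ?thesis using 1 2 3 by blast
    qed
    note kM = key[OF U g m_def[symmetric]] and kN = key[OF V h m]
    let ?\<mu> = "distr (density M (\<lambda>\<omega>. ennreal (g \<omega> / m))) borel U" and ?\<nu> = "distr (density N (\<lambda>\<omega>. ennreal (h \<omega> / m))) borel V"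
    have "char ?\<mu> = char ?\<nu>"
      using kM kN unfolding cos_eq by (intro ext) metis
    then have "?\<mu> = ?\<nu>" using Levy_uniqueness kM kN by blast
    then have "(\<integral>\<omega>. indicator A (U \<omega>) * g \<omega> \<partial>M) / m = (\<integral>\<omega>. indicator A (V \<omega>) * h \<omega> \<partial>N) / m"
      using kM kN by metis
    then show ?thesis using \<open>m > 0\<close> by simp
  qed
qed

text \<open>The trigonometric weights are exchanged for indicators one coordinate at a time; the remaining
  factors form the nonnegative density \<open>g\<close> of the preceding lemma.\<close>

lemma indicators_expectation_eq:
  fixes X :: "'i \<Rightarrow> 'a \<Rightarrow> real" and Y :: "'i \<Rightarrow> 'a \<Rightarrow> real"
  assumes "prob_space M" "prob_space N" and J: "finite J"
    and X: "\<And>i. i \<in> J \<Longrightarrow> X i \<in> borel_measurable M" and Y: "\<And>i. i \<in> J \<Longrightarrow> Y i \<in> borel_measurable N"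
    and eq: "\<And>c \<phi>. (\<integral>\<omega>. cos ((\<Sum>j\<in>J. c j * X j \<omega>) + \<phi>) \<partial>M) = (\<integral>\<omega>. cos ((\<Sum>j\<in>J. c j * Y j \<omega>) + \<phi>) \<partial>N)"
    and S: "S \<subseteq> J" and A: "\<And>i. i \<in> J \<Longrightarrow> A i \<in> sets borel"
  shows "(\<integral>\<omega>. (\<Prod>i\<in>S. indicator (A i) (X i \<omega>)) * (\<Prod>i\<in>J - S. trig_weight (\<theta> i) (\<psi> i) (X i \<omega>)) \<partial>M)
    = (\<integral>\<omega>. (\<Prod>i\<in>S. indicator (A i) (Y i \<omega>)) * (\<Prod>i\<in>J - S. trig_weight (\<theta> i) (\<psi> i) (Y i \<omega>)) \<partial>N)"
proof -
  have "finite S" using S J finite_subset by blast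
  then show ?thesis using S
  proof (induction S arbitrary: \<theta> \<psi> rule: finite_induct)
    case empty
    then show ?case
      using trig_weights_expectation_eq[OF assms(1-5) eq order_refl, of "\<lambda>_. 0" 0 \<theta> \<psi>] by simp
  next
    case (insert k S)
    then have k: "k \<in> J" "k \<notin> S" "S \<subseteq> J" by auto
    let ?w = "\<lambda>Z \<omega>. (\<Prod>i\<in>S. indicator (A i) (Z i \<omega>)) * (\<Prod>i\<in>J - insert k S. trig_weight (\<theta> i) (\<psi> i) (Z i \<omega>)) :: real"
    have w0: "0 \<le> ?w Z \<omega>" for Z :: "'i \<Rightarrow> 'a \<Rightarrow> real" and \<omega>
      by (intro mult_nonneg_nonneg prod_nonneg trig_weight_nonneg) auto
    have wi: "integrable Q (?w Z)" if Q: "prob_space Q" and Z: "\<And>i. i \<in> J \<Longrightarrow> Z i \<in> borel_measurable Q"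
      for Q :: "'a measure" and Z
    proof -
      interpret Q: prob_space Q by fact
      have "integrable Q (\<lambda>\<omega>. cos 0 * (\<Prod>i\<in>J - insert k S. trig_weight (\<theta> i) (\<psi> i) (Z i \<omega>)))"
        using Z by (intro Q.integrable_cos_prod_trig_weight) auto
      then have int: "integrable Q (\<lambda>\<omega>. \<Prod>i\<in>J - insert k S. trig_weight (\<theta> i) (\<psi> i) (Z i \<omega>))" by simp
      have mZ: "(\<lambda>\<omega>. trig_weight (\<theta> i) (\<psi> i) (Z i \<omega>)) \<in> borel_measurable Q" if "i \<in> J" for i
        using measurable_compose[OF Z[OF that] trig_weight_measurable] .
      have "(\<lambda>\<omega>. indicator (A i) (Z i \<omega>) :: real) \<in> borel_measurable Q" if "i \<in> S" for i
        using that k A Z by (intro measurable_compose[OF Z[of i]] borel_measurable_indicator) auto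
      then have m: "?w Z \<in> borel_measurable Q"
        using mZ by (intro borel_measurable_times borel_measurable_prod) simp_all
      have "norm (?w Z \<omega>) \<le> norm (\<Prod>i\<in>J - insert k S. trig_weight (\<theta> i) (\<psi> i) (Z i \<omega>))" for \<omega>
      proof -
        have "(\<Prod>i\<in>S. indicator (A i) (Z i \<omega>) :: real) \<le> 1" "0 \<le> (\<Prod>i\<in>S. indicator (A i) (Z i \<omega>) :: real)"
          by (auto intro: prod_le_1 prod_nonneg)
        then show ?thesis
          by (simp add: abs_mult mult_left_le_one_le del: abs_prod)
      qed
      then show ?thesis
        by (intro Bochner_Integration.integrable_bound[OF int m]) auto
    qed
    have split: "(\<Prod>i\<in>S. indicator (A i) (Z i \<omega>)) * (\<Prod>i\<in>J - S. trig_weight ((\<theta>(k := a)) i) ((\<psi>(k := b)) i) (Z i \<omega>))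
        = trig_weight a b (Z k \<omega>) * ?w Z \<omega>" for Z :: "'i \<Rightarrow> 'a \<Rightarrow> real" and \<omega> a b
    proof -
      have JS: "J - S = insert k (J - insert k S)" using k(1,2) by blast
      have "(\<Prod>i\<in>J - S. trig_weight ((\<theta>(k := a)) i) ((\<psi>(k := b)) i) (Z i \<omega>))
        = trig_weight a b (Z k \<omega>) * (\<Prod>i\<in>J - insert k S. trig_weight ((\<theta>(k := a)) i) ((\<psi>(k := b)) i) (Z i \<omega>))"
        unfolding JS using J by (subst prod.insert) simp_all
      also have "(\<Prod>i\<in>J - insert k S. trig_weight ((\<theta>(k := a)) i) ((\<psi>(k := b)) i) (Z i \<omega>)) = (\<Prod>i\<in>J - insert k S. trig_weight (\<theta> i) (\<psi> i) (Z i \<omega>))"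
        by (intro prod.cong) auto
      finally show ?thesis by (simp add: mult_ac)
    qed
    have "(\<integral>\<omega>. indicator (A k) (X k \<omega>) * ?w X \<omega> \<partial>M) = (\<integral>\<omega>. indicator (A k) (Y k \<omega>) * ?w Y \<omega> \<partial>N)"
    proof (rule indicator_expectation_eq_of_trig_weights[OF assms(1,2) X Y])
      show "(\<integral>\<omega>. trig_weight a b (X k \<omega>) * ?w X \<omega> \<partial>M) = (\<integral>\<omega>. trig_weight a b (Y k \<omega>) * ?w Y \<omega> \<partial>N)" for a b
        using insert.IH[OF k(3), of "\<theta>(k := a)" "\<psi>(k := b)"] unfolding split .
    qed (use k A X Y assms w0 wi in auto)
    then show ?case using insert.hyps by (simp add: mult.assoc)
  qed
qed

text \<open>A form of the Cramer-Wold theorem. Finite-dimensional rectangles generate the product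
  \<open>\<sigma>\<close>-algebra, and their probabilities are expectations of products of indicators. The hypothesis is
  phrased with cosines because these expectations are explicit for Gaussian variables.\<close>

theorem distr_PiM_eqI_cos:
  fixes X :: "'i \<Rightarrow> 'a \<Rightarrow> real" and Y :: "'i \<Rightarrow> 'a \<Rightarrow> real"
  assumes M: "prob_space M" and N: "prob_space N"
    and X: "\<And>i. i \<in> I \<Longrightarrow> X i \<in> borel_measurable M" and Y: "\<And>i. i \<in> I \<Longrightarrow> Y i \<in> borel_measurable N"
    and eq: "\<And>J c \<phi>. finite J \<Longrightarrow> J \<subseteq> I \<Longrightarrow>
      (\<integral>\<omega>. cos ((\<Sum>j\<in>J. c j * X j \<omega>) + \<phi>) \<partial>M) = (\<integral>\<omega>. cos ((\<Sum>j\<in>J. c j * Y j \<omega>) + \<phi>) \<partial>N)"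
  shows "distr M (Pi\<^sub>M I (\<lambda>_. borel)) (\<lambda>\<omega>. \<lambda>i\<in>I. X i \<omega>) = distr N (Pi\<^sub>M I (\<lambda>_. borel)) (\<lambda>\<omega>. \<lambda>i\<in>I. Y i \<omega>)"
proof (rule measure_eqI_PiM_infinite)
  interpret M: prob_space M by fact
  interpret N: prob_space N by fact
  have mX: "(\<lambda>\<omega>. \<lambda>i\<in>I. X i \<omega>) \<in> M \<rightarrow>\<^sub>M Pi\<^sub>M I (\<lambda>_. borel)" by (intro measurable_restrict X)
  have mY: "(\<lambda>\<omega>. \<lambda>i\<in>I. Y i \<omega>) \<in> N \<rightarrow>\<^sub>M Pi\<^sub>M I (\<lambda>_. borel)" by (intro measurable_restrict Y)
  show "finite_measure (distr M (Pi\<^sub>M I (\<lambda>_. borel)) (\<lambda>\<omega>. \<lambda>i\<in>I. X i \<omega>))"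
    using M.prob_space_distr[OF mX] by (simp add: prob_space_def)
  fix A :: "'i \<Rightarrow> real set" and J assume J: "finite J" "J \<subseteq> I" and A: "\<And>i. i \<in> J \<Longrightarrow> A i \<in> sets borel"
  let ?E = "prod_emb I (\<lambda>_. borel :: real measure) J (Pi\<^sub>E J A)"
  have E: "?E \<in> sets (Pi\<^sub>M I (\<lambda>_. borel))" using J A by (intro sets_PiM_I) auto
  have prob: "emeasure (distr Q (Pi\<^sub>M I (\<lambda>_. borel)) (\<lambda>\<omega>. \<lambda>i\<in>I. Z i \<omega>)) ?E
      = ennreal (\<integral>\<omega>. (\<Prod>i\<in>J. indicator (A i) (Z i \<omega>) :: real) \<partial>Q)"
    if Q: "prob_space Q" and Z: "(\<lambda>\<omega>. \<lambda>i\<in>I. Z i \<omega>) \<in> Q \<rightarrow>\<^sub>M Pi\<^sub>M I (\<lambda>_. borel)" for Q :: "'a measure" and Z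
  proof -
    interpret Q: prob_space Q by fact
    let ?S = "(\<lambda>\<omega>. \<lambda>i\<in>I. Z i \<omega>) -` ?E \<inter> space Q"
    have S: "?S \<in> sets Q" using measurable_sets[OF Z E] .
    have "(\<Prod>i\<in>J. indicator (A i) (Z i \<omega>)) = (indicator ?S \<omega> :: real)" if "\<omega> \<in> space Q" for \<omega>
    proof -
      have "\<omega> \<in> ?S \<longleftrightarrow> (\<forall>i\<in>J. Z i \<omega> \<in> A i)"
        using that J by (auto simp: prod_emb_def PiE_iff restrict_def extensional_def subset_iff)
      moreover have "(\<Prod>i\<in>J. indicator (A i) (Z i \<omega>)) = (if \<forall>i\<in>J. Z i \<omega> \<in> A i then 1 else 0 :: real)"
        using J(1) by (induction J rule: finite_induct) (auto simp: indicator_def)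
      ultimately show ?thesis by (auto simp: indicator_def)
    qed
    then have "(\<integral>\<omega>. (\<Prod>i\<in>J. indicator (A i) (Z i \<omega>) :: real) \<partial>Q) = (\<integral>\<omega>. indicator ?S \<omega> \<partial>Q)"
      by (intro Bochner_Integration.integral_cong) auto
    also have "\<dots> = measure Q ?S" using S by simp
    finally show ?thesis using S E Z by (simp add: emeasure_distr Q.emeasure_eq_measure)
  qed
  have "(\<integral>\<omega>. (\<Prod>i\<in>J. indicator (A i) (X i \<omega>)) \<partial>M) = (\<integral>\<omega>. (\<Prod>i\<in>J. indicator (A i) (Y i \<omega>)) \<partial>N :: real)"
    using indicators_expectation_eq[OF M N J(1) _ _ _ order_refl A, of X Y] X Y J eq by (simp add: subset_iff)
  then show "emeasure (distr M (Pi\<^sub>M I (\<lambda>_. borel)) (\<lambda>\<omega>. \<lambda>i\<in>I. X i \<omega>)) ?E = emeasure (distr N (Pi\<^sub>M I (\<lambda>_. borel)) (\<lambda>\<omega>. \<lambda>i\<in>I. Y i \<omega>)) ?E"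
    unfolding prob[OF M mX] prob[OF N mY] by simp
qed simp_all

section \<open>The closed linear span of a Gaussian family\<close>

lemma (in prob_space) centered_gaussian_square_integrable:
  assumes "centered_gaussian M Y"
  shows "square_integrable M Y"
proof -
  have mY: "Y \<in> borel_measurable M" using assms by (simp add: centered_gaussian_def)
  consider "AE \<omega> in M. Y \<omega> = 0" | \<sigma> where "\<sigma> > 0" "distributed M lborel Y (normal_density 0 \<sigma>)"
    using assms unfolding centered_gaussian_def by blast
  then show ?thesis
  proof cases
    case 1
    then show ?thesis by (rule square_integrable_cong_AE[OF _ mY square_integrable_zero])
  next
    case (2 \<sigma>)
    then show ?thesis by (rule normal_second_moment(1))
  qed
qed

lemma (in prob_space) expectation_cos_centered_gaussian:
  assumes Y: "centered_gaussian M Y"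
  shows "expectation (\<lambda>\<omega>. cos (Y \<omega> + \<phi>)) = cos \<phi> * exp (- expectation (\<lambda>\<omega>. (Y \<omega>)\<^sup>2) / 2)"
proof -
  have mY[measurable]: "Y \<in> borel_measurable M" using Y by (simp add: centered_gaussian_def)
  consider "AE \<omega> in M. Y \<omega> = 0" | \<sigma> where "\<sigma> > 0" "distributed M lborel Y (normal_density 0 \<sigma>)"
    using Y unfolding centered_gaussian_def by blast
  then show ?thesis
  proof cases
    case 1
    have "expectation (\<lambda>\<omega>. cos (Y \<omega> + \<phi>)) = expectation (\<lambda>\<omega>. cos \<phi>)"
      by (rule integral_cong_AE) (use 1 in auto)
    moreover have "expectation (\<lambda>\<omega>. (Y \<omega>)\<^sup>2) = 0"
      by (rule integral_eq_zero_AE) (use 1 in auto)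
    ultimately show ?thesis by (simp add: prob_space)
  next
    case (2 \<sigma>)
    have S: "distributed M lborel (\<lambda>\<omega>. Y \<omega> / \<sigma>) std_normal_density"
      using 2 normal_standard_normal_convert[of \<sigma> Y 0] by simp
    have "char std_normal_distribution \<sigma> = (CLINT x|distr M lborel (\<lambda>\<omega>. Y \<omega> / \<sigma>). iexp (\<sigma> * x))"
      unfolding char_def using distributed_distr_eq_density[OF S] by simp
    also have "\<dots> = (CLINT \<omega>|M. iexp (Y \<omega>))"
      using \<open>\<sigma> > 0\<close> by (subst integral_distr) (auto intro: distributed_measurable[OF S])
    finally have ch: "(CLINT \<omega>|M. iexp (Y \<omega>)) = complex_of_real (exp (- \<sigma>\<^sup>2 / 2))"
      by (simp add: char_std_normal_distribution)
    have int: "integrable M (\<lambda>\<omega>. iexp (Y \<omega>))" by (rule integrable_iexp) simp_all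
    have "expectation (\<lambda>\<omega>. cos (Y \<omega>)) = exp (- \<sigma>\<^sup>2 / 2)" "expectation (\<lambda>\<omega>. sin (Y \<omega>)) = 0"
      using integral_Re[OF int] integral_Im[OF int] by (simp_all add: ch Re_exp Im_exp)
    moreover have "integrable M (\<lambda>\<omega>. cos (Y \<omega>))" "integrable M (\<lambda>\<omega>. sin (Y \<omega>))"
      by (rule integrable_const_bound[where B=1]; simp)+
    ultimately have "expectation (\<lambda>\<omega>. cos (Y \<omega> + \<phi>)) = cos \<phi> * exp (- \<sigma>\<^sup>2 / 2)"
      by (simp add: cos_add)
    then show ?thesis using normal_second_moment(2)[OF 2] by simp
  qed
qed

text \<open>The closed linear span of a family in \<open>L\<^sup>2\<close>; for a Gaussian family all its elements are
  again centered Gaussian.\<close>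

definition L2_span :: "'a measure \<Rightarrow> 'i set \<Rightarrow> ('i \<Rightarrow> 'a \<Rightarrow> real) \<Rightarrow> ('a \<Rightarrow> real) \<Rightarrow> bool" where
  "L2_span M I X Y \<longleftrightarrow> square_integrable M Y \<and>
     (\<forall>e>0. \<exists>J c. finite J \<and> J \<subseteq> I \<and> (\<integral>\<omega>. (Y \<omega> - (\<Sum>j\<in>J. c j * X j \<omega>))\<^sup>2 \<partial>M) < e)"

context
  fixes M :: "'a measure" and I :: "'i set" and X :: "'i \<Rightarrow> 'a \<Rightarrow> real"
  assumes sq: "\<And>i. i \<in> I \<Longrightarrow> square_integrable M (X i)"
begin

lemma L2_span_linear_combination:
  assumes "finite J" "J \<subseteq> I"
  shows "L2_span M I X (\<lambda>\<omega>. \<Sum>j\<in>J. c j * X j \<omega>)"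
  unfolding L2_span_def
proof (intro conjI allI impI)
  show "square_integrable M (\<lambda>\<omega>. \<Sum>j\<in>J. c j * X j \<omega>)"
    using assms by (intro square_integrable_sum square_integrable_cmult sq) auto
  show "\<exists>J' c'. finite J' \<and> J' \<subseteq> I \<and> (\<integral>\<omega>. ((\<Sum>j\<in>J. c j * X j \<omega>) - (\<Sum>j\<in>J'. c' j * X j \<omega>))\<^sup>2 \<partial>M) < e" if "e > 0" for e :: real
    using assms that by (intro exI[of _ J] exI[of _ c]) simp
qed

lemma L2_span_zero: "L2_span M I X (\<lambda>_. 0)"
  using L2_span_linear_combination[of "{}"] by simp

lemma L2_span_base: "i \<in> I \<Longrightarrow> L2_span M I X (X i)"
  using L2_span_linear_combination[of "{i}" "\<lambda>_. 1"] by simp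

text \<open>Closedness; the closure properties below are reduced to it by approximating with finite linear
  combinations.\<close>

lemma L2_span_limit:
  assumes Y: "square_integrable M Y" and lim: "\<And>e. e > 0 \<Longrightarrow> \<exists>Z. L2_span M I X Z \<and> (\<integral>\<omega>. (Y \<omega> - Z \<omega>)\<^sup>2 \<partial>M) < e"
  shows "L2_span M I X Y"
  unfolding L2_span_def
proof (intro conjI allI impI)
  fix e :: real assume "e > 0"
  then obtain Z where Z: "L2_span M I X Z" "(\<integral>\<omega>. (Y \<omega> - Z \<omega>)\<^sup>2 \<partial>M) < e / 4"
    using lim[of "e/4"] by auto
  then obtain J c where J: "finite J" "J \<subseteq> I" "(\<integral>\<omega>. (Z \<omega> - (\<Sum>j\<in>J. c j * X j \<omega>))\<^sup>2 \<partial>M) < e / 4"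
    using \<open>e > 0\<close> unfolding L2_span_def by (meson divide_pos_pos zero_less_numeral)
  have sZ: "square_integrable M Z" using Z by (simp add: L2_span_def)
  have "square_integrable M (\<lambda>\<omega>. \<Sum>j\<in>J. c j * X j \<omega>)"
    using J by (intro square_integrable_sum square_integrable_cmult sq) auto
  then have "(\<integral>\<omega>. ((Y \<omega> - Z \<omega>) + (Z \<omega> - (\<Sum>j\<in>J. c j * X j \<omega>)))\<^sup>2 \<partial>M)
     \<le> 2 * (\<integral>\<omega>. (Y \<omega> - Z \<omega>)\<^sup>2 \<partial>M) + 2 * (\<integral>\<omega>. (Z \<omega> - (\<Sum>j\<in>J. c j * X j \<omega>))\<^sup>2 \<partial>M)"
    using Y sZ by (intro integral_square_add_le square_integrable_diff)
  then have "(\<integral>\<omega>. (Y \<omega> - (\<Sum>j\<in>J. c j * X j \<omega>))\<^sup>2 \<partial>M) < e" using Z J by simp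
  then show "\<exists>J c. finite J \<and> J \<subseteq> I \<and> (\<integral>\<omega>. (Y \<omega> - (\<Sum>j\<in>J. c j * X j \<omega>))\<^sup>2 \<partial>M) < e"
    using J by blast
qed (rule Y)

lemma L2_span_cmult:
  assumes "L2_span M I X Y" shows "L2_span M I X (\<lambda>\<omega>. k * Y \<omega>)"
proof (rule L2_span_limit)
  show "square_integrable M (\<lambda>\<omega>. k * Y \<omega>)" using assms by (auto simp: L2_span_def intro: square_integrable_cmult)
  fix e :: real assume "e > 0"
  then have "e / (k\<^sup>2 + 1) > 0" by (simp add: add_nonneg_pos)
  then obtain J c where J: "finite J" "J \<subseteq> I" and lt: "(\<integral>\<omega>. (Y \<omega> - (\<Sum>j\<in>J. c j * X j \<omega>))\<^sup>2 \<partial>M) < e / (k\<^sup>2 + 1)"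
    using assms unfolding L2_span_def by blast
  have "(\<lambda>\<omega>. (k * Y \<omega> - (\<Sum>j\<in>J. (k * c j) * X j \<omega>))\<^sup>2) = (\<lambda>\<omega>. k\<^sup>2 * (Y \<omega> - (\<Sum>j\<in>J. c j * X j \<omega>))\<^sup>2)"
    by (simp add: mult.assoc sum_distrib_left[symmetric] right_diff_distrib[symmetric] power_mult_distrib)
  then have "(\<integral>\<omega>. (k * Y \<omega> - (\<Sum>j\<in>J. (k * c j) * X j \<omega>))\<^sup>2 \<partial>M) = k\<^sup>2 * (\<integral>\<omega>. (Y \<omega> - (\<Sum>j\<in>J. c j * X j \<omega>))\<^sup>2 \<partial>M)"
    by simp
  also have "\<dots> \<le> (k\<^sup>2 + 1) * (\<integral>\<omega>. (Y \<omega> - (\<Sum>j\<in>J. c j * X j \<omega>))\<^sup>2 \<partial>M)"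
    by (intro mult_right_mono) auto
  also have "\<dots> < e"
  proof -
    have "k\<^sup>2 + 1 > 0" by (simp add: add_nonneg_pos)
    then show ?thesis using lt by (simp only: pos_less_divide_eq mult.commute)
  qed
  finally have "(\<integral>\<omega>. (k * Y \<omega> - (\<Sum>j\<in>J. (k * c j) * X j \<omega>))\<^sup>2 \<partial>M) < e" .
  with L2_span_linear_combination[OF J, of "\<lambda>j. k * c j"]
  show "\<exists>Z. L2_span M I X Z \<and> (\<integral>\<omega>. (k * Y \<omega> - Z \<omega>)\<^sup>2 \<partial>M) < e"
    by (intro exI conjI)
qed

lemma L2_span_add:
  assumes Y: "L2_span M I X Y" and Z: "L2_span M I X Z" shows "L2_span M I X (\<lambda>\<omega>. Y \<omega> + Z \<omega>)"
proof (rule L2_span_limit)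
  have s: "square_integrable M Y" "square_integrable M Z" using Y Z by (auto simp: L2_span_def)
  then show "square_integrable M (\<lambda>\<omega>. Y \<omega> + Z \<omega>)" by (rule square_integrable_add)
  fix e :: real assume "e > 0"
  then have "e / 4 > 0" by simp
  obtain J c where J: "finite J" "J \<subseteq> I" and lJ: "(\<integral>\<omega>. (Y \<omega> - (\<Sum>j\<in>J. c j * X j \<omega>))\<^sup>2 \<partial>M) < e / 4"
    using Y \<open>e / 4 > 0\<close> unfolding L2_span_def by blast
  obtain K d where K: "finite K" "K \<subseteq> I" and lK: "(\<integral>\<omega>. (Z \<omega> - (\<Sum>j\<in>K. d j * X j \<omega>))\<^sup>2 \<partial>M) < e / 4"
    using Z \<open>e / 4 > 0\<close> unfolding L2_span_def by blast
  let ?c = "\<lambda>j. (if j \<in> J then c j else 0) + (if j \<in> K then d j else 0)"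
  have comb: "(\<Sum>j\<in>J \<union> K. ?c j * X j \<omega>) = (\<Sum>j\<in>J. c j * X j \<omega>) + (\<Sum>j\<in>K. d j * X j \<omega>)" for \<omega>
  proof -
    have "(\<Sum>j\<in>J \<union> K. (if j \<in> J then c j else 0) * X j \<omega>) = (\<Sum>j\<in>J. c j * X j \<omega>)"
      using J K by (intro sum.mono_neutral_cong_right) auto
    moreover have "(\<Sum>j\<in>J \<union> K. (if j \<in> K then d j else 0) * X j \<omega>) = (\<Sum>j\<in>K. d j * X j \<omega>)"
      using J K by (intro sum.mono_neutral_cong_right) auto
    ultimately show ?thesis by (simp add: distrib_right sum.distrib)
  qed
  have sJ: "square_integrable M (\<lambda>\<omega>. \<Sum>j\<in>J. c j * X j \<omega>)" and sK: "square_integrable M (\<lambda>\<omega>. \<Sum>j\<in>K. d j * X j \<omega>)"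
    using J K by (intro square_integrable_sum square_integrable_cmult sq; auto)+
  have "(\<integral>\<omega>. ((Y \<omega> - (\<Sum>j\<in>J. c j * X j \<omega>)) + (Z \<omega> - (\<Sum>j\<in>K. d j * X j \<omega>)))\<^sup>2 \<partial>M)
     \<le> 2 * (\<integral>\<omega>. (Y \<omega> - (\<Sum>j\<in>J. c j * X j \<omega>))\<^sup>2 \<partial>M) + 2 * (\<integral>\<omega>. (Z \<omega> - (\<Sum>j\<in>K. d j * X j \<omega>))\<^sup>2 \<partial>M)"
    by (intro integral_square_add_le square_integrable_diff s sJ sK)
  also have "(\<lambda>\<omega>. ((Y \<omega> - (\<Sum>j\<in>J. c j * X j \<omega>)) + (Z \<omega> - (\<Sum>j\<in>K. d j * X j \<omega>)))\<^sup>2)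
     = (\<lambda>\<omega>. ((Y \<omega> + Z \<omega>) - (\<Sum>j\<in>J \<union> K. ?c j * X j \<omega>))\<^sup>2)"
    unfolding comb by (simp add: algebra_simps)
  finally have "(\<integral>\<omega>. ((Y \<omega> + Z \<omega>) - (\<Sum>j\<in>J \<union> K. ?c j * X j \<omega>))\<^sup>2 \<partial>M) < e" using lJ lK by simp
  moreover have "L2_span M I X (\<lambda>\<omega>. \<Sum>j\<in>J \<union> K. ?c j * X j \<omega>)"
    using J K by (intro L2_span_linear_combination) auto
  ultimately show "\<exists>U. L2_span M I X U \<and> (\<integral>\<omega>. (Y \<omega> + Z \<omega> - U \<omega>)\<^sup>2 \<partial>M) < e" by blast
qed

lemma L2_span_sum:
  assumes "\<And>k. k \<in> K \<Longrightarrow> L2_span M I X (Y k)"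
  shows "L2_span M I X (\<lambda>\<omega>. \<Sum>k\<in>K. Y k \<omega>)"
  using assms
proof (induction K rule: infinite_finite_induct)
  case (insert a K)
  then have "L2_span M I X (\<lambda>\<omega>. Y a \<omega> + (\<Sum>k\<in>K. Y k \<omega>))" by (intro L2_span_add) simp_all
  then show ?case using insert.hyps by simp
qed (simp_all add: L2_span_zero)

text \<open>Both sides of the formula for linear combinations are continuous in mean square: the left
  because \<open>cos\<close> is \<open>1\<close>-Lipschitz.\<close>

lemma expectation_cos_L2_span:
  assumes M: "prob_space M"
    and gauss: "\<And>J c. finite J \<Longrightarrow> J \<subseteq> I \<Longrightarrow> centered_gaussian M (\<lambda>\<omega>. \<Sum>j\<in>J. c j * X j \<omega>)"
    and Y: "L2_span M I X Y"
  shows "(\<integral>\<omega>. cos (Y \<omega> + \<phi>) \<partial>M) = cos \<phi> * exp (- (\<integral>\<omega>. (Y \<omega>)\<^sup>2 \<partial>M) / 2)"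
proof -
  interpret prob_space M by fact
  have sY: "square_integrable M Y" using Y by (simp add: L2_span_def)
  then have [measurable]: "Y \<in> borel_measurable M" by (simp add: square_integrable_def)
  have "\<forall>n. \<exists>J c. finite J \<and> J \<subseteq> I \<and> (\<integral>\<omega>. (Y \<omega> - (\<Sum>j\<in>J. c j * X j \<omega>))\<^sup>2 \<partial>M) < inverse (real (Suc n))"
    using Y unfolding L2_span_def by simp
  then obtain J where "\<forall>n. \<exists>c. finite (J n) \<and> J n \<subseteq> I \<and>
      (\<integral>\<omega>. (Y \<omega> - (\<Sum>j\<in>J n. c j * X j \<omega>))\<^sup>2 \<partial>M) < inverse (real (Suc n))"
    by (rule exE[OF choice])
  then obtain c where Jc: "\<forall>n. finite (J n) \<and> J n \<subseteq> I \<and>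
      (\<integral>\<omega>. (Y \<omega> - (\<Sum>j\<in>J n. c n j * X j \<omega>))\<^sup>2 \<partial>M) < inverse (real (Suc n))"
    by (rule exE[OF choice])
  then have J: "finite (J n)" "J n \<subseteq> I"
    and lt: "(\<integral>\<omega>. (Y \<omega> - (\<Sum>j\<in>J n. c n j * X j \<omega>))\<^sup>2 \<partial>M) < inverse (real (Suc n))" for n
    by simp_all
  define Z where "Z n \<omega> = (\<Sum>j\<in>J n. c n j * X j \<omega>)" for n \<omega>
  have g: "centered_gaussian M (Z n)" for n unfolding Z_def by (rule gauss[OF J])
  have sZ: "square_integrable M (Z n)" for n by (rule centered_gaussian_square_integrable[OF g])
  then have [measurable]: "Z n \<in> borel_measurable M" for n by (simp add: square_integrable_def)
  have lim0: "(\<lambda>n. \<integral>\<omega>. (Z n \<omega> - Y \<omega>)\<^sup>2 \<partial>M) \<longlonglongrightarrow> 0"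
  proof (rule tendsto_sandwich[where f="\<lambda>_. 0" and h="\<lambda>n. inverse (real (Suc n))"])
    show "\<forall>\<^sub>F n in sequentially. (\<integral>\<omega>. (Z n \<omega> - Y \<omega>)\<^sup>2 \<partial>M) \<le> inverse (real (Suc n))"
    proof (intro always_eventually allI)
      show "(\<integral>\<omega>. (Z n \<omega> - Y \<omega>)\<^sup>2 \<partial>M) \<le> inverse (real (Suc n))" for n
        using lt[of n] power2_commute[of "Y _"] by (simp only: Z_def less_imp_le)
    qed
    show "(\<lambda>n. inverse (real (Suc n))) \<longlonglongrightarrow> 0" by (rule LIMSEQ_inverse_real_of_nat)
  qed (auto intro: always_eventually)
  have L2: "L2_tendsto M Z Y sequentially"
    using sY sZ lim0 by (simp add: L2_tendsto_def)
  have intc: "integrable M (\<lambda>\<omega>. cos (Z n \<omega> + \<phi>))" "integrable M (\<lambda>\<omega>. cos (Y \<omega> + \<phi>))" for n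
    by (rule integrable_const_bound[where B=1]; simp)+
  have "norm ((\<integral>\<omega>. cos (Z n \<omega> + \<phi>) \<partial>M) - (\<integral>\<omega>. cos (Y \<omega> + \<phi>) \<partial>M)) \<le> sqrt (\<integral>\<omega>. (Z n \<omega> - Y \<omega>)\<^sup>2 \<partial>M)" for n
  proof -
    have d: "square_integrable M (\<lambda>\<omega>. \<bar>Z n \<omega> - Y \<omega>\<bar>)"
      using square_integrable_diff[OF sZ sY, of n] by (simp add: square_integrable_def)
    have one: "square_integrable M (\<lambda>_. 1)" by (simp add: square_integrable_def)
    have "norm ((\<integral>\<omega>. cos (Z n \<omega> + \<phi>) \<partial>M) - (\<integral>\<omega>. cos (Y \<omega> + \<phi>) \<partial>M)) = \<bar>\<integral>\<omega>. cos (Z n \<omega> + \<phi>) - cos (Y \<omega> + \<phi>) \<partial>M\<bar>"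
      using intc by simp
    also have "\<dots> \<le> (\<integral>\<omega>. \<bar>cos (Z n \<omega> + \<phi>) - cos (Y \<omega> + \<phi>)\<bar> \<partial>M)" by (rule integral_abs_bound)
    also have "\<dots> \<le> (\<integral>\<omega>. \<bar>Z n \<omega> - Y \<omega>\<bar> \<partial>M)"
    proof (rule integral_mono)
      show "integrable M (\<lambda>\<omega>. \<bar>Z n \<omega> - Y \<omega>\<bar>)" by (rule square_integrable_imp_integrable[OF d])
      show "\<bar>cos (Z n \<omega> + \<phi>) - cos (Y \<omega> + \<phi>)\<bar> \<le> \<bar>Z n \<omega> - Y \<omega>\<bar>" for \<omega>
      proof -
        let ?a = "Z n \<omega> + \<phi>" and ?b = "Y \<omega> + \<phi>"
        have "\<bar>cos ?a - cos ?b\<bar> = 2 * (\<bar>sin ((?a + ?b) / 2)\<bar> * \<bar>sin ((?b - ?a) / 2)\<bar>)"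
          by (simp add: cos_diff_cos abs_mult)
        also have "\<dots> \<le> 2 * (1 * \<bar>(?b - ?a) / 2\<bar>)"
          by (intro mult_left_mono mult_mono abs_sin_x_le_abs_x abs_sin_le_one) auto
        finally show ?thesis by (simp add: abs_minus_commute)
      qed
    qed (use intc in simp)
    also have "\<dots> \<le> sqrt (\<integral>\<omega>. (Z n \<omega> - Y \<omega>)\<^sup>2 \<partial>M)"
      using abs_integral_mult_le[OF d one] by (simp add: prob_space)
    finally show ?thesis .
  qed
  then have ev: "\<forall>\<^sub>F n in sequentially. norm ((\<integral>\<omega>. cos (Z n \<omega> + \<phi>) \<partial>M) - (\<integral>\<omega>. cos (Y \<omega> + \<phi>) \<partial>M)) \<le> sqrt (\<integral>\<omega>. (Z n \<omega> - Y \<omega>)\<^sup>2 \<partial>M)"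
    by (intro always_eventually allI)
  have "(\<lambda>n. sqrt (\<integral>\<omega>. (Z n \<omega> - Y \<omega>)\<^sup>2 \<partial>M)) \<longlonglongrightarrow> 0"
    using tendsto_real_sqrt[OF lim0] by simp
  with ev have "(\<lambda>n. (\<integral>\<omega>. cos (Z n \<omega> + \<phi>) \<partial>M) - (\<integral>\<omega>. cos (Y \<omega> + \<phi>) \<partial>M)) \<longlonglongrightarrow> 0"
    by (rule Lim_null_comparison)
  then have 1: "(\<lambda>n. \<integral>\<omega>. cos (Z n \<omega> + \<phi>) \<partial>M) \<longlonglongrightarrow> (\<integral>\<omega>. cos (Y \<omega> + \<phi>) \<partial>M)"
    by (rule LIM_zero_cancel)
  have "(\<lambda>n. \<integral>\<omega>. (Z n \<omega>)\<^sup>2 \<partial>M) \<longlonglongrightarrow> (\<integral>\<omega>. (Y \<omega>)\<^sup>2 \<partial>M)"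
    using L2_tendsto_integral_mult[OF L2 L2] by (simp add: power2_eq_square)
  then have "(\<lambda>n. cos \<phi> * exp (- (\<integral>\<omega>. (Z n \<omega>)\<^sup>2 \<partial>M) / 2)) \<longlonglongrightarrow> cos \<phi> * exp (- (\<integral>\<omega>. (Y \<omega>)\<^sup>2 \<partial>M) / 2)"
    by (intro tendsto_intros) auto
  with 1 show ?thesis
    unfolding expectation_cos_centered_gaussian[OF g] by (rule LIMSEQ_unique)
qed

end

section \<open>Measurable evaluation of paths\<close>

lemma space_path_algebra[simp]: "space path_algebra = paths"
  by (auto simp: path_algebra_def space_restrict_space space_PiM paths_def PiE_def)

lemma measurable_coordinate_path_algebra:
  assumes "0 \<le> t" shows "(\<lambda>\<omega>. \<omega> t) \<in> borel_measurable path_algebra"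
  unfolding path_algebra_def
  by (rule measurable_restrict_space1, rule measurable_component_singleton) (use assms in auto)

text \<open>A path is the pointwise limit of its discretisations, which are jointly measurable because
  they involve countably many coordinates.\<close>

lemma measurable_path_evaluation:
  assumes sp: "space M \<subseteq> paths" and coord: "\<And>t. 0 \<le> t \<Longrightarrow> (\<lambda>\<omega>. \<omega> t) \<in> borel_measurable M"
  shows "(\<lambda>(\<omega>, s). \<omega> s) \<in> borel_measurable (M \<Otimes>\<^sub>M lborel)"
proof -
  have [measurable]: "(\<lambda>\<omega>. \<omega> (max 0 t)) \<in> borel_measurable M" for t using coord[of "max 0 t"] by simp
  define D where "D n p = fst p (max 0 (of_int \<lfloor>real (Suc n) * snd p\<rfloor> / real (Suc n)))"
    for n and p :: "(real \<Rightarrow> real) \<times> real"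
  have [measurable]: "D n \<in> borel_measurable (M \<Otimes>\<^sub>M lborel)" for n
  proof -
    have "(\<lambda>p. (\<lambda>k p. fst p (max 0 (of_int k / real (Suc n)))) \<lfloor>real (Suc n) * snd p\<rfloor> p) \<in> borel_measurable (M \<Otimes>\<^sub>M lborel)"
      by (rule measurable_compose_countable) measurable
    then show ?thesis by (simp add: D_def[abs_def])
  qed
  have lim: "(\<lambda>n. D n p) \<longlonglongrightarrow> fst p (max 0 (snd p))" if p: "p \<in> space (M \<Otimes>\<^sub>M lborel)" for p
  proof -
    have "fst p \<in> paths" using p sp by (auto simp: space_pair_measure)
    then have c: "continuous_on {0..} (fst p)" by (simp add: paths_def)
    have "(\<lambda>n. of_int \<lfloor>real (Suc n) * snd p\<rfloor> / real (Suc n)) \<longlonglongrightarrow> snd p"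
    proof (rule tendsto_sandwich)
      show "\<forall>\<^sub>F n in sequentially. snd p - inverse (real (Suc n)) \<le> of_int \<lfloor>real (Suc n) * snd p\<rfloor> / real (Suc n)"
      proof (intro always_eventually allI)
        fix n
        have "real (Suc n) * snd p - 1 \<le> of_int \<lfloor>real (Suc n) * snd p\<rfloor>" by linarith
        then have "(real (Suc n) * snd p - 1) / real (Suc n) \<le> of_int \<lfloor>real (Suc n) * snd p\<rfloor> / real (Suc n)"
          by (rule divide_right_mono) simp
        then show "snd p - inverse (real (Suc n)) \<le> of_int \<lfloor>real (Suc n) * snd p\<rfloor> / real (Suc n)"
          by (simp add: diff_divide_distrib inverse_eq_divide)
      qed
      show "\<forall>\<^sub>F n in sequentially. of_int \<lfloor>real (Suc n) * snd p\<rfloor> / real (Suc n) \<le> snd p"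
      proof (intro always_eventually allI)
        fix n show "of_int \<lfloor>real (Suc n) * snd p\<rfloor> / real (Suc n) \<le> snd p"
          using of_int_floor_le[of "real (Suc n) * snd p"] by (simp add: divide_le_eq mult.commute)
      qed
      have "(\<lambda>n. snd p - inverse (real (Suc n))) \<longlonglongrightarrow> snd p - 0"
        by (intro tendsto_diff tendsto_const LIMSEQ_inverse_real_of_nat)
      then show "(\<lambda>n. snd p - inverse (real (Suc n))) \<longlonglongrightarrow> snd p" by simp
    qed (rule tendsto_const)
    then have "(\<lambda>n. max 0 (of_int \<lfloor>real (Suc n) * snd p\<rfloor> / real (Suc n))) \<longlonglongrightarrow> max 0 (snd p)"
      by (intro tendsto_max tendsto_const)
    then show ?thesis unfolding D_def
      by (intro continuous_on_tendsto_compose[OF c]) auto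
  qed
  have [measurable]: "(\<lambda>p. fst p (max 0 (snd p))) \<in> borel_measurable (M \<Otimes>\<^sub>M lborel)"
    by (rule borel_measurable_LIMSEQ_real[OF lim]) measurable
  have meas: "(\<lambda>p. if snd p < 0 then undefined else fst p (max 0 (snd p))) \<in> borel_measurable (M \<Otimes>\<^sub>M lborel)"
    by measurable
  have "(if snd p < 0 then undefined else fst p (max 0 (snd p))) = (\<lambda>(\<omega>, s). \<omega> s) p"
    if "p \<in> space (M \<Otimes>\<^sub>M lborel)" for p
  proof -
    have "fst p \<in> paths" using that sp by (auto simp: space_pair_measure)
    then have "fst p s = undefined" if "s < 0" for s
      using that unfolding paths_def extensional_def by (simp add: not_le)
    then show ?thesis by (simp add: case_prod_beta)
  qed
  from measurable_cong[OF this, THEN iffD1, OF _ meas] show ?thesis by simp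
qed

section \<open>Inversion of the transformation path by path\<close>

lemma powr_mult_powr: "a + b = c \<Longrightarrow> s powr a * s powr b = s powr c" for s :: real
  by (simp add: powr_add[symmetric])

lemma has_real_derivative_at_interior:
  assumes "(F has_real_derivative D) (at t within {a..b})" "a < t" "t < b"
  shows "(F has_real_derivative D) (at t)"
proof -
  have "(F has_real_derivative D) (at t within {a<..<b})"
    using assms(1) by (rule DERIV_subset) auto
  then show ?thesis using assms by (simp add: at_within_open[of t "{a<..<b}"])
qed

lemma integral_from_0_has_derivative:
  fixes f :: "real \<Rightarrow> real"
  assumes cont: "continuous_on {0<..} f" and int: "\<And>t. 0 < t \<Longrightarrow> set_integrable lborel {0..t} f" and t: "0 < t"
  shows "((\<lambda>t. LBINT s:{0..t}. f s) has_real_derivative f t) (at t)"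
proof (rule has_real_derivative_at_interior[of _ _ _ "t/2" "2*t"])
  let ?a = "t/2" and ?b = "2*t"
  have c: "continuous_on {?a..?b} f" using t by (intro continuous_on_subset[OF cont]) auto
  have "((\<lambda>u. integral {0..?a} f + integral {?a..u} f) has_real_derivative f t) (at t within {?a..?b})"
    using integral_has_real_derivative[OF c, of t] t by (auto intro!: derivative_eq_intros)
  then show "((\<lambda>t. LBINT s:{0..t}. f s) has_real_derivative f t) (at t within {?a..?b})"
  proof (rule has_field_derivative_transform_within[of _ _ _ _ 1])
    fix u assume "u \<in> {?a..?b}"
    then show "integral {0..?a} f + integral {?a..u} f = (LBINT s:{0..u}. f s)"
      using t set_borel_integral_eq_integral[OF int[of u]] by (simp add: Henstock_Kurzweil_Integration.integral_combine)
  qed (use t in auto)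
qed (use t in auto)

lemma integral_from_0_tendsto:
  fixes f :: "real \<Rightarrow> real"
  assumes int: "set_integrable lborel {0..t} f" and t: "0 < t"
  shows "((\<lambda>r. LBINT s:{r..t}. f s) \<longlongrightarrow> (LBINT s:{0..t}. f s)) (at_right 0)"
proof -
  have int': "set_integrable lborel {0<..t} f" by (auto intro: set_integrable_subset[OF int])
  have "((\<lambda>r. LBINT s:{r..t}. f s) \<longlongrightarrow> (LBINT s:{0<..t}. f s)) (at_right 0)"
    by (rule tendsto_set_lebesgue_integral_at_right[OF t _ int']) auto
  moreover have "(LBINT s:{0<..t}. f s) = (LBINT s:{0..t}. f s)"
    unfolding set_lebesgue_integral_def
  proof (rule integral_cong_AE)
    show "(\<lambda>s. indicator {0<..t} s *\<^sub>R f s) \<in> borel_measurable lborel"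
      using int' by (simp add: set_integrable_def)
    show "(\<lambda>s. indicator {0..t} s *\<^sub>R f s) \<in> borel_measurable lborel"
      using int by (simp add: set_integrable_def)
    show "AE s in lborel. indicator {0<..t} s *\<^sub>R f s = indicator {0..t} s *\<^sub>R f s"
      using AE_lborel_singleton[of 0] by eventually_elim (auto simp: indicator_def)
  qed
  ultimately show ?thesis by simp
qed

lemma integral_from_0_split:
  fixes f :: "real \<Rightarrow> real"
  assumes int: "set_integrable lborel {0..t} f" and r: "0 \<le> r" "r \<le> t"
  shows "(LBINT s:{r..t}. f s) = (LBINT s:{0..t}. f s) - (LBINT s:{0..r}. f s)"
proof -
  have "set_integrable lborel {0..r} f" "set_integrable lborel {r..t} f"
    using r by (auto intro: set_integrable_subset[OF int])
  then show ?thesis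
    using set_borel_integral_eq_integral[OF int] set_borel_integral_eq_integral(2)[of "{0..r}" f]
      set_borel_integral_eq_integral(2)[of "{r..t}" f] Henstock_Kurzweil_Integration.integral_combine[OF r, of f] by simp
qed

lemma integral_to_infinity_split:
  fixes f :: "real \<Rightarrow> real"
  assumes int: "set_integrable lborel {a..} f" and "a \<le> u"
  shows "(LBINT s:{u..}. f s) = (LBINT s:{a..}. f s) - integral {a..u} f"
proof -
  have 1: "set_integrable lborel {u..} f" "set_integrable lborel {a..u} f"
    using assms by (auto intro: set_integrable_subset[OF int])
  have un: "{a..u} \<union> {u..} = {a..}" and int_un: "{a..u} \<inter> {u..} = {u}" using assms by auto
  have "(f has_integral (integral {a..u} f + integral {u..} f)) ({a..u} \<union> {u..})"
  proof (rule has_integral_Un)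
    show "negligible ({a..u} \<inter> {u..})" unfolding int_un by simp
  qed (use set_borel_integral_eq_integral(1)[OF 1(1)] set_borel_integral_eq_integral(1)[OF 1(2)] in \<open>simp_all add: integrable_integral\<close>)
  then have "(f has_integral (integral {a..u} f + integral {u..} f)) {a..}" unfolding un .
  then show ?thesis
    using set_borel_integral_eq_integral(2)[OF 1(1)] set_borel_integral_eq_integral(2)[OF int]
    by (simp add: integral_unique)
qed

text \<open>By monotonicity in \<open>t\<close>, uncountably many integrability conditions reduce to countably many, as null
  sets and measurability require.\<close>

lemma all_integrable_iff_nat:
  fixes f :: "real \<Rightarrow> real"
  shows "(\<forall>t>0. set_integrable lborel {0..t} f) \<longleftrightarrow> (\<forall>n. set_integrable lborel {0..real (Suc n)} f)"
    and "(\<forall>t>0. set_integrable lborel {t..} f) \<longleftrightarrow> (\<forall>n. set_integrable lborel {inverse (real (Suc n))..} f)"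
proof -
  have "set_integrable lborel {0..t} f" if *: "\<forall>n. set_integrable lborel {0..real (Suc n)} f" for t
  proof -
    obtain n where "t \<le> real n" using real_arch_simple by blast
    then show ?thesis by (intro set_integrable_subset[OF *[rule_format, of n]]) auto
  qed
  moreover have "0 < real (Suc n)" for n by simp
  ultimately show "(\<forall>t>0. set_integrable lborel {0..t} f) \<longleftrightarrow> (\<forall>n. set_integrable lborel {0..real (Suc n)} f)"
    by blast
  have "set_integrable lborel {t..} f" if *: "\<forall>n. set_integrable lborel {inverse (real (Suc n))..} f" and "0 < t" for t
  proof -
    obtain n where "inverse (real (Suc n)) < t" using reals_Archimedean[OF \<open>0 < t\<close>] by blast
    then show ?thesis by (intro set_integrable_subset[OF *[rule_format, of n]]) auto
  qed
  moreover have "0 < inverse (real (Suc n))" for n by simp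
  ultimately show "(\<forall>t>0. set_integrable lborel {t..} f) \<longleftrightarrow> (\<forall>n. set_integrable lborel {inverse (real (Suc n))..} f)"
    by blast
qed

lemma integral_to_infinity_has_derivative:
  fixes f :: "real \<Rightarrow> real"
  assumes cont: "continuous_on {0<..} f" and int: "\<And>t. 0 < t \<Longrightarrow> set_integrable lborel {t..} f" and t: "0 < t"
  shows "((\<lambda>t. LBINT s:{t..}. f s) has_real_derivative - f t) (at t)"
proof (rule has_real_derivative_at_interior[of _ _ _ "t/2" "2*t"])
  let ?a = "t/2" and ?b = "2*t"
  have c: "continuous_on {?a..?b} f" using t by (intro continuous_on_subset[OF cont]) auto
  have "((\<lambda>u. (LBINT s:{?a..}. f s) - integral {?a..u} f) has_real_derivative - f t) (at t within {?a..?b})"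
    using integral_has_real_derivative[OF c, of t] t by (auto intro!: derivative_eq_intros)
  then show "((\<lambda>t. LBINT s:{t..}. f s) has_real_derivative - f t) (at t within {?a..?b})"
  proof (rule has_field_derivative_transform_within[of _ _ _ _ 1])
    fix u assume "u \<in> {?a..?b}"
    then show "(LBINT s:{?a..}. f s) - integral {?a..u} f = (LBINT s:{u..}. f s)"
      using t int by (intro integral_to_infinity_split[symmetric]) auto
  qed (use t in auto)
qed (use t in auto)

text \<open>Dominated convergence: on \<open>{0..r}\<close> the factor \<open>r powr (-c)\<close> is at most \<open>s powr (-c)\<close>, and it tends to \<open>0\<close>
  for each fixed \<open>s\<close>.\<close>

lemma weighted_integral_from_0_tendsto_0:
  fixes f :: "real \<Rightarrow> real"
  assumes c: "0 < c" and int: "\<And>t. 0 < t \<Longrightarrow> set_integrable lborel {0..t} f"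
    and inf: "set_integrable lborel {1..} (\<lambda>s. s powr (- c) * f s)"
  shows "((\<lambda>r. r powr (- c) * (LBINT s:{0..r}. f s)) \<longlongrightarrow> 0) at_top"
proof -
  let ?s = "\<lambda>r s. r powr (- c) * (indicator {0..r} s * f s)"
  let ?w = "\<lambda>s. indicator {0..1} s * \<bar>f s\<bar> + indicator {1..} s * \<bar>s powr (- c) * f s\<bar>"
  have "((\<lambda>r. \<integral>s. ?s r s \<partial>lborel) \<longlongrightarrow> (\<integral>s. 0 \<partial>(lborel :: real measure))) at_top"
  proof (rule integral_dominated_convergence_at_top[where w="?w"])
    have int': "integrable lborel (\<lambda>s. indicator {0..r} s * f s)" if "0 < r" for r
      using int[OF that] by (simp add: set_integrable_def)
    show "?s r \<in> borel_measurable lborel" for r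
    proof (cases "0 < r")
      case True
      then show ?thesis by (intro borel_measurable_times borel_measurable_const borel_measurable_integrable int')
    next
      case False
      then have "?s r = (\<lambda>s. r powr (- c) * (indicator {0} s * f 0) * (if r = 0 then 1 else 0))"
        by (auto simp: indicator_def)
      then show ?thesis by simp
    qed
    have "integrable lborel (\<lambda>s. \<bar>indicator {0..1} s * f s\<bar> + \<bar>indicator {1..} s * (s powr (- c) * f s)\<bar>)"
      using int'[of 1] inf by (intro Bochner_Integration.integrable_add integrable_abs) (simp_all add: set_integrable_def)
    then show "integrable lborel ?w" by (simp add: abs_mult)
    show "\<forall>\<^sub>F r in at_top. AE s in lborel. norm (?s r s) \<le> ?w s"
      using eventually_ge_at_top[of 1]
    proof eventually_elim
      case (elim r)
      have "norm (?s r s) \<le> ?w s" for s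
      proof -
        consider "s < 0 \<or> r < s" | "0 \<le> s" "s < 1" | "1 \<le> s" "s \<le> r" using elim by linarith
        then show ?thesis
        proof cases
          case 2
          have "r powr (- c) \<le> 1" using elim c powr_mono2'[of "- c" 1 r] by simp
          then show ?thesis using 2 elim by (auto simp: indicator_def abs_mult intro: mult_left_le_one_le)
        next
          case 3
          then have "r powr (- c) \<le> s powr (- c)" using c by (intro powr_mono2') auto
          then show ?thesis using 3 by (auto simp: indicator_def abs_mult intro!: mult_right_mono)
        qed (auto simp: indicator_def)
      qed
      then show ?case by auto
    qed
    show "AE s in lborel. ((\<lambda>r. ?s r s) \<longlongrightarrow> 0) at_top"
    proof (rule AE_I2)
      fix s
      have "((\<lambda>r. r powr (- c) * \<bar>f s\<bar>) \<longlongrightarrow> 0 * \<bar>f s\<bar>) at_top"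
        using c by (intro tendsto_mult tendsto_const tendsto_neg_powr filterlim_ident) auto
      then have "((\<lambda>r. r powr (- c) * \<bar>f s\<bar>) \<longlongrightarrow> 0) at_top" by simp
      then show "((\<lambda>r. ?s r s) \<longlongrightarrow> 0) at_top"
        by (rule Lim_null_comparison[rotated]) (auto simp: indicator_def abs_mult intro!: always_eventually)
    qed
  qed simp
  then show ?thesis by (simp add: set_lebesgue_integral_def)
qed

text \<open>The mirror image of the preceding lemma. The variable \<open>r\<close> is replaced by its inverse to have a limit
  at infinity, and the integrand is cut off for \<open>r < 1\<close> to be measurable throughout.\<close>

lemma weighted_integral_to_infinity_tendsto_0:
  fixes f :: "real \<Rightarrow> real"
  assumes c: "0 < c" and int: "\<And>t. 0 < t \<Longrightarrow> set_integrable lborel {t..} f"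
    and zero: "set_integrable lborel {0..1} (\<lambda>s. s powr c * f s)"
  shows "((\<lambda>r. r powr c * (LBINT s:{r..}. f s)) \<longlongrightarrow> 0) (at_right 0)"
proof -
  let ?s = "\<lambda>r s. inverse r powr c * (indicator {inverse r..} s * f s)"
  let ?w = "\<lambda>s. indicator {1..} s * \<bar>f s\<bar> + indicator {0..1} s * \<bar>s powr c * f s\<bar>"
  have "((\<lambda>r. \<integral>s. (if 1 \<le> r then ?s r s else 0) \<partial>lborel) \<longlongrightarrow> (\<integral>s. 0 \<partial>(lborel :: real measure))) at_top"
  proof (rule integral_dominated_convergence_at_top[where w="?w"])
    have int': "integrable lborel (\<lambda>s. indicator {r..} s * f s)" if "0 < r" for r
      using int[OF that] by (simp add: set_integrable_def)
    show "(\<lambda>s. if 1 \<le> r then ?s r s else 0) \<in> borel_measurable lborel" for r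
    proof (cases "1 \<le> r")
      case True
      then show ?thesis using borel_measurable_integrable[OF int'[of "inverse r"]] by simp
    qed simp
    have "integrable lborel (\<lambda>s. \<bar>indicator {1..} s * f s\<bar> + \<bar>indicator {0..1} s * (s powr c * f s)\<bar>)"
      using int'[of 1] zero by (intro Bochner_Integration.integrable_add integrable_abs) (simp_all add: set_integrable_def)
    then show "integrable lborel ?w" by (simp add: abs_mult)
    show "\<forall>\<^sub>F r in at_top. AE s in lborel. norm (if 1 \<le> r then ?s r s else 0) \<le> ?w s"
      using eventually_ge_at_top[of 1]
    proof eventually_elim
      case (elim r)
      have "norm (?s r s) \<le> ?w s" for s
      proof -
        have r: "0 < inverse r" "inverse r \<le> 1" using elim by (auto simp: inverse_le_1_iff)
        consider "s < inverse r" | "inverse r \<le> s" "s < 1" | "1 \<le> s" by linarith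
        then show ?thesis
        proof cases
          case 2
          then have "inverse r powr c \<le> s powr c" using c r by (intro powr_mono2) auto
          moreover have "0 \<le> s" using 2 r by linarith
          ultimately show ?thesis using 2 by (auto simp: indicator_def abs_mult intro!: mult_right_mono)
        next
          case 3
          have "inverse r powr c \<le> 1 powr c" using c r by (intro powr_mono2) auto
          then have "inverse r powr c * \<bar>f s\<bar> \<le> \<bar>f s\<bar>" by (intro mult_left_le_one_le) auto
          then have "norm (?s r s) \<le> \<bar>f s\<bar>" by (simp add: indicator_def abs_mult)
          also have "\<dots> \<le> ?w s" using 3 by (simp add: indicator_def)
          finally show ?thesis .
        qed (auto simp: indicator_def)
      qed
      then show ?case using elim by auto
    qed
    show "AE s in lborel. ((\<lambda>r. if 1 \<le> r then ?s r s else 0) \<longlongrightarrow> 0) at_top"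
    proof (rule AE_I2)
      fix s
      have "((\<lambda>r. r powr (- c) * \<bar>f s\<bar>) \<longlongrightarrow> 0 * \<bar>f s\<bar>) at_top"
        using c by (intro tendsto_mult tendsto_const tendsto_neg_powr filterlim_ident) auto
      then have "((\<lambda>r. r powr (- c) * \<bar>f s\<bar>) \<longlongrightarrow> 0) at_top" by simp
      then show "((\<lambda>r. if 1 \<le> r then ?s r s else 0) \<longlongrightarrow> 0) at_top"
        by (rule Lim_null_comparison[rotated])
          (auto simp: indicator_def abs_mult inverse_powr powr_minus intro!: always_eventually)
    qed
  qed simp
  then have "((\<lambda>r. \<integral>s. (if 1 \<le> r then ?s r s else 0) \<partial>lborel) \<longlongrightarrow> 0) at_top" by simp
  moreover have "\<forall>\<^sub>F r in at_top. (\<integral>s. (if 1 \<le> r then ?s r s else 0) \<partial>lborel) = inverse r powr c * (LBINT s:{inverse r..}. f s)"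
    using eventually_ge_at_top[of 1] by eventually_elim (simp add: set_lebesgue_integral_def)
  ultimately have "((\<lambda>r. inverse r powr c * (LBINT s:{inverse r..}. f s)) \<longlongrightarrow> 0) at_top"
    by (rule Lim_transform_eventually)
  then show ?thesis by (simp add: filterlim_at_right_to_top)
qed

text \<open>The paths that start at \<open>0\<close> and for which the integrals in both transformations converge. Integrability at \<open>0\<close> and at
  infinity is also what makes the boundary terms in the inversion formulas vanish.\<close>

definition Z_domain :: "real \<Rightarrow> real \<Rightarrow> (real \<Rightarrow> real) set" where
  "Z_domain \<beta> \<alpha> = {\<omega> \<in> paths. \<omega> 0 = 0 \<and>
     (\<forall>t>0. set_integrable lborel {0..t} (\<lambda>s. Z_integrand \<beta> \<alpha> s \<omega>)) \<and>
     (\<forall>t>0. set_integrable lborel {t..} (\<lambda>s. Z_inv_integrand \<beta> \<alpha> s \<omega>))}"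

lemma continuous_on_Z_integrand:
  assumes "\<omega> \<in> paths"
  shows "continuous_on {0<..} (\<lambda>s. Z_integrand \<beta> \<alpha> s \<omega>)" "continuous_on {0<..} (\<lambda>s. Z_inv_integrand \<beta> \<alpha> s \<omega>)"
proof -
  have "continuous_on {0<..} \<omega>"
    using assms by (auto simp: paths_def intro: continuous_on_subset)
  then show "continuous_on {0<..} (\<lambda>s. Z_integrand \<beta> \<alpha> s \<omega>)" "continuous_on {0<..} (\<lambda>s. Z_inv_integrand \<beta> \<alpha> s \<omega>)"
    unfolding Z_integrand_def Z_inv_integrand_def by (auto intro!: continuous_intros)
qed

lemma Z_integral_has_derivative:
  assumes "\<omega> \<in> Z_domain \<beta> \<alpha>" "0 < t"
  shows "((\<lambda>t. LBINT s:{0..t}. Z_integrand \<beta> \<alpha> s \<omega>) has_real_derivative Z_integrand \<beta> \<alpha> t \<omega>) (at t)"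
  using assms by (intro integral_from_0_has_derivative continuous_on_Z_integrand) (auto simp: Z_domain_def)

lemma Z_inv_integral_has_derivative:
  assumes "\<omega> \<in> Z_domain \<beta> \<alpha>" "0 < t"
  shows "((\<lambda>t. LBINT s:{t..}. Z_inv_integrand \<beta> \<alpha> s \<omega>) has_real_derivative - Z_inv_integrand \<beta> \<alpha> t \<omega>) (at t)"
  using assms by (intro integral_to_infinity_has_derivative continuous_on_Z_integrand) (auto simp: Z_domain_def)

lemma Z_transform_extensional:
  "Z_transform \<beta> \<alpha> \<omega> \<in> extensional {0..}" "Z_inv_transform \<beta> \<alpha> \<omega> \<in> extensional {0..}"
  "Z_transform \<beta> \<alpha> \<omega> 0 = 0" "Z_inv_transform \<beta> \<alpha> \<omega> 0 = 0"
  by (auto simp: Z_transform_def Z_inv_transform_def)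

lemma continuous_on_Z_transform:
  assumes "\<omega> \<in> Z_domain \<beta> \<alpha>"
  shows "continuous_on {0<..} (Z_transform \<beta> \<alpha> \<omega>)" "continuous_on {0<..} (Z_inv_transform \<beta> \<alpha> \<omega>)"
proof -
  have c: "continuous_on {0<..} \<omega>"
    using assms by (auto simp: Z_domain_def paths_def intro: continuous_on_subset)
  have "continuous_on {0<..} (\<lambda>t. LBINT s:{0..t}. Z_integrand \<beta> \<alpha> s \<omega>)"
    "continuous_on {0<..} (\<lambda>t. LBINT s:{t..}. Z_inv_integrand \<beta> \<alpha> s \<omega>)"
    using DERIV_continuous[OF Z_integral_has_derivative[OF assms]] DERIV_continuous[OF Z_inv_integral_has_derivative[OF assms]]
    by (auto simp: continuous_on_eq_continuous_at)
  note c' = this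
  have "continuous_on {0<..} (\<lambda>t. \<omega> t - (2 * \<alpha> + 1) * t powr (\<beta> - \<alpha> - 1/2) * (LBINT s:{0..t}. Z_integrand \<beta> \<alpha> s \<omega>))"
    by (intro continuous_intros c c') auto
  then show "continuous_on {0<..} (Z_transform \<beta> \<alpha> \<omega>)"
    by (rule continuous_on_cong[THEN iffD1, rotated 2]) (auto simp: Z_transform_def)
  have "continuous_on {0<..} (\<lambda>t. \<omega> t - (2 * \<alpha> + 1) * t powr (\<alpha> + \<beta> + 1/2) * (LBINT s:{t..}. Z_inv_integrand \<beta> \<alpha> s \<omega>))"
    by (intro continuous_intros c c') auto
  then show "continuous_on {0<..} (Z_inv_transform \<beta> \<alpha> \<omega>)"
    by (rule continuous_on_cong[THEN iffD1, rotated 2]) (auto simp: Z_inv_transform_def)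
qed

text \<open>Let \<open>I t\<close> be the integral over \<open>[0,t]\<close> in the transformation and \<open>\<eta> = Z \<omega>\<close>. The integrand
  \<open>\<eta> s * s powr (-\<beta>-\<alpha>-3/2)\<close> of the inverse transformation is the derivative of \<open>s powr (-2\<alpha>-1) * I s\<close>,
  which vanishes at infinity. Hence its integral over \<open>[t,\<infinity>)\<close> is \<open>- t powr (-2\<alpha>-1) * I t\<close>, and inserting
  this value in the formula for the inverse cancels the integral term of \<open>\<eta> t\<close>.\<close>

lemma Z_inv_transform_Z_transform:
  assumes \<alpha>: "\<alpha> > - 1/2" and \<omega>: "\<omega> \<in> Z_domain \<beta> \<alpha>" and \<eta>: "Z_transform \<beta> \<alpha> \<omega> \<in> Z_domain \<beta> \<alpha>"
  shows "Z_inv_transform \<beta> \<alpha> (Z_transform \<beta> \<alpha> \<omega>) = \<omega>"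
proof
  fix t
  define \<eta> where "\<eta> = Z_transform \<beta> \<alpha> \<omega>"
  define I where "I t = (LBINT s:{0..t}. Z_integrand \<beta> \<alpha> s \<omega>)" for t
  define F where "F s = s powr (- (2 * \<alpha> + 1)) * I s" for s
  have \<eta>_eq: "\<eta> t = \<omega> t - (2 * \<alpha> + 1) * t powr (\<beta> - \<alpha> - 1/2) * I t" if "0 < t" for t
    using that by (simp add: \<eta>_def Z_transform_def I_def)
  have F': "(F has_real_derivative Z_inv_integrand \<beta> \<alpha> s \<eta>) (at s)" if s: "0 < s" for s
  proof -
    have "(F has_real_derivative (- (2 * \<alpha> + 1)) * s powr (- (2 * \<alpha> + 1) - 1) * I s + s powr (- (2 * \<alpha> + 1)) * Z_integrand \<beta> \<alpha> s \<omega>) (at s)"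
      using Z_integral_has_derivative[OF \<omega> s] s unfolding F_def I_def
      by (auto intro!: derivative_eq_intros)
    \<comment> \<open>The powers are abstracted to variables to keep the simplifier from rearranging the exponents.\<close>
    moreover have "A * B = C \<Longrightarrow> D * C = E \<Longrightarrow> - k * E * x + A * (B * y) = (y - k * D * x) * C" for A B C D E k x y :: real
      by (auto simp: algebra_simps)
    note this[of "s powr (- (2 * \<alpha> + 1))" "s powr (\<alpha> - \<beta> - 1/2)" "s powr (- \<beta> - \<alpha> - 3/2)"
        "s powr (\<beta> - \<alpha> - 1/2)" "s powr (- (2 * \<alpha> + 1) - 1)" "2 * \<alpha> + 1" "I s" "\<omega> s", OF powr_mult_powr powr_mult_powr]
    then have "(- (2 * \<alpha> + 1)) * s powr (- (2 * \<alpha> + 1) - 1) * I s + s powr (- (2 * \<alpha> + 1)) * Z_integrand \<beta> \<alpha> s \<omega> = Z_inv_integrand \<beta> \<alpha> s \<eta>"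
      unfolding Z_integrand_def Z_inv_integrand_def \<eta>_eq[OF s] by simp
    ultimately show ?thesis by simp
  qed
  have Flim: "(F \<longlongrightarrow> 0) at_top" unfolding F_def I_def
  proof (rule weighted_integral_from_0_tendsto_0)
    show "0 < 2 * \<alpha> + 1" using \<alpha> by simp
    have "s powr (- (2 * \<alpha> + 1)) * Z_integrand \<beta> \<alpha> s \<omega> = Z_inv_integrand \<beta> \<alpha> s \<omega>" for s
      unfolding Z_integrand_def Z_inv_integrand_def
      using powr_mult_powr[of "- (2 * \<alpha> + 1)" "\<alpha> - \<beta> - 1/2" "- \<beta> - \<alpha> - 3/2" s]
      by (simp add: mult.assoc[symmetric] del: mult_minus_left)
    then show "set_integrable lborel {1..} (\<lambda>s. s powr (- (2 * \<alpha> + 1)) * Z_integrand \<beta> \<alpha> s \<omega>)"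
      using \<omega> by (simp add: Z_domain_def)
  qed (use \<omega> in \<open>simp add: Z_domain_def\<close>)
  have K: "(LBINT s:{t..}. Z_inv_integrand \<beta> \<alpha> s \<eta>) = - F t" if t: "0 < t"
  proof -
    have int: "set_integrable lborel {t..} (\<lambda>s. Z_inv_integrand \<beta> \<alpha> s \<eta>)"
      using assms t by (simp add: Z_domain_def \<eta>_def)
    have "((\<lambda>r. LBINT s:{t..r}. Z_inv_integrand \<beta> \<alpha> s \<eta>) \<longlongrightarrow> (LBINT s:{t..}. Z_inv_integrand \<beta> \<alpha> s \<eta>)) at_top"
      by (rule tendsto_set_lebesgue_integral_at_top[OF _ int]) simp
    moreover have "\<forall>\<^sub>F r in at_top. (LBINT s:{t..r}. Z_inv_integrand \<beta> \<alpha> s \<eta>) = F r - F t"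
      using eventually_ge_at_top[of t]
    proof eventually_elim
      case (elim r)
      have "((\<lambda>s. Z_inv_integrand \<beta> \<alpha> s \<eta>) has_integral (F r - F t)) {t..r}"
        using elim t F' by (intro fundamental_theorem_of_calculus)
          (auto simp flip: has_real_derivative_iff_has_vector_derivative intro: has_field_derivative_at_within)
      then show ?case
        using set_borel_integral_eq_integral(2)[OF set_integrable_subset[OF int, of "{t..r}"]] by (simp add: integral_unique)
    qed
    ultimately have "((\<lambda>r. F r - F t) \<longlongrightarrow> (LBINT s:{t..}. Z_inv_integrand \<beta> \<alpha> s \<eta>)) at_top"
      by (rule Lim_transform_eventually)
    moreover have "((\<lambda>r. F r - F t) \<longlongrightarrow> 0 - F t) at_top" by (intro tendsto_intros Flim)
    ultimately show ?thesis using tendsto_unique trivial_limit_at_top_linorder by fastforce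
  qed
  consider "t < 0" | "t = 0" | "0 < t" by linarith
  then have "Z_inv_transform \<beta> \<alpha> \<eta> t = \<omega> t"
  proof cases
    case 1
    then show ?thesis using \<omega> by (auto simp: Z_inv_transform_def Z_domain_def paths_def extensional_def)
  next
    case 2
    then show ?thesis using \<omega> by (simp add: Z_inv_transform_def Z_domain_def)
  next
    case 3
    have "t powr (\<alpha> + \<beta> + 1/2) * t powr (- (2 * \<alpha> + 1)) = t powr (\<beta> - \<alpha> - 1/2)"
      by (rule powr_mult_powr) simp
    then show ?thesis using 3 by (simp add: Z_inv_transform_def K \<eta>_eq F_def mult.assoc)
  qed
  then show "Z_inv_transform \<beta> \<alpha> (Z_transform \<beta> \<alpha> \<omega>) t = \<omega> t" by (simp add: \<eta>_def)
qed

text \<open>The same computation in the other direction: let \<open>K t\<close> be the integral over \<open>[t,\<infinity>)\<close> in the inverse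
  transformation and \<open>\<omega>\<close> the image of \<open>\<eta>\<close> under it. The integrand \<open>\<omega> s * s powr (\<alpha>-\<beta>-1/2)\<close> of the
  transformation is the derivative of \<open>- s powr (2\<alpha>+1) * K s\<close>, which vanishes at \<open>0\<close>.\<close>

lemma Z_transform_Z_inv_transform:
  assumes \<alpha>: "\<alpha> > - 1/2" and \<eta>: "\<eta> \<in> Z_domain \<beta> \<alpha>" and \<omega>': "Z_inv_transform \<beta> \<alpha> \<eta> \<in> Z_domain \<beta> \<alpha>"
  shows "Z_transform \<beta> \<alpha> (Z_inv_transform \<beta> \<alpha> \<eta>) = \<eta>"
proof
  fix t
  define \<omega> where "\<omega> = Z_inv_transform \<beta> \<alpha> \<eta>"
  define K where "K t = (LBINT s:{t..}. Z_inv_integrand \<beta> \<alpha> s \<eta>)" for t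
  define F where "F s = s powr (2 * \<alpha> + 1) * K s" for s
  have \<omega>_eq: "\<omega> t = \<eta> t - (2 * \<alpha> + 1) * t powr (\<alpha> + \<beta> + 1/2) * K t" if "0 < t" for t
    using that by (simp add: \<omega>_def Z_inv_transform_def K_def)
  have F': "(F has_real_derivative - Z_integrand \<beta> \<alpha> s \<omega>) (at s)" if s: "0 < s" for s
  proof -
    have "(F has_real_derivative (2 * \<alpha> + 1) * s powr ((2 * \<alpha> + 1) - 1) * K s + s powr (2 * \<alpha> + 1) * (- Z_inv_integrand \<beta> \<alpha> s \<eta>)) (at s)"
      using Z_inv_integral_has_derivative[OF \<eta> s] s unfolding F_def K_def
      by (auto intro!: derivative_eq_intros)
    moreover have "s powr (2 * \<alpha> + 1) * s powr (- \<beta> - \<alpha> - 3/2) = s powr (\<alpha> - \<beta> - 1/2)"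
      "s powr (\<alpha> - \<beta> - 1/2) * s powr (\<alpha> + \<beta> + 1/2) = s powr ((2 * \<alpha> + 1) - 1)"
      by (rule powr_mult_powr, simp)+
    then have "(2 * \<alpha> + 1) * s powr ((2 * \<alpha> + 1) - 1) * K s + s powr (2 * \<alpha> + 1) * (- Z_inv_integrand \<beta> \<alpha> s \<eta>) = - Z_integrand \<beta> \<alpha> s \<omega>"
      unfolding Z_integrand_def Z_inv_integrand_def \<omega>_eq[OF s] by (simp add: right_diff_distrib mult_ac)
    ultimately show ?thesis by simp
  qed
  have Flim: "(F \<longlongrightarrow> 0) (at_right 0)" unfolding F_def K_def
  proof (rule weighted_integral_to_infinity_tendsto_0)
    show "0 < 2 * \<alpha> + 1" using \<alpha> by simp
    have "s powr (2 * \<alpha> + 1) * Z_inv_integrand \<beta> \<alpha> s \<eta> = Z_integrand \<beta> \<alpha> s \<eta>" for s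
      unfolding Z_integrand_def Z_inv_integrand_def
      using powr_mult_powr[of "2 * \<alpha> + 1" "- \<beta> - \<alpha> - 3/2" "\<alpha> - \<beta> - 1/2" s]
      by (simp add: mult.left_commute[of _ "\<eta> s"] mult.commute[of _ "\<eta> s"])
    then show "set_integrable lborel {0..1} (\<lambda>s. s powr (2 * \<alpha> + 1) * Z_inv_integrand \<beta> \<alpha> s \<eta>)"
      using \<eta> by (simp add: Z_domain_def)
  qed (use \<eta> in \<open>simp add: Z_domain_def\<close>)
  have I: "(LBINT s:{0..t}. Z_integrand \<beta> \<alpha> s \<omega>) = - F t" if t: "0 < t"
  proof -
    have int: "set_integrable lborel {0..t} (\<lambda>s. Z_integrand \<beta> \<alpha> s \<omega>)"
      using assms t by (simp add: Z_domain_def \<omega>_def)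
    note lim = integral_from_0_tendsto[OF int t]
    have "\<forall>\<^sub>F r in at_right 0. (LBINT s:{r..t}. Z_integrand \<beta> \<alpha> s \<omega>) = F r - F t"
      using eventually_at_right_real[OF t]
    proof eventually_elim
      case (elim r)
      have "((\<lambda>s. - Z_integrand \<beta> \<alpha> s \<omega>) has_integral (F t - F r)) {r..t}"
        using elim t F' by (intro fundamental_theorem_of_calculus)
          (auto simp flip: has_real_derivative_iff_has_vector_derivative intro: has_field_derivative_at_within)
      from has_integral_neg[OF this] have "((\<lambda>s. Z_integrand \<beta> \<alpha> s \<omega>) has_integral (F r - F t)) {r..t}" by simp
      then show ?case
        using set_borel_integral_eq_integral(2)[OF set_integrable_subset[OF int, of "{r..t}"]] elim by (simp add: integral_unique)
    qed
    from Lim_transform_eventually[OF lim this]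
    have "((\<lambda>r. F r - F t) \<longlongrightarrow> (LBINT s:{0..t}. Z_integrand \<beta> \<alpha> s \<omega>)) (at_right 0)" .
    moreover have "((\<lambda>r. F r - F t) \<longlongrightarrow> 0 - F t) (at_right 0)" by (intro tendsto_intros Flim)
    ultimately have "(LBINT s:{0..t}. Z_integrand \<beta> \<alpha> s \<omega>) = 0 - F t"
      by (rule tendsto_unique[rotated]) simp
    then show ?thesis by simp
  qed
  consider "t < 0" | "t = 0" | "0 < t" by linarith
  then have "Z_transform \<beta> \<alpha> \<omega> t = \<eta> t"
  proof cases
    case 1
    then show ?thesis using \<eta> by (auto simp: Z_transform_def Z_domain_def paths_def extensional_def)
  next
    case 2
    then show ?thesis using \<eta> by (simp add: Z_transform_def Z_domain_def)
  next
    case 3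
    have "t powr (\<beta> - \<alpha> - 1/2) * t powr (2 * \<alpha> + 1) = t powr (\<alpha> + \<beta> + 1/2)"
      by (rule powr_mult_powr) simp
    then show ?thesis using 3 by (simp add: Z_transform_def I \<omega>_eq F_def mult.assoc)
  qed
  then show "Z_transform \<beta> \<alpha> (Z_inv_transform \<beta> \<alpha> \<eta>) t = \<eta> t" by (simp add: \<omega>_def)
qed

section \<open>Mean square calculus of measurable processes\<close>

lemma integral_square_add_le_square:
  assumes f: "square_integrable M f" and g: "square_integrable M g"
    and a: "(\<integral>x. (f x)\<^sup>2 \<partial>M) \<le> a\<^sup>2" "0 \<le> a" and b: "(\<integral>x. (g x)\<^sup>2 \<partial>M) \<le> b\<^sup>2" "0 \<le> b"
  shows "(\<integral>x. (f x + g x)\<^sup>2 \<partial>M) \<le> (a + b)\<^sup>2"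
proof -
  have "(\<integral>x. f x * g x \<partial>M) \<le> sqrt (\<integral>x. (f x)\<^sup>2 \<partial>M) * sqrt (\<integral>x. (g x)\<^sup>2 \<partial>M)"
    using abs_integral_mult_le[OF f g] by linarith
  also have "\<dots> \<le> a * b"
    using a b by (intro mult_mono real_le_lsqrt real_sqrt_ge_zero) auto
  finally have fg: "(\<integral>x. f x * g x \<partial>M) \<le> a * b" .
  have "(\<integral>x. (f x + g x)\<^sup>2 \<partial>M) = (\<integral>x. (f x)\<^sup>2 + (g x)\<^sup>2 + 2 * (f x * g x) \<partial>M)"
    by (simp add: power2_sum mult.assoc)
  also have "\<dots> = (\<integral>x. (f x)\<^sup>2 \<partial>M) + (\<integral>x. (g x)\<^sup>2 \<partial>M) + 2 * (\<integral>x. f x * g x \<partial>M)"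
    using f g square_integrable_mult[OF f g] by (simp add: square_integrable_def)
  also have "\<dots> \<le> a\<^sup>2 + b\<^sup>2 + 2 * (a * b)" using a b fg by linarith
  finally show ?thesis by (simp add: power2_sum mult.assoc)
qed

lemma integral_square_sum_le_square:
  assumes "finite S" and "\<And>i. i \<in> S \<Longrightarrow> square_integrable M (f i)"
    and "\<And>i. i \<in> S \<Longrightarrow> (\<integral>x. (f i x)\<^sup>2 \<partial>M) \<le> (b i)\<^sup>2" and "\<And>i. i \<in> S \<Longrightarrow> 0 \<le> b i"
  shows "(\<integral>x. (\<Sum>i\<in>S. f i x)\<^sup>2 \<partial>M) \<le> (\<Sum>i\<in>S. b i)\<^sup>2"
  using assms
proof (induction S rule: finite_induct)
  case (insert a S)
  have "(\<integral>x. (f a x + (\<Sum>i\<in>S. f i x))\<^sup>2 \<partial>M) \<le> (b a + (\<Sum>i\<in>S. b i))\<^sup>2"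
    using insert by (intro integral_square_add_le_square square_integrable_sum sum_nonneg) auto
  then show ?case using insert.hyps by simp
qed simp

text \<open>Integration in time of a measurable process whose \<open>L\<^sup>2\<close> norm at time \<open>s\<close> is at most \<open>b s\<close>.\<close>

locale dominated_process = prob_space M for M :: "'a measure" +
  fixes U :: "real \<Rightarrow> 'a \<Rightarrow> real" and b :: "real \<Rightarrow> real" and B :: real
  assumes U_measurable: "(\<lambda>(x, s). U s x) \<in> borel_measurable (M \<Otimes>\<^sub>M lborel)"
    and b_measurable: "b \<in> borel_measurable borel" and b_nonneg: "\<And>s. 0 \<le> b s"
    and U_bound: "\<And>s. (\<integral>\<^sup>+x. ennreal ((U s x)\<^sup>2) \<partial>M) \<le> ennreal ((b s)\<^sup>2)"
    and b_bound: "(\<integral>\<^sup>+s. ennreal (b s) \<partial>lborel) \<le> ennreal B" and B_nonneg: "0 \<le> B"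
begin

lemma U_section_measurable: "U s \<in> borel_measurable M"
  using measurable_Pair1[OF U_measurable, of s] by simp

lemma U_path_measurable: "x \<in> space M \<Longrightarrow> (\<lambda>s. U s x) \<in> borel_measurable lborel"
  using measurable_Pair2[OF U_measurable, of x] by simp

lemma nn_integral_square_le: "(\<integral>\<^sup>+x. (\<integral>\<^sup>+s. ennreal \<bar>U s x\<bar> \<partial>lborel)\<^sup>2 \<partial>M) \<le> ennreal (B\<^sup>2)"
proof -
  have "(\<integral>\<^sup>+x. (\<integral>\<^sup>+s. ennreal \<bar>U s x\<bar> \<partial>lborel)\<^sup>2 \<partial>M) \<le> (\<integral>\<^sup>+s. ennreal (b s) \<partial>lborel)\<^sup>2"
    by (rule Minkowski_integral_inequality_2)
       (use U_measurable b_measurable b_nonneg U_bound in \<open>auto intro: sigma_finite_lborel sigma_finite_measure_axioms\<close>)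
  also have "\<dots> \<le> (ennreal B)\<^sup>2" by (rule power_mono[OF b_bound]) simp
  finally show ?thesis using B_nonneg by (simp add: ennreal_power)
qed

lemma nn_integral_abs_measurable: "(\<lambda>x. \<integral>\<^sup>+s. ennreal \<bar>U s x\<bar> \<partial>lborel) \<in> borel_measurable M"
proof -
  define V where "V = (\<lambda>(x, s). U s x)"
  have [measurable]: "V \<in> borel_measurable (M \<Otimes>\<^sub>M lborel)" using U_measurable by (simp add: V_def)
  have "(\<lambda>x. \<integral>\<^sup>+s. ennreal \<bar>V (x, s)\<bar> \<partial>lborel) \<in> borel_measurable M" by measurable
  then show ?thesis by (simp add: V_def)
qed

lemma AE_integrable: "AE x in M. integrable lborel (\<lambda>s. U s x)"
proof -
  have "(\<integral>\<^sup>+x. (\<integral>\<^sup>+s. ennreal \<bar>U s x\<bar> \<partial>lborel)\<^sup>2 \<partial>M) \<noteq> \<infinity>"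
    using nn_integral_square_le by (auto simp: top_unique)
  then have "AE x in M. (\<integral>\<^sup>+s. ennreal \<bar>U s x\<bar> \<partial>lborel)\<^sup>2 \<noteq> \<infinity>"
    using nn_integral_abs_measurable by (intro nn_integral_noteq_infinite) auto
  then show ?thesis using AE_space
  proof eventually_elim
    case (elim x)
    then have "(\<integral>\<^sup>+s. ennreal (norm (U s x)) \<partial>lborel) < \<infinity>"
      by (auto simp: power2_eq_square ennreal_mult_eq_top_iff less_top)
    then show ?case using U_path_measurable[OF elim(2)] by (simp add: integrable_iff_bounded)
  qed
qed

lemma integral_measurable: "(\<lambda>x. \<integral>s. U s x \<partial>lborel) \<in> borel_measurable M"
  by (rule lborel.borel_measurable_lebesgue_integral) (rule U_measurable)

lemma square_integrable_integral: "square_integrable M (\<lambda>x. \<integral>s. U s x \<partial>lborel)"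
  and integral_square_le: "(\<integral>x. (\<integral>s. U s x \<partial>lborel)\<^sup>2 \<partial>M) \<le> B\<^sup>2"
proof -
  have "(\<integral>\<^sup>+x. ennreal ((\<integral>s. U s x \<partial>lborel)\<^sup>2) \<partial>M) \<le> (\<integral>\<^sup>+x. (\<integral>\<^sup>+s. ennreal \<bar>U s x\<bar> \<partial>lborel)\<^sup>2 \<partial>M)"
  proof (rule nn_integral_mono_AE)
    show "AE x in M. ennreal ((\<integral>s. U s x \<partial>lborel)\<^sup>2) \<le> (\<integral>\<^sup>+s. ennreal \<bar>U s x\<bar> \<partial>lborel)\<^sup>2"
      using AE_integrable
    proof eventually_elim
      case (elim x)
      have "ennreal ((\<integral>s. U s x \<partial>lborel)\<^sup>2) = (ennreal \<bar>\<integral>s. U s x \<partial>lborel\<bar>)\<^sup>2"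
        by (simp add: ennreal_power)
      also have "\<dots> \<le> (\<integral>\<^sup>+s. ennreal \<bar>U s x\<bar> \<partial>lborel)\<^sup>2"
        using integral_norm_bound_ennreal[OF elim] by (intro power_mono) auto
      finally show ?case .
    qed
  qed
  also note nn_integral_square_le
  finally have nn: "(\<integral>\<^sup>+x. ennreal ((\<integral>s. U s x \<partial>lborel)\<^sup>2) \<partial>M) \<le> ennreal (B\<^sup>2)" .
  then show sq: "square_integrable M (\<lambda>x. \<integral>s. U s x \<partial>lborel)"
    by (intro square_integrableI_nn_integral integral_measurable) (auto simp: le_less_trans)
  show "(\<integral>x. (\<integral>s. U s x \<partial>lborel)\<^sup>2 \<partial>M) \<le> B\<^sup>2"
    using nn sq by (simp add: square_integrable_def nn_integral_eq_integral)
qed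

end

lemma (in prob_space) Fubini_dominated:
  fixes U :: "real \<Rightarrow> 'a \<Rightarrow> real"
  assumes U: "(\<lambda>(x, s). U s x) \<in> borel_measurable (M \<Otimes>\<^sub>M lborel)"
    and bound: "\<And>s. (\<integral>\<^sup>+x. ennreal \<bar>U s x\<bar> \<partial>M) \<le> b s" and fin: "(\<integral>\<^sup>+s. b s \<partial>lborel) < \<infinity>"
  shows "AE x in M. integrable lborel (\<lambda>s. U s x)"
    and "(\<integral>x. (\<integral>s. U s x \<partial>lborel) \<partial>M) = (\<integral>s. (\<integral>x. U s x \<partial>M) \<partial>lborel)"
    and "integrable M (\<lambda>x. \<integral>s. U s x \<partial>lborel)"
proof -
  interpret pair_sigma_finite M "lborel :: real measure" ..
  have "(\<integral>\<^sup>+p. ennreal (norm (case p of (x, s) \<Rightarrow> U s x)) \<partial>(M \<Otimes>\<^sub>M lborel)) = (\<integral>\<^sup>+s. \<integral>\<^sup>+x. ennreal \<bar>U s x\<bar> \<partial>M \<partial>lborel)"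
    using U by (subst nn_integral_snd[symmetric]) (auto simp: case_prod_beta)
  also have "\<dots> \<le> (\<integral>\<^sup>+s. b s \<partial>lborel)" by (intro nn_integral_mono bound)
  finally have int: "integrable (M \<Otimes>\<^sub>M lborel) (\<lambda>(x, s). U s x)"
    using U fin by (simp add: integrable_iff_bounded)
  show "AE x in M. integrable lborel (\<lambda>s. U s x)" using AE_integrable_fst[OF int] .
  show "(\<integral>x. (\<integral>s. U s x \<partial>lborel) \<partial>M) = (\<integral>s. (\<integral>x. U s x \<partial>M) \<partial>lborel)"
    using Fubini_integral[OF int] by simp
  show "integrable M (\<lambda>x. \<integral>s. U s x \<partial>lborel)" using integrable_fst[OF int] .
qed

context dominated_process
begin

lemma integral_mult_integral:
  assumes V: "square_integrable M V"
  shows "(\<integral>x. V x * (\<integral>s. U s x \<partial>lborel) \<partial>M) = (\<integral>s. (\<integral>x. V x * U s x \<partial>M) \<partial>lborel)"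
proof -
  define v where "v = sqrt (\<integral>x. (V x)\<^sup>2 \<partial>M)"
  define W where "W = (\<lambda>(x, s). U s x)"
  have [measurable]: "V \<in> borel_measurable M" using V by (simp add: square_integrable_def)
  have [measurable]: "W \<in> borel_measurable (M \<Otimes>\<^sub>M lborel)" using U_measurable by (simp add: W_def)
  have [measurable]: "b \<in> borel_measurable borel" by (rule b_measurable)
  have nV: "(\<integral>\<^sup>+x. ennreal ((V x)\<^sup>2) \<partial>M) \<le> ennreal (v\<^sup>2)"
    using V by (simp add: square_integrable_def nn_integral_eq_integral v_def)
  have "(\<integral>x. (\<integral>s. V x * U s x \<partial>lborel) \<partial>M) = (\<integral>s. (\<integral>x. V x * U s x \<partial>M) \<partial>lborel)"
  proof (rule Fubini_dominated(2))
    have "(\<lambda>(x, s). V x * W (x, s)) \<in> borel_measurable (M \<Otimes>\<^sub>M lborel)" by measurable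
    then show "(\<lambda>(x, s). V x * U s x) \<in> borel_measurable (M \<Otimes>\<^sub>M lborel)" by (simp add: W_def)
    show "(\<integral>\<^sup>+x. ennreal \<bar>V x * U s x\<bar> \<partial>M) \<le> ennreal (v * b s)" for s
      using nV U_bound[of s] b_nonneg[of s] U_section_measurable[of s]
      by (intro nn_integral_abs_mult_le) (auto simp: v_def)
    have "(\<integral>\<^sup>+s. ennreal (v * b s) \<partial>lborel) = ennreal v * (\<integral>\<^sup>+s. ennreal (b s) \<partial>lborel)"
      by (subst nn_integral_cmult[symmetric]) (auto simp: ennreal_mult b_nonneg v_def)
    also have "\<dots> < \<infinity>" using b_bound by (auto simp: ennreal_mult_less_top le_less_trans)
    finally show "(\<integral>\<^sup>+s. ennreal (v * b s) \<partial>lborel) < \<infinity>" .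
  qed
  moreover have "(\<integral>x. (\<integral>s. V x * U s x \<partial>lborel) \<partial>M) = (\<integral>x. V x * (\<integral>s. U s x \<partial>lborel) \<partial>M)"
    by simp
  ultimately show ?thesis by simp
qed

end

text \<open>Riemann sums converge in mean square to the pathwise integral: over a piece \<open>K\<close> tagged by \<open>x\<close>,
  the error \<open>\<integral>\<^sub>K (U x - U s) ds\<close> has \<open>L\<^sup>2\<close> norm at most \<open>\<delta>\<close> times the length of \<open>K\<close>.\<close>

lemma (in prob_space) L2_riemann_integral_mean_square_continuous:
  fixes U :: "real \<Rightarrow> 'a \<Rightarrow> real"
  assumes ab: "a \<le> b" and U: "(\<lambda>(x, s). U s x) \<in> borel_measurable (M \<Otimes>\<^sub>M lborel)"
    and sq: "\<And>s. s \<in> {a..b} \<Longrightarrow> square_integrable M (U s)"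
    and B: "\<And>s. s \<in> {a..b} \<Longrightarrow> (\<integral>x. (U s x)\<^sup>2 \<partial>M) \<le> B\<^sup>2" "0 \<le> B"
    and cont: "\<And>e. 0 < e \<Longrightarrow> \<exists>d>0. \<forall>s\<in>{a..b}. \<forall>u\<in>{a..b}. \<bar>s - u\<bar> < d \<longrightarrow> (\<integral>x. (U s x - U u x)\<^sup>2 \<partial>M) < e"
  shows "L2_riemann_integral M U a b (\<lambda>x. LBINT s:{a..b}. U s x)"
proof -
  define V where "V = (\<lambda>(x, s). U s x)"
  have V[measurable]: "V \<in> borel_measurable (M \<Otimes>\<^sub>M lborel)" using U by (simp add: V_def)
  have UV: "U s x = V (x, s)" for s x by (simp add: V_def)
  have Um[measurable]: "U s \<in> borel_measurable M" for s
    using measurable_Pair1[OF U, of s] by simp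
  interpret I: dominated_process M "\<lambda>s x. indicator {a..b} s * U s x" "\<lambda>s. indicator {a..b} s * B" "(b - a) * B"
  proof
    show "(\<lambda>(x, s). indicator {a..b} s * U s x) \<in> borel_measurable (M \<Otimes>\<^sub>M lborel)" unfolding UV by measurable
    show "(\<integral>\<^sup>+x. ennreal ((indicator {a..b} s * U s x)\<^sup>2) \<partial>M) \<le> ennreal ((indicator {a..b} s * B)\<^sup>2)" for s
      using B(1)[of s] sq[of s] by (cases "s \<in> {a..b}") (auto simp: square_integrable_def nn_integral_eq_integral)
    have "(\<integral>\<^sup>+s. ennreal (indicator {a..b} s * B) \<partial>lborel) = (\<integral>\<^sup>+s. ennreal B * indicator {a..b} s \<partial>lborel)"
      by (intro nn_integral_cong) (auto simp: indicator_def)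
    also have "\<dots> = ennreal ((b - a) * B)"
      using ab B(2) by (simp add: nn_integral_cmult_indicator ennreal_mult mult.commute)
    finally show "(\<integral>\<^sup>+s. ennreal (indicator {a..b} s * B) \<partial>lborel) \<le> ennreal ((b - a) * B)" by simp
  qed (use ab B in auto)
  have sqI: "square_integrable M (\<lambda>x. LBINT s:{a..b}. U s x)"
    using I.square_integrable_integral by (simp add: set_lebesgue_integral_def)
  show ?thesis unfolding L2_riemann_integral_def
  proof (intro conjI allI impI sqI)
    fix e :: real assume e: "e > 0"
    \<comment> \<open>The summand \<open>1\<close> avoids a division by \<open>0\<close> for \<open>a = b\<close>.\<close>
    define \<delta> where "\<delta> = sqrt (e / ((b - a)\<^sup>2 + 1))"
    have \<delta>: "0 < \<delta>" "\<delta>\<^sup>2 = e / ((b - a)\<^sup>2 + 1)" using e by (simp_all add: \<delta>_def add_nonneg_pos)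
    obtain d where d: "d > 0" "\<And>s u. s \<in> {a..b} \<Longrightarrow> u \<in> {a..b} \<Longrightarrow> \<bar>s - u\<bar> < d \<Longrightarrow> (\<integral>x. (U s x - U u x)\<^sup>2 \<partial>M) < \<delta>\<^sup>2"
      using cont[of "\<delta>\<^sup>2"] \<delta>(1) by (auto simp del: \<delta>(2))
    show "\<exists>d>0. \<forall>p. p tagged_division_of {a..b} \<and> (\<lambda>x. ball x d) fine p \<longrightarrow>
        square_integrable M (\<lambda>\<omega>. \<Sum>(x, K)\<in>p. measure lborel K * U x \<omega>) \<and>
        (\<integral>\<omega>. ((\<Sum>(x, K)\<in>p. measure lborel K * U x \<omega>) - (LBINT s:{a..b}. U s \<omega>))\<^sup>2 \<partial>M) < e"
    proof (intro exI[of _ d] conjI d(1) allI impI)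
      fix p assume "p tagged_division_of {a..b} \<and> (\<lambda>x. ball x d) fine p"
      then have p: "p tagged_division_of {a..b}" and fine: "(\<lambda>x. ball x d) fine p" by auto
      have fin: "finite p" using p by (rule tagged_division_of_finite)
      have xab: "x \<in> {a..b}" and Kab: "K \<subseteq> {a..b}" and xK: "x \<in> K" and K: "\<exists>c d. K = {c..d} \<and> c \<le> d"
        if "(x, K) \<in> p" for x K
      proof -
        show "K \<subseteq> {a..b}" "x \<in> K" using that p by (auto dest: tagged_division_ofD(2,3))
        then show "x \<in> {a..b}" by auto
        have "\<exists>c d. K = cbox c d" using p that by (rule tagged_division_ofD(4))
        then obtain c d where "K = {c..d}" by auto
        then show "\<exists>c d. K = {c..d} \<and> c \<le> d" using \<open>x \<in> K\<close> by auto
      qed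
      let ?S = "\<lambda>\<omega>. \<Sum>(x, K)\<in>p. measure lborel K * U x \<omega>"
      show sqS: "square_integrable M ?S"
      proof -
        have "square_integrable M (\<lambda>\<omega>. \<Sum>i\<in>p. measure lborel (snd i) * U (fst i) \<omega>)"
          using xab by (intro square_integrable_sum square_integrable_cmult sq) auto
        then show ?thesis by (simp add: case_prod_beta)
      qed
      define D where "D i \<omega> = (\<integral>s. indicator (snd i) s * (U (fst i) \<omega> - U s \<omega>) \<partial>lborel)" for i \<omega>
      have Dbound: "square_integrable M (D i) \<and> (\<integral>\<omega>. (D i \<omega>)\<^sup>2 \<partial>M) \<le> (measure lborel (snd i) * \<delta>)\<^sup>2" if i: "i \<in> p" for i
      proof -
        obtain x K where xK': "i = (x, K)" by (cases i)
        obtain c c' where K': "K = {c..c'}" "c \<le> c'" using K i xK' by blast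
        interpret D: dominated_process M "\<lambda>s \<omega>. indicator K s * (U x \<omega> - U s \<omega>)" "\<lambda>s. indicator K s * \<delta>" "measure lborel K * \<delta>"
        proof
          have [measurable]: "K \<in> sets borel" using K' by simp
          show "(\<lambda>(\<omega>, s). indicator K s * (U x \<omega> - U s \<omega>)) \<in> borel_measurable (M \<Otimes>\<^sub>M lborel)"
            unfolding UV by measurable
          show "(\<integral>\<^sup>+\<omega>. ennreal ((indicator K s * (U x \<omega> - U s \<omega>))\<^sup>2) \<partial>M) \<le> ennreal ((indicator K s * \<delta>)\<^sup>2)" for s
          proof (cases "s \<in> K")
            case True
            have ip: "(x, K) \<in> p" using i xK' by simp
            have s: "s \<in> {a..b}" "x \<in> {a..b}" using True Kab[OF ip] xab[OF ip] by auto
            have "K \<subseteq> ball x d" using fineD[OF fine ip] .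
            then have "dist x s < d" using True by auto
            then have "(\<integral>\<omega>. (U x \<omega> - U s \<omega>)\<^sup>2 \<partial>M) \<le> \<delta>\<^sup>2" using d(2)[OF s(2,1)] by (simp add: dist_real_def)
            moreover have "square_integrable M (\<lambda>\<omega>. U x \<omega> - U s \<omega>)" using s by (intro square_integrable_diff sq)
            ultimately show ?thesis using True by (simp add: square_integrable_def nn_integral_eq_integral)
          qed simp
          have "(\<integral>\<^sup>+s. ennreal (indicator K s * \<delta>) \<partial>lborel) = (\<integral>\<^sup>+s. ennreal \<delta> * indicator K s \<partial>lborel)"
            by (intro nn_integral_cong) (auto simp: indicator_def)
          also have "\<dots> = ennreal (measure lborel K * \<delta>)"
            using K' \<delta> by (simp add: nn_integral_cmult_indicator ennreal_mult mult.commute)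
          finally show "(\<integral>\<^sup>+s. ennreal (indicator K s * \<delta>) \<partial>lborel) \<le> ennreal (measure lborel K * \<delta>)" by simp
        qed (use \<delta> K' in auto)
        show ?thesis using D.square_integrable_integral D.integral_square_le by (simp add: D_def[abs_def] xK')
      qed
      have "AE \<omega> in M. ?S \<omega> - (LBINT s:{a..b}. U s \<omega>) = (\<Sum>i\<in>p. D i \<omega>)"
        using I.AE_integrable
      proof eventually_elim
        case (elim \<omega>)
        then have int: "set_integrable lborel {a..b} (\<lambda>s. U s \<omega>)" by (simp add: set_integrable_def)
        have D_eq: "D (x, K) \<omega> = measure lborel K * U x \<omega> - integral K (\<lambda>s. U s \<omega>)" if xKp: "(x, K) \<in> p" for x K
        proof -
          obtain c c' where K': "K = {c..c'}" "c \<le> c'" using K[OF xKp] by blast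
          have intK: "set_integrable lborel K (\<lambda>s. U s \<omega>)"
            using Kab[OF xKp] K' by (intro set_integrable_subset[OF int]) auto
          have "integrable lborel (\<lambda>s. indicator K s * U s \<omega>)" using intK by (simp add: set_integrable_def)
          moreover have "integrable lborel (\<lambda>s. U x \<omega> * indicator K s)" using K' by simp
          ultimately have "(\<integral>s. U x \<omega> * indicator K s - indicator K s * U s \<omega> \<partial>lborel)
             = (\<integral>s. U x \<omega> * indicator K s \<partial>lborel) - (\<integral>s. indicator K s * U s \<omega> \<partial>lborel)"
            by (intro Bochner_Integration.integral_diff)
          moreover have "(\<lambda>s. U x \<omega> * indicator K s - indicator K s * U s \<omega>) = (\<lambda>s. indicator K s * (U x \<omega> - U s \<omega>))"
            by (auto simp: algebra_simps)
          ultimately show ?thesis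
            using set_borel_integral_eq_integral(2)[OF intK] K'
            by (simp add: D_def set_lebesgue_integral_def)
        qed
        have "(LBINT s:{a..b}. U s \<omega>) = integral {a..b} (\<lambda>s. U s \<omega>)"
          by (rule set_borel_integral_eq_integral(2)[OF int])
        also have "\<dots> = (\<Sum>(x, K)\<in>p. integral K (\<lambda>s. U s \<omega>))"
          using integral_combine_tagged_division_topdown[of "\<lambda>s. U s \<omega>" a b p] p set_borel_integral_eq_integral(1)[OF int] by simp
        finally have "?S \<omega> - (LBINT s:{a..b}. U s \<omega>) = (\<Sum>i\<in>p. (case i of (x, K) \<Rightarrow> measure lborel K * U x \<omega>) - (case i of (x, K) \<Rightarrow> integral K (\<lambda>s. U s \<omega>)))"
          by (simp only: sum_subtractf)
        also have "\<dots> = (\<Sum>i\<in>p. D i \<omega>)"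
          using D_eq by (intro sum.cong) auto
        finally show ?case .
      qed
      moreover have mD: "D i \<in> borel_measurable M" if "i \<in> p" for i using Dbound[OF that] by (simp add: square_integrable_def)
      ultimately have "(\<integral>\<omega>. (?S \<omega> - (LBINT s:{a..b}. U s \<omega>))\<^sup>2 \<partial>M) = (\<integral>\<omega>. (\<Sum>i\<in>p. D i \<omega>)\<^sup>2 \<partial>M)"
      proof (intro integral_cong_AE)
        show "(\<lambda>\<omega>. (?S \<omega> - (LBINT s:{a..b}. U s \<omega>))\<^sup>2) \<in> borel_measurable M"
          using square_integrable_diff[OF sqS sqI] unfolding square_integrable_def
          by (elim conjE) (rule borel_measurable_power)
      qed (auto intro!: borel_measurable_power borel_measurable_sum)
      also have "\<dots> \<le> (\<Sum>i\<in>p. measure lborel (snd i) * \<delta>)\<^sup>2"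
        using Dbound \<delta> by (intro integral_square_sum_le_square fin) auto
      also have "(\<Sum>i\<in>p. measure lborel (snd i) * \<delta>) = (b - a) * \<delta>"
        using additive_content_tagged_division[of p a b] p ab by (simp add: sum_distrib_right[symmetric] case_prod_beta)
      also have "((b - a) * \<delta>)\<^sup>2 = (b - a)\<^sup>2 * (e / ((b - a)\<^sup>2 + 1))" by (simp only: power_mult_distrib \<delta>(2))
      also have "\<dots> < e"
      proof -
        have "(b - a)\<^sup>2 + 1 > 0" by (simp add: add_nonneg_pos)
        then show ?thesis using e by (simp add: field_simps)
      qed
      finally show "(\<integral>\<omega>. (?S \<omega> - (LBINT s:{a..b}. U s \<omega>))\<^sup>2 \<partial>M) < e" .
    qed
  qed
qed

section \<open>The self-similar Gaussian coordinate process\<close>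

lemma nn_integral_powr_from_0:
  assumes "-1 < a" "0 \<le> t"
  shows "(\<integral>\<^sup>+s. ennreal (indicator {0..t} s * s powr a) \<partial>lborel) = ennreal (t powr (a + 1) / (a + 1))"
proof -
  have "((\<lambda>s. if s \<in> {0..t} then s powr a else 0) has_integral (t powr (a + 1) / (a + 1))) UNIV"
    by (subst has_integral_restrict_UNIV) (rule has_integral_powr_from_0[OF assms])
  then have "((\<lambda>s. indicator {0..t} s * s powr a) has_integral (t powr (a + 1) / (a + 1))) UNIV"
    by (rule has_integral_eq[rotated]) (simp add: indicator_def)
  then show ?thesis by (intro nn_integral_has_integral_lborel) auto
qed

lemma nn_integral_powr_to_infinity:
  assumes "a < -1" "0 < t"
  shows "(\<integral>\<^sup>+s. ennreal (indicator {t..} s * s powr a) \<partial>lborel) = ennreal (- (t powr (a + 1)) / (a + 1))"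
proof -
  have "((\<lambda>s. if s \<in> {t..} then s powr a else 0) has_integral (- (t powr (a + 1)) / (a + 1))) UNIV"
    by (subst has_integral_restrict_UNIV) (rule has_integral_powr_to_inf[OF assms])
  then have "((\<lambda>s. indicator {t..} s * s powr a) has_integral (- (t powr (a + 1)) / (a + 1))) UNIV"
    by (rule has_integral_eq[rotated]) (simp add: indicator_def)
  then show ?thesis by (intro nn_integral_has_integral_lborel) auto
qed

lemma integral_powr_unit_interval:
  assumes "-1 < a"
  shows "(\<integral>s. indicator {0<..<1} s * s powr a \<partial>lborel) = 1 / (a + 1 :: real)"
proof -
  have "(\<integral>s. indicator {0<..<1} s * s powr a \<partial>lborel) = (\<integral>s. indicator {0..1} s * s powr a \<partial>lborel)"
  proof (rule integral_cong_AE)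
    show "AE s in lborel. indicator {0<..<1} s * s powr a = indicator {0..1} s * s powr a"
      using AE_lborel_singleton[of 0] AE_lborel_singleton[of 1] by eventually_elim (auto simp: indicator_def)
  qed auto
  also have "\<dots> = 1 / (a + 1)"
    by (subst integral_eq_nn_integral) (use nn_integral_powr_from_0[OF assms, of 1] assms in auto)
  finally show ?thesis .
qed

text \<open>The setting of the theorem after the Volterra representation has served its purpose: a centered
  Gaussian coordinate process whose covariance is homogeneous of degree \<open>2\<beta>\<close>.\<close>

locale self_similar_coordinate_process = prob_space P for P :: "(real \<Rightarrow> real) measure" +
  fixes R :: "real \<Rightarrow> real \<Rightarrow> real" and \<beta> \<alpha> :: real
  assumes space_P: "space P = paths"
    and gaussian: "centered_gaussian_process P (\<lambda>t \<omega>. \<omega> t) R"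
    and homogeneous: "\<And>a s t. 0 < a \<Longrightarrow> 0 \<le> s \<Longrightarrow> 0 \<le> t \<Longrightarrow> R (a * s) (a * t) = a powr (2 * \<beta>) * R s t"
    and \<beta>_pos: "0 < \<beta>" and \<alpha>_gt: "- 1/2 < \<alpha>"
begin

abbreviation span :: "((real \<Rightarrow> real) \<Rightarrow> real) \<Rightarrow> bool" where
  "span \<equiv> L2_span P {0..} (\<lambda>t \<omega>. \<omega> t)"

lemma R_0: "R 0 0 = 0"
proof -
  have "R 0 0 = 2 powr (2 * \<beta>) * R 0 0" using homogeneous[of 2 0 0] by simp
  moreover have "(2::real) powr (2 * \<beta>) > 1" using \<beta>_pos by simp
  ultimately show ?thesis by auto
qed

text \<open>By homogeneity the \<open>L\<^sup>2\<close> norm of \<open>\<omega> t\<close> is \<open>\<sigma> * t powr \<beta>\<close>; all integrability below comes from this.\<close>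

definition \<sigma> :: real where "\<sigma> = sqrt (R 1 1)"

lemma centered_gaussian_linear_combination:
  "finite J \<Longrightarrow> J \<subseteq> {0..} \<Longrightarrow> centered_gaussian P (\<lambda>\<omega>. \<Sum>t\<in>J. c t * \<omega> t)"
  using gaussian by (simp add: centered_gaussian_process_def)

lemma square_integrable_coordinate: "0 \<le> t \<Longrightarrow> square_integrable P (\<lambda>\<omega>. \<omega> t)"
  using centered_gaussian_square_integrable[OF centered_gaussian_linear_combination[of "{t}" "\<lambda>_. 1"]] by simp

lemma coordinate_measurable: "0 \<le> t \<Longrightarrow> (\<lambda>\<omega>. \<omega> t) \<in> borel_measurable P"
  using square_integrable_coordinate by (simp add: square_integrable_def)

lemma covariance: "0 \<le> s \<Longrightarrow> 0 \<le> t \<Longrightarrow> (\<integral>\<omega>. \<omega> s * \<omega> t \<partial>P) = R s t"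
  using gaussian by (simp add: centered_gaussian_process_def)

lemma evaluation_measurable: "(\<lambda>p. fst p (snd p)) \<in> borel_measurable (P \<Otimes>\<^sub>M lborel)"
  using measurable_path_evaluation[OF _ coordinate_measurable] space_P by (simp add: case_prod_beta')

lemma second_moment:
  assumes "0 \<le> t" shows "(\<integral>\<omega>. (\<omega> t)\<^sup>2 \<partial>P) = (\<sigma> * t powr \<beta>)\<^sup>2"
proof (cases "t = 0")
  case True
  then show ?thesis using covariance[of 0 0] R_0 by (simp add: power2_eq_square)
next
  case False
  have "R t t = t powr (2 * \<beta>) * R 1 1" using homogeneous[of t 1 1] False assms by simp
  moreover have "0 \<le> R 1 1"
    unfolding covariance[OF zero_le_one zero_le_one, symmetric] by (intro Bochner_Integration.integral_nonneg) simp
  moreover have "t powr (2 * \<beta>) = (t powr \<beta>)\<^sup>2" by (simp add: power2_eq_square powr_add[symmetric])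
  ultimately show ?thesis using covariance[of t t] assms by (simp add: \<sigma>_def power_mult_distrib power2_eq_square)
qed

lemma \<sigma>_nonneg: "0 \<le> \<sigma>"
  unfolding \<sigma>_def covariance[OF zero_le_one zero_le_one, symmetric]
  by (intro real_sqrt_ge_zero Bochner_Integration.integral_nonneg) simp

lemma nn_second_moment:
  assumes "0 \<le> t" shows "(\<integral>\<^sup>+\<omega>. ennreal ((\<omega> t)\<^sup>2) \<partial>P) = ennreal ((\<sigma> * t powr \<beta>)\<^sup>2)"
  using second_moment[OF assms] square_integrable_coordinate[OF assms]
  by (simp add: square_integrable_def nn_integral_eq_integral)

text \<open>Minkowski's inequality applies to a weighted integral of the path as soon as \<open>k s * s powr \<beta>\<close> is integrable.
  For the two integrals of the theorem this product is \<open>s powr (\<alpha> - 1/2)\<close> near \<open>0\<close> and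
  \<open>s powr (- \<alpha> - 3/2)\<close> near infinity, which is where \<open>\<alpha> > - 1/2\<close> enters.\<close>

lemma dominated_weighted_coordinate:
  assumes [measurable]: "S \<in> sets borel" "k \<in> borel_measurable borel" and S: "S \<subseteq> {0..}" and k: "\<And>s. 0 \<le> k s"
    and B: "(\<integral>\<^sup>+s. ennreal (indicator S s * (k s * s powr \<beta>)) \<partial>lborel) = ennreal B" "0 \<le> B"
  shows "dominated_process P (\<lambda>s \<omega>. indicator S s * (k s * \<omega> s)) (\<lambda>s. \<sigma> * (indicator S s * (k s * s powr \<beta>))) (\<sigma> * B)"
proof
  note evaluation_measurable[measurable]
  have "(\<lambda>p. indicator S (snd p) * (k (snd p) * (fst p (snd p)))) \<in> borel_measurable (P \<Otimes>\<^sub>M lborel)" by measurable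
  then show "(\<lambda>(\<omega>, s). indicator S s * (k s * \<omega> s)) \<in> borel_measurable (P \<Otimes>\<^sub>M lborel)" by (simp add: case_prod_beta')
  show "(\<lambda>s. \<sigma> * (indicator S s * (k s * s powr \<beta>))) \<in> borel_measurable borel" by measurable
  show "0 \<le> \<sigma> * (indicator S s * (k s * s powr \<beta>))" for s using \<sigma>_nonneg k by simp
  show "(\<integral>\<^sup>+\<omega>. ennreal ((indicator S s * (k s * \<omega> s))\<^sup>2) \<partial>P) \<le> ennreal ((\<sigma> * (indicator S s * (k s * s powr \<beta>)))\<^sup>2)" for s
  proof (cases "s \<in> S")
    case True
    then have s: "0 \<le> s" using S by auto
    note coordinate_measurable[OF s, measurable]
    have "(\<integral>\<^sup>+\<omega>. ennreal ((indicator S s * (k s * \<omega> s))\<^sup>2) \<partial>P) = (\<integral>\<^sup>+\<omega>. ennreal ((k s)\<^sup>2) * ennreal ((\<omega> s)\<^sup>2) \<partial>P)"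
      using True by (simp add: power_mult_distrib ennreal_mult)
    also have "\<dots> = ennreal ((k s)\<^sup>2) * ennreal ((\<sigma> * s powr \<beta>)\<^sup>2)"
      by (subst nn_integral_cmult) (simp_all add: nn_second_moment[OF s])
    also have "\<dots> = ennreal ((\<sigma> * (indicator S s * (k s * s powr \<beta>)))\<^sup>2)"
      using True by (simp add: ennreal_mult[symmetric] power_mult_distrib mult_ac)
    finally show ?thesis by simp
  qed simp
  have "(\<integral>\<^sup>+s. ennreal (\<sigma> * (indicator S s * (k s * s powr \<beta>))) \<partial>lborel) = ennreal \<sigma> * (\<integral>\<^sup>+s. ennreal (indicator S s * (k s * s powr \<beta>)) \<partial>lborel)"
    using \<sigma>_nonneg k by (subst nn_integral_cmult[symmetric]) (auto simp: ennreal_mult)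
  then show "(\<integral>\<^sup>+s. ennreal (\<sigma> * (indicator S s * (k s * s powr \<beta>))) \<partial>lborel) \<le> ennreal (\<sigma> * B)"
    using B \<sigma>_nonneg by (simp add: ennreal_mult)
  show "0 \<le> \<sigma> * B" using B \<sigma>_nonneg by simp
qed

lemma dominated_Z:
  assumes "0 < t"
  shows "dominated_process P (\<lambda>s \<omega>. indicator {0..t} s * Z_integrand \<beta> \<alpha> s \<omega>)
    (\<lambda>s. \<sigma> * (indicator {0..t} s * (s powr (\<alpha> - \<beta> - 1/2) * s powr \<beta>))) (\<sigma> * (t powr (\<alpha> + 1/2) / (\<alpha> + 1/2)))"
  unfolding Z_integrand_def
proof (rule dominated_weighted_coordinate)
  have "s powr (\<alpha> - \<beta> - 1/2) * s powr \<beta> = s powr (\<alpha> - 1/2)" for s :: real by (rule powr_mult_powr) simp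
  moreover have "\<alpha> - 1/2 + 1 = \<alpha> + 1/2" by simp
  moreover have "-1 < \<alpha> - 1/2" using \<alpha>_gt by simp
  ultimately show "(\<integral>\<^sup>+s. ennreal (indicator {0..t} s * (s powr (\<alpha> - \<beta> - 1/2) * s powr \<beta>)) \<partial>lborel) = ennreal (t powr (\<alpha> + 1/2) / (\<alpha> + 1/2))"
    using nn_integral_powr_from_0[of "\<alpha> - 1/2" t] assms by (simp only: less_imp_le)
qed (use \<alpha>_gt in auto)

lemma dominated_Z_inv:
  assumes "0 < t"
  shows "dominated_process P (\<lambda>s \<omega>. indicator {t..} s * Z_inv_integrand \<beta> \<alpha> s \<omega>)
    (\<lambda>s. \<sigma> * (indicator {t..} s * (s powr (- \<beta> - \<alpha> - 3/2) * s powr \<beta>))) (\<sigma> * (t powr (- \<alpha> - 1/2) / (\<alpha> + 1/2)))"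
  unfolding Z_inv_integrand_def mult.commute[of "_ :: real" "_ powr (- \<beta> - \<alpha> - 3/2)"]
proof (rule dominated_weighted_coordinate)
  have "s powr (- \<beta> - \<alpha> - 3/2) * s powr \<beta> = s powr (- \<alpha> - 3/2)" for s :: real by (rule powr_mult_powr) simp
  moreover have lt: "- \<alpha> - 3/2 < -1" using \<alpha>_gt by (simp add: field_simps)
  moreover have "- (t powr (- \<alpha> - 3/2 + 1)) / (- \<alpha> - 3/2 + 1) = t powr (- \<alpha> - 1/2) / (\<alpha> + 1/2)"
  proof -
    have "- \<alpha> - 3/2 + 1 = - (\<alpha> + 1/2)" "- \<alpha> - 1/2 = - (\<alpha> + 1/2)" by simp_all
    then show ?thesis by (simp only: minus_divide_divide)
  qed
  ultimately show "(\<integral>\<^sup>+s. ennreal (indicator {t..} s * (s powr (- \<beta> - \<alpha> - 3/2) * s powr \<beta>)) \<partial>lborel) = ennreal (t powr (- \<alpha> - 1/2) / (\<alpha> + 1/2))"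
    using nn_integral_powr_to_infinity[of "- \<alpha> - 3/2" t, OF lt assms] by (simp only:)
qed (use assms \<alpha>_gt in auto)

lemma Z_integral_L2_bound:
  assumes t: "0 < t"
  shows "AE \<omega> in P. set_integrable lborel {0..t} (\<lambda>s. Z_integrand \<beta> \<alpha> s \<omega>)"
    and "square_integrable P (\<lambda>\<omega>. LBINT s:{0..t}. Z_integrand \<beta> \<alpha> s \<omega>)"
    and "(\<integral>\<omega>. (LBINT s:{0..t}. Z_integrand \<beta> \<alpha> s \<omega>)\<^sup>2 \<partial>P) \<le> (\<sigma> * (t powr (\<alpha> + 1/2) / (\<alpha> + 1/2)))\<^sup>2"
proof -
  interpret D: dominated_process P "\<lambda>s \<omega>. indicator {0..t} s * Z_integrand \<beta> \<alpha> s \<omega>"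
    "\<lambda>s. \<sigma> * (indicator {0..t} s * (s powr (\<alpha> - \<beta> - 1/2) * s powr \<beta>))" "\<sigma> * (t powr (\<alpha> + 1/2) / (\<alpha> + 1/2))"
    by (rule dominated_Z[OF t])
  show "AE \<omega> in P. set_integrable lborel {0..t} (\<lambda>s. Z_integrand \<beta> \<alpha> s \<omega>)"
    using D.AE_integrable by (simp add: set_integrable_def)
  show "square_integrable P (\<lambda>\<omega>. LBINT s:{0..t}. Z_integrand \<beta> \<alpha> s \<omega>)"
    "(\<integral>\<omega>. (LBINT s:{0..t}. Z_integrand \<beta> \<alpha> s \<omega>)\<^sup>2 \<partial>P) \<le> (\<sigma> * (t powr (\<alpha> + 1/2) / (\<alpha> + 1/2)))\<^sup>2"
    using D.square_integrable_integral D.integral_square_le by (simp_all add: set_lebesgue_integral_def)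
qed

lemma Z_inv_integral_L2_bound:
  assumes t: "0 < t"
  shows "AE \<omega> in P. set_integrable lborel {t..} (\<lambda>s. Z_inv_integrand \<beta> \<alpha> s \<omega>)"
    and "square_integrable P (\<lambda>\<omega>. LBINT s:{t..}. Z_inv_integrand \<beta> \<alpha> s \<omega>)"
    and "(\<integral>\<omega>. (LBINT s:{t..}. Z_inv_integrand \<beta> \<alpha> s \<omega>)\<^sup>2 \<partial>P) \<le> (\<sigma> * (t powr (- \<alpha> - 1/2) / (\<alpha> + 1/2)))\<^sup>2"
proof -
  interpret D: dominated_process P "\<lambda>s \<omega>. indicator {t..} s * Z_inv_integrand \<beta> \<alpha> s \<omega>"
    "\<lambda>s. \<sigma> * (indicator {t..} s * (s powr (- \<beta> - \<alpha> - 3/2) * s powr \<beta>))" "\<sigma> * (t powr (- \<alpha> - 1/2) / (\<alpha> + 1/2))"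
    by (rule dominated_Z_inv[OF t])
  show "AE \<omega> in P. set_integrable lborel {t..} (\<lambda>s. Z_inv_integrand \<beta> \<alpha> s \<omega>)"
    using D.AE_integrable by (simp add: set_integrable_def)
  show "square_integrable P (\<lambda>\<omega>. LBINT s:{t..}. Z_inv_integrand \<beta> \<alpha> s \<omega>)"
    "(\<integral>\<omega>. (LBINT s:{t..}. Z_inv_integrand \<beta> \<alpha> s \<omega>)\<^sup>2 \<partial>P) \<le> (\<sigma> * (t powr (- \<alpha> - 1/2) / (\<alpha> + 1/2)))\<^sup>2"
    using D.square_integrable_integral D.integral_square_le by (simp_all add: set_lebesgue_integral_def)
qed

lemma AE_all_integrable:
  shows "AE \<omega> in P. \<forall>t>0. set_integrable lborel {0..t} (\<lambda>s. Z_integrand \<beta> \<alpha> s \<omega>)"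
    and "AE \<omega> in P. \<forall>t>0. set_integrable lborel {t..} (\<lambda>s. Z_inv_integrand \<beta> \<alpha> s \<omega>)"
  unfolding all_integrable_iff_nat AE_all_countable
  by (intro allI Z_integral_L2_bound(1) Z_inv_integral_L2_bound(1); simp)+

lemma AE_Z_domain: "AE \<omega> in P. \<omega> \<in> Z_domain \<beta> \<alpha>"
proof -
  have "AE \<omega> in P. (\<omega> 0)\<^sup>2 = (0::real)"
    using second_moment[of 0] square_integrable_coordinate[of 0]
    by (subst integral_nonneg_eq_0_iff_AE[symmetric]) (auto simp: square_integrable_def)
  then show ?thesis using AE_all_integrable AE_space
    by eventually_elim (simp add: Z_domain_def space_P)
qed

lemma expectation_cos_span:
  assumes "span Y" shows "(\<integral>\<omega>. cos (Y \<omega> + \<phi>) \<partial>P) = cos \<phi> * exp (- (\<integral>\<omega>. (Y \<omega>)\<^sup>2 \<partial>P) / 2)"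
  by (rule expectation_cos_L2_span[where X="\<lambda>t \<omega>. \<omega> t" and I="{0..}"])
    (use assms square_integrable_coordinate centered_gaussian_linear_combination prob_space_axioms in auto)

lemma span_square_integrable: "span Y \<Longrightarrow> square_integrable P Y" by (simp add: L2_span_def)

lemma square_integrable_coordinates: "t \<in> {0..} \<Longrightarrow> square_integrable P (\<lambda>\<omega>. \<omega> t)"
  by (rule square_integrable_coordinate) simp

lemmas span_base = L2_span_base[where M=P and I="{0..}" and X="\<lambda>t \<omega>. \<omega> t", OF square_integrable_coordinates]
lemmas span_cmult = L2_span_cmult[where M=P and I="{0..}" and X="\<lambda>t \<omega>. \<omega> t", OF square_integrable_coordinates]
lemmas span_add = L2_span_add[where M=P and I="{0..}" and X="\<lambda>t \<omega>. \<omega> t", OF square_integrable_coordinates]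
lemmas span_sum = L2_span_sum[where M=P and I="{0..}" and X="\<lambda>t \<omega>. \<omega> t", OF square_integrable_coordinates]
lemmas span_limit = L2_span_limit[where M=P and I="{0..}" and X="\<lambda>t \<omega>. \<omega> t", OF square_integrable_coordinates]

lemma span_coordinate: "0 \<le> t \<Longrightarrow> span (\<lambda>\<omega>. c * \<omega> t)"
  by (rule span_cmult, assumption, rule span_base) auto

text \<open>Mean square continuity follows from continuity of the paths: for centered Gaussian variables with
  variance \<open>v\<close> the expected cosine is \<open>exp (- v / 2)\<close>, so almost sure convergence to \<open>0\<close> forces the
  variances to tend to \<open>0\<close>.\<close>

lemma mean_square_uniformly_continuous:
  assumes a: "0 \<le> a" and k: "continuous_on {a..b} k" and e: "0 < e"
  shows "\<exists>d>0. \<forall>s\<in>{a..b}. \<forall>u\<in>{a..b}. \<bar>s - u\<bar> < d \<longrightarrow> (\<integral>\<omega>. (k s * \<omega> s - k u * \<omega> u)\<^sup>2 \<partial>P) < e"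
proof (rule ccontr)
  assume neg: "\<not> ?thesis"
  define Q where "Q n q \<longleftrightarrow> fst q \<in> {a..b} \<and> snd q \<in> {a..b} \<and> \<bar>fst q - snd q\<bar> < inverse (real (Suc n)) \<and>
      e \<le> (\<integral>\<omega>. (k (fst q) * \<omega> (fst q) - k (snd q) * \<omega> (snd q))\<^sup>2 \<partial>P)" for n q
  have "\<forall>n. \<exists>q. Q n q"
  proof
    fix n
    have "\<not> (\<forall>s\<in>{a..b}. \<forall>u\<in>{a..b}. \<bar>s - u\<bar> < inverse (real (Suc n)) \<longrightarrow> (\<integral>\<omega>. (k s * \<omega> s - k u * \<omega> u)\<^sup>2 \<partial>P) < e)"
    proof
      assume *: "\<forall>s\<in>{a..b}. \<forall>u\<in>{a..b}. \<bar>s - u\<bar> < inverse (real (Suc n)) \<longrightarrow> (\<integral>\<omega>. (k s * \<omega> s - k u * \<omega> u)\<^sup>2 \<partial>P) < e"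
      have "0 < inverse (real (Suc n))" by simp
      with * neg show False by blast
    qed
    then obtain s u where "s \<in> {a..b}" "u \<in> {a..b}" "\<bar>s - u\<bar> < inverse (real (Suc n))" "e \<le> (\<integral>\<omega>. (k s * \<omega> s - k u * \<omega> u)\<^sup>2 \<partial>P)"
      by (auto simp: not_less)
    then show "\<exists>q. Q n q" by (intro exI[of _ "(s, u)"]) (simp add: Q_def)
  qed
  then obtain q where "\<forall>n. Q n (q n)" by (rule exE[OF choice])
  then have q: "fst (q n) \<in> {a..b}" "snd (q n) \<in> {a..b}" "\<bar>fst (q n) - snd (q n)\<bar> < inverse (real (Suc n))"
      "e \<le> (\<integral>\<omega>. (k (fst (q n)) * \<omega> (fst (q n)) - k (snd (q n)) * \<omega> (snd (q n)))\<^sup>2 \<partial>P)" for n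
    by (simp_all add: Q_def)
  define D where "D n \<omega> = k (fst (q n)) * \<omega> (fst (q n)) - k (snd (q n)) * \<omega> (snd (q n))" for n \<omega>
  have spD: "span (D n)" for n
  proof -
    have "span (\<lambda>\<omega>. k (fst (q n)) * \<omega> (fst (q n)) + (- k (snd (q n))) * \<omega> (snd (q n)))"
      using q(1,2)[of n] a by (intro span_add span_coordinate) auto
    then show ?thesis by (simp add: D_def[abs_def])
  qed
  have q0: "(\<lambda>n. dist (fst (q n)) (snd (q n))) \<longlonglongrightarrow> 0"
  proof (rule Lim_null_comparison)
    show "\<forall>\<^sub>F n in sequentially. norm (dist (fst (q n)) (snd (q n))) \<le> inverse (real (Suc n))"
      using q(3) by (intro always_eventually allI) (simp add: dist_real_def less_imp_le)
  qed (rule LIMSEQ_inverse_real_of_nat)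
  have "(\<lambda>n. \<integral>\<omega>. cos (D n \<omega>) \<partial>P) \<longlonglongrightarrow> (\<integral>\<omega>. 1 \<partial>P)"
  proof (rule integral_dominated_convergence[where w="\<lambda>_. 1"])
    show "(\<lambda>\<omega>. cos (D n \<omega>)) \<in> borel_measurable P" for n
      using span_square_integrable[OF spD[of n]] by (auto simp: square_integrable_def)
    show "AE \<omega> in P. (\<lambda>n. cos (D n \<omega>)) \<longlonglongrightarrow> 1"
      using AE_space
    proof eventually_elim
      case (elim \<omega>)
      have "continuous_on {a..b} \<omega>"
        using elim a by (auto simp: space_P paths_def intro: continuous_on_subset)
      then have "uniformly_continuous_on {a..b} (\<lambda>s. k s * \<omega> s)"
        using k by (intro compact_uniformly_continuous continuous_intros) auto
      then have "(\<lambda>n. dist (k (fst (q n)) * \<omega> (fst (q n))) (k (snd (q n)) * \<omega> (snd (q n)))) \<longlonglongrightarrow> 0"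
        using q(1,2) q0 unfolding uniformly_continuous_on_sequentially by simp
      then have "(\<lambda>n. D n \<omega>) \<longlonglongrightarrow> 0" unfolding D_def dist_norm by (rule tendsto_norm_zero_cancel)
      then have "(\<lambda>n. cos (D n \<omega>)) \<longlonglongrightarrow> cos 0" by (rule tendsto_cos)
      then show ?case by simp
    qed
  qed auto
  then have lim: "(\<lambda>n. exp (- (\<integral>\<omega>. (D n \<omega>)\<^sup>2 \<partial>P) / 2)) \<longlonglongrightarrow> 1"
    using expectation_cos_span[OF spD, of _ 0] by (simp add: prob_space)
  have "\<forall>\<^sub>F n in sequentially. exp (- (\<integral>\<omega>. (D n \<omega>)\<^sup>2 \<partial>P) / 2) \<le> exp (- e / 2)"
    using q(4) by (intro always_eventually allI) (simp add: D_def)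
  from tendsto_upperbound[OF lim this] have "(1::real) \<le> exp (- e / 2)" by simp
  then show False using e by simp
qed

lemma L2_riemann_integral_weighted_coordinate:
  assumes a: "0 \<le> a" "a \<le> b" and k: "continuous_on {a..b} k" and km[measurable]: "k \<in> borel_measurable borel"
  shows "L2_riemann_integral P (\<lambda>s \<omega>. k s * \<omega> s) a b (\<lambda>\<omega>. LBINT s:{a..b}. k s * \<omega> s)"
proof -
  have "compact (k ` {a..b})" using k by (intro compact_continuous_image) auto
  then obtain C where C: "\<And>s. s \<in> {a..b} \<Longrightarrow> \<bar>k s\<bar> \<le> C"
    using compact_imp_bounded[of "k ` {a..b}"] unfolding bounded_iff real_norm_def ball_simps by blast
  have C0: "0 \<le> C" using C[of a] a abs_ge_zero[of "k a"] by auto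
  show ?thesis
  proof (rule L2_riemann_integral_mean_square_continuous[where B="C * (\<sigma> * b powr \<beta>)"])
    note evaluation_measurable[measurable]
    have "(\<lambda>p. k (snd p) * (fst p (snd p))) \<in> borel_measurable (P \<Otimes>\<^sub>M lborel)" by measurable
    then show "(\<lambda>(\<omega>, s). k s * \<omega> s) \<in> borel_measurable (P \<Otimes>\<^sub>M lborel)" by (simp add: case_prod_beta')
    fix s assume s: "s \<in> {a..b}"
    then have s0: "0 \<le> s" using a by auto
    show "square_integrable P (\<lambda>\<omega>. k s * \<omega> s)" using s0 by (intro square_integrable_cmult square_integrable_coordinate)
    have "(\<integral>\<omega>. (k s * \<omega> s)\<^sup>2 \<partial>P) = (\<bar>k s\<bar> * (\<sigma> * s powr \<beta>))\<^sup>2"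
      using second_moment[OF s0] by (simp add: power_mult_distrib)
    also have "\<dots> \<le> (C * (\<sigma> * b powr \<beta>))\<^sup>2"
      using s s0 C C0 \<sigma>_nonneg \<beta>_pos by (intro power_mono mult_mono powr_mono2) auto
    finally show "(\<integral>\<omega>. (k s * \<omega> s)\<^sup>2 \<partial>P) \<le> (C * (\<sigma> * b powr \<beta>))\<^sup>2" .
  next
    fix e :: real assume "0 < e"
    then show "\<exists>d>0. \<forall>s\<in>{a..b}. \<forall>u\<in>{a..b}. \<bar>s - u\<bar> < d \<longrightarrow> (\<integral>\<omega>. (k s * \<omega> s - k u * \<omega> u)\<^sup>2 \<partial>P) < e"
      by (rule mean_square_uniformly_continuous[OF a(1) k])
  qed (use a C0 \<sigma>_nonneg in auto)
qed

lemma span_L2_riemann_integral: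
  assumes a: "0 \<le> a" and I: "L2_riemann_integral P (\<lambda>s \<omega>. k s * \<omega> s) a b I"
  shows "span I"
proof (rule span_limit)
  show "square_integrable P I" using I by (simp add: L2_riemann_integral_def)
  fix e :: real assume "e > 0"
  then obtain d where d: "d > 0" "\<And>p. p tagged_division_of {a..b} \<Longrightarrow> (\<lambda>x. ball x d) fine p \<Longrightarrow>
       (\<integral>\<omega>. ((\<Sum>(x, K)\<in>p. measure lborel K * (k x * \<omega> x)) - I \<omega>)\<^sup>2 \<partial>P) < e"
    using I unfolding L2_riemann_integral_def by blast
  have "gauge (\<lambda>x::real. ball x d)" using d(1) by (rule gauge_ball)
  then obtain p where p: "p tagged_division_of {a..b}" "(\<lambda>x. ball x d) fine p" by (rule fine_division_exists_real)
  let ?Z = "\<lambda>\<omega>. \<Sum>(x, K)\<in>p. measure lborel K * (k x * \<omega> x)"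
  have "span (\<lambda>\<omega>. \<Sum>i\<in>p. (measure lborel (snd i) * k (fst i)) * \<omega> (fst i))"
  proof (intro span_sum span_coordinate)
    fix i assume "i \<in> p"
    then have "fst i \<in> {a..b}" using tagged_division_ofD(2,3)[OF p(1), of "fst i" "snd i"] by auto
    then show "0 \<le> fst i" using a by auto
  qed auto
  then have "span ?Z" by (simp add: case_prod_beta' mult.assoc)
  moreover have "(\<integral>\<omega>. (I \<omega> - ?Z \<omega>)\<^sup>2 \<partial>P) < e"
    using d(2)[OF p] by (subst power2_commute)
  ultimately show "\<exists>Z. span Z \<and> (\<integral>\<omega>. (I \<omega> - Z \<omega>)\<^sup>2 \<partial>P) < e" by (intro exI[of _ ?Z] conjI)
qed simp

end

section \<open>The improper mean square integrals and their covariance\<close>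

context self_similar_coordinate_process
begin

lemma L2_tendsto_0I:
  assumes "square_integrable P I" and "\<forall>\<^sub>F r in F. square_integrable P (J r)"
    and "\<forall>\<^sub>F r in F. (\<integral>\<omega>. (J r \<omega> - I \<omega>)\<^sup>2 \<partial>P) \<le> (B r)\<^sup>2" and "(B \<longlongrightarrow> 0) F"
  shows "L2_tendsto P J I F"
  unfolding L2_tendsto_def
proof (intro conjI assms)
  show "((\<lambda>r. \<integral>\<omega>. (J r \<omega> - I \<omega>)\<^sup>2 \<partial>P) \<longlongrightarrow> 0) F"
  proof (rule Lim_null_comparison)
    show "\<forall>\<^sub>F r in F. norm (\<integral>\<omega>. (J r \<omega> - I \<omega>)\<^sup>2 \<partial>P) \<le> (B r)\<^sup>2"
      using assms(3) by eventually_elim simp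
    show "((\<lambda>r. (B r)\<^sup>2) \<longlongrightarrow> 0) F" using tendsto_power[OF assms(4), of 2] by simp
  qed
qed

lemma Z_integral_tail_tendsto: "((\<lambda>r. \<sigma> * (r powr (\<alpha> + 1/2) / (\<alpha> + 1/2))) \<longlongrightarrow> 0) (at_right 0)"
proof -
  have "((\<lambda>r. r powr (\<alpha> + 1/2)) \<longlongrightarrow> 0 powr (\<alpha> + 1/2)) (at_right 0)"
    using \<alpha>_gt by (intro tendsto_powr' tendsto_intros) (auto simp: eventually_at_filter)
  then have "((\<lambda>r. \<sigma> * (r powr (\<alpha> + 1/2) / (\<alpha> + 1/2))) \<longlongrightarrow> \<sigma> * (0 / (\<alpha> + 1/2))) (at_right 0)"
    using \<alpha>_gt by (intro tendsto_intros) auto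
  then show ?thesis by simp
qed

lemma Z_inv_integral_tail_tendsto: "((\<lambda>r. \<sigma> * (r powr (- \<alpha> - 1/2) / (\<alpha> + 1/2))) \<longlongrightarrow> 0) at_top"
proof -
  have "((\<lambda>r. r powr (- \<alpha> - 1/2)) \<longlongrightarrow> 0) at_top"
    using \<alpha>_gt by (intro tendsto_neg_powr filterlim_ident) auto
  then have "((\<lambda>r. \<sigma> * (r powr (- \<alpha> - 1/2) / (\<alpha> + 1/2))) \<longlongrightarrow> \<sigma> * (0 / (\<alpha> + 1/2))) at_top"
    using \<alpha>_gt by (intro tendsto_intros) auto
  then show ?thesis by simp
qed

lemma L2_riemann_integral_Z:
  assumes "0 < r" "r \<le> t"
  shows "L2_riemann_integral P (Z_integrand \<beta> \<alpha>) r t (\<lambda>\<omega>. LBINT s:{r..t}. Z_integrand \<beta> \<alpha> s \<omega>)"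
  unfolding Z_integrand_def[abs_def]
  by (rule L2_riemann_integral_weighted_coordinate) (use assms in \<open>auto intro!: continuous_intros\<close>)

lemma L2_riemann_integral_Z_inv:
  assumes "0 < t" "t \<le> r"
  shows "L2_riemann_integral P (Z_inv_integrand \<beta> \<alpha>) t r (\<lambda>\<omega>. LBINT s:{t..r}. Z_inv_integrand \<beta> \<alpha> s \<omega>)"
  unfolding Z_inv_integrand_def[abs_def] mult.commute[of "_ :: real" "_ powr (- \<beta> - \<alpha> - 3/2)"]
  by (rule L2_riemann_integral_weighted_coordinate) (use assms in \<open>auto intro!: continuous_intros\<close>)

text \<open>The difference of the two integrals is the integral over \<open>[0,r]\<close>, whose norm is known.\<close>

lemma Z_integral_L2_tendsto:
  assumes t: "0 < t"
  shows "L2_tendsto P (\<lambda>r \<omega>. LBINT s:{r..t}. Z_integrand \<beta> \<alpha> s \<omega>) (\<lambda>\<omega>. LBINT s:{0..t}. Z_integrand \<beta> \<alpha> s \<omega>) (at_right 0)"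
proof (rule L2_tendsto_0I[OF Z_integral_L2_bound(2)[OF t] _ _ Z_integral_tail_tendsto])
  have ev: "\<forall>\<^sub>F r in at_right 0. r \<in> {0<..<t}" using eventually_at_right_real[OF t] .
  have sqJ: "square_integrable P (\<lambda>\<omega>. LBINT s:{r..t}. Z_integrand \<beta> \<alpha> s \<omega>)" if "r \<in> {0<..<t}" for r
    using L2_riemann_integral_Z[of r t] that by (simp add: L2_riemann_integral_def)
  then show "\<forall>\<^sub>F r in at_right 0. square_integrable P (\<lambda>\<omega>. LBINT s:{r..t}. Z_integrand \<beta> \<alpha> s \<omega>)"
    using ev by (rule eventually_mono[rotated])
  show "\<forall>\<^sub>F r in at_right 0. (\<integral>\<omega>. ((LBINT s:{r..t}. Z_integrand \<beta> \<alpha> s \<omega>) - (LBINT s:{0..t}. Z_integrand \<beta> \<alpha> s \<omega>))\<^sup>2 \<partial>P)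
      \<le> (\<sigma> * (r powr (\<alpha> + 1/2) / (\<alpha> + 1/2)))\<^sup>2"
    using ev
  proof eventually_elim
    case (elim r)
    then have r: "0 < r" "r \<le> t" by auto
    have "(\<integral>\<omega>. ((LBINT s:{r..t}. Z_integrand \<beta> \<alpha> s \<omega>) - (LBINT s:{0..t}. Z_integrand \<beta> \<alpha> s \<omega>))\<^sup>2 \<partial>P)
       = (\<integral>\<omega>. (LBINT s:{0..r}. Z_integrand \<beta> \<alpha> s \<omega>)\<^sup>2 \<partial>P)"
    proof (rule integral_cong_AE)
      show "AE \<omega> in P. ((LBINT s:{r..t}. Z_integrand \<beta> \<alpha> s \<omega>) - (LBINT s:{0..t}. Z_integrand \<beta> \<alpha> s \<omega>))\<^sup>2 = (LBINT s:{0..r}. Z_integrand \<beta> \<alpha> s \<omega>)\<^sup>2"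
        using Z_integral_L2_bound(1)[OF t]
      proof eventually_elim
        case (elim \<omega>)
        have "(LBINT s:{r..t}. Z_integrand \<beta> \<alpha> s \<omega>) - (LBINT s:{0..t}. Z_integrand \<beta> \<alpha> s \<omega>) = - (LBINT s:{0..r}. Z_integrand \<beta> \<alpha> s \<omega>)"
          using integral_from_0_split[OF elim less_imp_le[OF r(1)] r(2)] by linarith
        then show ?case by (simp only: power2_minus)
      qed
    qed (use sqJ[OF elim] Z_integral_L2_bound(2)[OF t] Z_integral_L2_bound(2)[OF r(1)] in
        \<open>auto simp: square_integrable_def intro!: borel_measurable_power borel_measurable_diff\<close>)
    then show ?case using Z_integral_L2_bound(3)[OF r(1)] by simp
  qed
qed

lemma Z_inv_integral_L2_tendsto:
  assumes t: "0 < t"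
  shows "L2_tendsto P (\<lambda>r \<omega>. LBINT s:{t..r}. Z_inv_integrand \<beta> \<alpha> s \<omega>) (\<lambda>\<omega>. LBINT s:{t..}. Z_inv_integrand \<beta> \<alpha> s \<omega>) at_top"
proof (rule L2_tendsto_0I[OF Z_inv_integral_L2_bound(2)[OF t] _ _ Z_inv_integral_tail_tendsto])
  have ev: "\<forall>\<^sub>F r in at_top. t \<le> r" by (rule eventually_ge_at_top)
  have sqJ: "square_integrable P (\<lambda>\<omega>. LBINT s:{t..r}. Z_inv_integrand \<beta> \<alpha> s \<omega>)" if "t \<le> r" for r
    using L2_riemann_integral_Z_inv[of t r] that t by (simp add: L2_riemann_integral_def)
  then show "\<forall>\<^sub>F r in at_top. square_integrable P (\<lambda>\<omega>. LBINT s:{t..r}. Z_inv_integrand \<beta> \<alpha> s \<omega>)"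
    using ev by (rule eventually_mono[rotated])
  show "\<forall>\<^sub>F r in at_top. (\<integral>\<omega>. ((LBINT s:{t..r}. Z_inv_integrand \<beta> \<alpha> s \<omega>) - (LBINT s:{t..}. Z_inv_integrand \<beta> \<alpha> s \<omega>))\<^sup>2 \<partial>P)
      \<le> (\<sigma> * (r powr (- \<alpha> - 1/2) / (\<alpha> + 1/2)))\<^sup>2"
    using ev
  proof eventually_elim
    case (elim r)
    then have r: "0 < r" using t by auto
    have "(\<integral>\<omega>. ((LBINT s:{t..r}. Z_inv_integrand \<beta> \<alpha> s \<omega>) - (LBINT s:{t..}. Z_inv_integrand \<beta> \<alpha> s \<omega>))\<^sup>2 \<partial>P)
       = (\<integral>\<omega>. (LBINT s:{r..}. Z_inv_integrand \<beta> \<alpha> s \<omega>)\<^sup>2 \<partial>P)"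
    proof (rule integral_cong_AE)
      show "AE \<omega> in P. ((LBINT s:{t..r}. Z_inv_integrand \<beta> \<alpha> s \<omega>) - (LBINT s:{t..}. Z_inv_integrand \<beta> \<alpha> s \<omega>))\<^sup>2 = (LBINT s:{r..}. Z_inv_integrand \<beta> \<alpha> s \<omega>)\<^sup>2"
        using Z_inv_integral_L2_bound(1)[OF t]
      proof eventually_elim
        case (elim \<omega>)
        have "set_integrable lborel {t..r} (\<lambda>s. Z_inv_integrand \<beta> \<alpha> s \<omega>)" by (rule set_integrable_subset[OF elim]) auto
        from set_borel_integral_eq_integral(2)[OF this] integral_to_infinity_split[OF elim \<open>t \<le> r\<close>]
        have "(LBINT s:{t..r}. Z_inv_integrand \<beta> \<alpha> s \<omega>) - (LBINT s:{t..}. Z_inv_integrand \<beta> \<alpha> s \<omega>) = - (LBINT s:{r..}. Z_inv_integrand \<beta> \<alpha> s \<omega>)"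
          by linarith
        then show ?case by (simp only: power2_minus)
      qed
    qed (use sqJ[OF elim] Z_inv_integral_L2_bound(2)[OF t] Z_inv_integral_L2_bound(2)[OF r] in
        \<open>auto simp: square_integrable_def intro!: borel_measurable_power borel_measurable_diff\<close>)
    then show ?case using Z_inv_integral_L2_bound(3)[OF r] by simp
  qed
qed

lemma L2_riemann_integral_from_0_Z:
  "0 < t \<Longrightarrow> L2_riemann_integral_from_0 P (Z_integrand \<beta> \<alpha>) t (\<lambda>\<omega>. LBINT s:{0..t}. Z_integrand \<beta> \<alpha> s \<omega>)"
  unfolding L2_riemann_integral_from_0_def
  by (intro exI[of _ "\<lambda>r \<omega>. LBINT s:{r..t}. Z_integrand \<beta> \<alpha> s \<omega>"] conjI allI impI L2_riemann_integral_Z Z_integral_L2_tendsto) auto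

lemma L2_riemann_integral_to_infinity_Z_inv:
  "0 < t \<Longrightarrow> L2_riemann_integral_to_infinity P (Z_inv_integrand \<beta> \<alpha>) t (\<lambda>\<omega>. LBINT s:{t..}. Z_inv_integrand \<beta> \<alpha> s \<omega>)"
  unfolding L2_riemann_integral_to_infinity_def
  by (intro exI[of _ "\<lambda>r \<omega>. LBINT s:{t..r}. Z_inv_integrand \<beta> \<alpha> s \<omega>"] conjI allI impI L2_riemann_integral_Z_inv Z_inv_integral_L2_tendsto) auto

lemma span_Z_integral:
  assumes t: "0 < t"
  shows "span (\<lambda>\<omega>. LBINT s:{0..t}. Z_integrand \<beta> \<alpha> s \<omega>)"
proof (rule span_limit)
  let ?I = "\<lambda>r \<omega>. LBINT s:{r..t}. Z_integrand \<beta> \<alpha> s \<omega>"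
  show "square_integrable P (?I 0)" by (rule Z_integral_L2_bound(2)[OF t])
  fix e :: real assume "e > 0"
  moreover have "((\<lambda>r. \<integral>\<omega>. (?I r \<omega> - ?I 0 \<omega>)\<^sup>2 \<partial>P) \<longlongrightarrow> 0) (at_right 0)"
    using Z_integral_L2_tendsto[OF t] by (simp add: L2_tendsto_def)
  ultimately have "\<forall>\<^sub>F r in at_right 0. (\<integral>\<omega>. (?I r \<omega> - ?I 0 \<omega>)\<^sup>2 \<partial>P) < e"
    by (auto dest: order_tendstoD(2))
  then have "\<forall>\<^sub>F r in at_right 0. (\<integral>\<omega>. (?I r \<omega> - ?I 0 \<omega>)\<^sup>2 \<partial>P) < e \<and> r \<in> {0<..<t}"
    using eventually_at_right_real[OF t] by (rule eventually_conj)
  then obtain r where r: "(\<integral>\<omega>. (?I r \<omega> - ?I 0 \<omega>)\<^sup>2 \<partial>P) < e" "r \<in> {0<..<t}"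
    using eventually_happens[of _ "at_right (0::real)"] by (auto simp: trivial_limit_at_right_real)
  have "span (?I r)"
    using r(2) L2_riemann_integral_Z[of r t] unfolding Z_integrand_def[abs_def]
    by (intro span_L2_riemann_integral[of r "\<lambda>s. s powr (\<alpha> - \<beta> - 1/2)" t]) auto
  moreover have "(\<integral>\<omega>. (?I 0 \<omega> - ?I r \<omega>)\<^sup>2 \<partial>P) < e" using r(1) by (subst power2_commute)
  ultimately show "\<exists>Z. span Z \<and> (\<integral>\<omega>. (?I 0 \<omega> - Z \<omega>)\<^sup>2 \<partial>P) < e" by (intro exI[of _ "?I r"] conjI)
qed

definition Z_integral :: "real \<Rightarrow> (real \<Rightarrow> real) \<Rightarrow> real" where
  "Z_integral t \<omega> = (LBINT s:{0..t}. Z_integrand \<beta> \<alpha> s \<omega>)"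

definition cross_cov :: "real \<Rightarrow> real \<Rightarrow> real" where
  "cross_cov s t = (\<integral>\<omega>. \<omega> s * Z_integral t \<omega> \<partial>P)"

lemma cross_cov_eq:
  assumes s: "0 \<le> s" and t: "0 < t"
  shows "cross_cov s t = (\<integral>v. indicator {0..t} v * (v powr (\<alpha> - \<beta> - 1/2) * R s v) \<partial>lborel)"
proof -
  interpret D: dominated_process P "\<lambda>s \<omega>. indicator {0..t} s * Z_integrand \<beta> \<alpha> s \<omega>"
    "\<lambda>s. \<sigma> * (indicator {0..t} s * (s powr (\<alpha> - \<beta> - 1/2) * s powr \<beta>))" "\<sigma> * (t powr (\<alpha> + 1/2) / (\<alpha> + 1/2))"
    by (rule dominated_Z[OF t])
  have "cross_cov s t = (\<integral>v. (\<integral>\<omega>. \<omega> s * (indicator {0..t} v * Z_integrand \<beta> \<alpha> v \<omega>) \<partial>P) \<partial>lborel)"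
    using D.integral_mult_integral[OF square_integrable_coordinate[OF s]]
    by (simp add: cross_cov_def Z_integral_def set_lebesgue_integral_def)
  also have "\<dots> = (\<integral>v. indicator {0..t} v * (v powr (\<alpha> - \<beta> - 1/2) * R s v) \<partial>lborel)"
  proof (rule Bochner_Integration.integral_cong)
    fix v :: real
    show "(\<integral>\<omega>. \<omega> s * (indicator {0..t} v * Z_integrand \<beta> \<alpha> v \<omega>) \<partial>P) = indicator {0..t} v * (v powr (\<alpha> - \<beta> - 1/2) * R s v)"
    proof (cases "v \<in> {0..t}")
      case True
      then have "(\<integral>\<omega>. \<omega> s * (indicator {0..t} v * Z_integrand \<beta> \<alpha> v \<omega>) \<partial>P) = (\<integral>\<omega>. v powr (\<alpha> - \<beta> - 1/2) * (\<omega> s * \<omega> v) \<partial>P)"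
        by (intro Bochner_Integration.integral_cong) (auto simp: Z_integrand_def)
      also have "\<dots> = v powr (\<alpha> - \<beta> - 1/2) * R s v"
        using True s covariance[of s v] by simp
      finally show ?thesis using True by simp
    qed simp
  qed simp
  finally show ?thesis .
qed

text \<open>Substitution \<open>v \<mapsto> a v\<close> in the integral for \<open>cross_cov\<close>.\<close>

lemma cross_cov_homogeneous:
  assumes a: "0 < a" and s: "0 \<le> s" and t: "0 < t"
  shows "cross_cov (a * s) (a * t) = a powr (\<alpha> + \<beta> + 1/2) * cross_cov s t"
proof -
  let ?\<kappa> = "\<alpha> - \<beta> - 1/2"
  have "cross_cov (a * s) (a * t) = (\<integral>v. indicator {0..a * t} v * (v powr ?\<kappa> * R (a * s) v) \<partial>lborel)"
    using a s t by (intro cross_cov_eq) auto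
  also have "\<dots> = a * (\<integral>v. indicator {0..a * t} (a * v) * ((a * v) powr ?\<kappa> * R (a * s) (a * v)) \<partial>lborel)"
    using a by (subst lborel_integral_real_affine[of a _ 0]) auto
  also have "(\<lambda>v. indicator {0..a * t} (a * v) * ((a * v) powr ?\<kappa> * R (a * s) (a * v)))
     = (\<lambda>v. (a powr ?\<kappa> * a powr (2 * \<beta>)) * (indicator {0..t} v * (v powr ?\<kappa> * R s v)))"
  proof
    fix v
    show "indicator {0..a * t} (a * v) * ((a * v) powr ?\<kappa> * R (a * s) (a * v))
       = (a powr ?\<kappa> * a powr (2 * \<beta>)) * (indicator {0..t} v * (v powr ?\<kappa> * R s v))"
    proof (cases "v \<in> {0..t}")
      case True
      then show ?thesis using a s homogeneous[of a s v] by (simp add: powr_mult)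
    next
      case False
      then have "a * v \<notin> {0..a * t}" using a by (auto simp: zero_le_mult_iff)
      then show ?thesis using False by simp
    qed
  qed
  also have "a * (\<integral>v. (a powr ?\<kappa> * a powr (2 * \<beta>)) * (indicator {0..t} v * (v powr ?\<kappa> * R s v)) \<partial>lborel)
     = (a powr 1 * (a powr ?\<kappa> * a powr (2 * \<beta>))) * cross_cov s t"
    using a s t by (simp add: cross_cov_eq)
  also have "a powr 1 * (a powr ?\<kappa> * a powr (2 * \<beta>)) = a powr (\<alpha> + \<beta> + 1/2)"
  proof -
    have "1 + (?\<kappa> + 2 * \<beta>) = \<alpha> + \<beta> + 1/2" by simp
    then show ?thesis by (simp only: powr_add[symmetric])
  qed
  finally show ?thesis .
qed

end

section \<open>Invariance of the law\<close>

context self_similar_coordinate_process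
begin

text \<open>With \<open>I = Z_integral\<close>, the derivative of \<open>a \<mapsto> I (a s) * I (a t)\<close> on \<open>(0,1)\<close> is
  \<open>euler_term s t a + euler_term t s a\<close>.\<close>

definition euler_term :: "real \<Rightarrow> real \<Rightarrow> real \<Rightarrow> (real \<Rightarrow> real) \<Rightarrow> real" where
  "euler_term s t a \<omega> = indicator {0<..<1} a * (s * (Z_integrand \<beta> \<alpha> (a * s) \<omega> * Z_integral (a * t) \<omega>))"

lemma nn_weighted_second_moment:
  assumes "0 \<le> s" shows "(\<integral>\<^sup>+\<omega>. ennreal ((k * \<omega> s)\<^sup>2) \<partial>P) = ennreal ((k * (\<sigma> * s powr \<beta>))\<^sup>2)"
proof -
  have "(\<integral>\<^sup>+\<omega>. ennreal ((k * \<omega> s)\<^sup>2) \<partial>P) = (\<integral>\<^sup>+\<omega>. ennreal (k\<^sup>2) * ennreal ((\<omega> s)\<^sup>2) \<partial>P)"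
    by (simp add: power_mult_distrib ennreal_mult)
  also have "\<dots> = ennreal (k\<^sup>2) * ennreal ((\<sigma> * s powr \<beta>)\<^sup>2)"
    using coordinate_measurable[OF assms] by (subst nn_integral_cmult) (simp_all add: nn_second_moment[OF assms])
  finally show ?thesis by (simp add: ennreal_mult[symmetric] power_mult_distrib)
qed

lemma square_integrable_Z_integral: "0 < t \<Longrightarrow> square_integrable P (Z_integral t)"
  using Z_integral_L2_bound(2) by (simp add: Z_integral_def[abs_def])

lemma nn_Z_integral_second_moment:
  assumes "0 < t"
  shows "(\<integral>\<^sup>+\<omega>. ennreal ((Z_integral t \<omega>)\<^sup>2) \<partial>P) \<le> ennreal ((\<sigma> * (t powr (\<alpha> + 1/2) / (\<alpha> + 1/2)))\<^sup>2)"
  using Z_integral_L2_bound(3)[OF assms] square_integrable_Z_integral[OF assms]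
  by (simp add: square_integrable_def nn_integral_eq_integral Z_integral_def)

lemma euler_term_measurable: "(\<lambda>(\<omega>, a). euler_term s t a \<omega>) \<in> borel_measurable (P \<Otimes>\<^sub>M lborel)"
proof -
  define ev :: "(real \<Rightarrow> real) \<times> real \<Rightarrow> real" where "ev = (\<lambda>p. fst p (snd p))"
  have ev[measurable]: "ev \<in> borel_measurable (P \<Otimes>\<^sub>M lborel)" using evaluation_measurable by (simp add: ev_def)
  have ind: "(\<lambda>q. indicator {0..snd (fst q) * t} (snd q) :: real) \<in> borel_measurable ((P \<Otimes>\<^sub>M lborel) \<Otimes>\<^sub>M lborel)"
    unfolding indicator_def atLeastAtMost_iff by measurable
  have "(\<lambda>q. indicator {0..snd (fst q) * t} (snd q) * (snd q powr (\<alpha> - \<beta> - 1/2) * ev (fst (fst q), snd q)))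
      \<in> borel_measurable ((P \<Otimes>\<^sub>M lborel) \<Otimes>\<^sub>M lborel)"
    by (intro borel_measurable_times ind) measurable
  then have "(\<lambda>p. \<integral>v. indicator {0..snd p * t} v * (v powr (\<alpha> - \<beta> - 1/2) * ev (fst p, v)) \<partial>lborel) \<in> borel_measurable (P \<Otimes>\<^sub>M lborel)"
    by (intro lborel.borel_measurable_lebesgue_integral) (simp add: case_prod_beta')
  then have I: "(\<lambda>p. Z_integral (snd p * t) (fst p)) \<in> borel_measurable (P \<Otimes>\<^sub>M lborel)"
    by (simp add: Z_integral_def set_lebesgue_integral_def Z_integrand_def ev_def)
  have "(\<lambda>p. (snd p * s) powr (\<alpha> - \<beta> - 1/2) * ev (fst p, snd p * s)) \<in> borel_measurable (P \<Otimes>\<^sub>M lborel)" by measurable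
  then have Zm: "(\<lambda>p. Z_integrand \<beta> \<alpha> (snd p * s) (fst p)) \<in> borel_measurable (P \<Otimes>\<^sub>M lborel)"
    by (simp add: Z_integrand_def ev_def)
  have "(\<lambda>p. indicator {0<..<1} (snd p) * (s * (Z_integrand \<beta> \<alpha> (snd p * s) (fst p) * Z_integral (snd p * t) (fst p)))) \<in> borel_measurable (P \<Otimes>\<^sub>M lborel)"
    by (intro borel_measurable_times I Zm) measurable
  then show ?thesis by (simp add: euler_term_def case_prod_beta')
qed

text \<open>By homogeneity of \<open>cross_cov\<close> the expectation at time \<open>a\<close> is a constant times \<open>a powr (2\<alpha>)\<close>, whose
  integral over \<open>(0,1)\<close> is \<open>1/(2\<alpha>+1)\<close>.\<close>

lemma euler_term_integral:
  assumes s: "0 < s" and t: "0 < t"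
  shows "AE \<omega> in P. integrable lborel (\<lambda>a. euler_term s t a \<omega>)"
    and "(\<integral>\<omega>. (\<integral>a. euler_term s t a \<omega> \<partial>lborel) \<partial>P) = s powr (\<alpha> + 1/2 - \<beta>) * cross_cov s t / (2 * \<alpha> + 1)"
    and "integrable P (\<lambda>\<omega>. \<integral>a. euler_term s t a \<omega> \<partial>lborel)"
proof -
  let ?\<kappa> = "\<alpha> - \<beta> - 1/2"
  define C where "C = s * (s powr ?\<kappa> * (\<sigma> * s powr \<beta>)) * (\<sigma> * (t powr (\<alpha> + 1/2) / (\<alpha> + 1/2)))"
  have C: "0 \<le> C" using s \<sigma>_nonneg \<alpha>_gt by (simp add: C_def)
  define b where "b a = ennreal (C * (indicator {0<..<1} a * a powr (2 * \<alpha>)))" for a :: real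
  have bound: "(\<integral>\<^sup>+\<omega>. ennreal \<bar>euler_term s t a \<omega>\<bar> \<partial>P) \<le> b a" for a
  proof (cases "a \<in> {0<..<1}")
    case True
    then have as: "0 < a * s" "0 < a * t" using s t by auto
    let ?A = "(a * s) powr ?\<kappa> * (\<sigma> * (a * s) powr \<beta>)" and ?B = "\<sigma> * ((a * t) powr (\<alpha> + 1/2) / (\<alpha> + 1/2))"
    have AB: "0 \<le> ?A" "0 \<le> ?B" using \<sigma>_nonneg \<alpha>_gt by auto
    have mZ: "Z_integrand \<beta> \<alpha> (a * s) \<in> borel_measurable P"
      unfolding Z_integrand_def[abs_def] using coordinate_measurable as by (intro borel_measurable_times) auto
    have mI: "Z_integral (a * t) \<in> borel_measurable P"
      using square_integrable_Z_integral[OF as(2)] by (simp add: square_integrable_def)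
    have "(\<integral>\<^sup>+\<omega>. ennreal \<bar>euler_term s t a \<omega>\<bar> \<partial>P) = (\<integral>\<^sup>+\<omega>. ennreal s * ennreal \<bar>Z_integrand \<beta> \<alpha> (a * s) \<omega> * Z_integral (a * t) \<omega>\<bar> \<partial>P)"
      using True s by (simp add: euler_term_def abs_mult ennreal_mult)
    also have "\<dots> = ennreal s * (\<integral>\<^sup>+\<omega>. ennreal \<bar>Z_integrand \<beta> \<alpha> (a * s) \<omega> * Z_integral (a * t) \<omega>\<bar> \<partial>P)"
      using mZ mI by (intro nn_integral_cmult) measurable
    also have "\<dots> \<le> ennreal s * ennreal (?A * ?B)"
    proof (intro mult_left_mono nn_integral_abs_mult_le mZ mI AB)
      show "(\<integral>\<^sup>+\<omega>. ennreal ((Z_integrand \<beta> \<alpha> (a * s) \<omega>)\<^sup>2) \<partial>P) \<le> ennreal (?A\<^sup>2)"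
        unfolding Z_integrand_def by (rule eq_refl, rule nn_weighted_second_moment) (use as in simp)
    qed (use nn_Z_integral_second_moment[OF as(2)] in auto)
    also have "\<dots> = ennreal (s * (?A * ?B))" using s by (intro ennreal_mult[symmetric] mult_nonneg_nonneg AB) simp
    also have "s * (?A * ?B) = C * (a powr ?\<kappa> * a powr \<beta> * a powr (\<alpha> + 1/2))"
      using True s t by (simp add: C_def powr_mult)
    also have "a powr ?\<kappa> * a powr \<beta> * a powr (\<alpha> + 1/2) = a powr (2 * \<alpha>)"
    proof -
      have "?\<kappa> + \<beta> + (\<alpha> + 1/2) = 2 * \<alpha>" by simp
      then show ?thesis by (simp only: powr_add[symmetric])
    qed
    finally show ?thesis using True by (simp add: b_def)
  qed (simp add: euler_term_def)
  have fin: "(\<integral>\<^sup>+a. b a \<partial>lborel) < \<infinity>"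
  proof -
    have "(\<integral>\<^sup>+a. b a \<partial>lborel) \<le> (\<integral>\<^sup>+a. ennreal C * ennreal (indicator {0..1} a * a powr (2 * \<alpha>)) \<partial>lborel)"
      unfolding b_def using C by (intro nn_integral_mono) (auto simp: indicator_def ennreal_mult)
    also have "\<dots> = ennreal C * ennreal (1 powr (2 * \<alpha> + 1) / (2 * \<alpha> + 1))"
      using \<alpha>_gt by (subst nn_integral_cmult) (simp_all add: nn_integral_powr_from_0)
    also have "\<dots> < \<infinity>" by (simp add: ennreal_mult_less_top)
    finally show ?thesis .
  qed
  note F = Fubini_dominated[OF euler_term_measurable bound fin]
  show "AE \<omega> in P. integrable lborel (\<lambda>a. euler_term s t a \<omega>)" by (rule F(1))
  have "(\<integral>\<omega>. euler_term s t a \<omega> \<partial>P) = s powr (\<alpha> + 1/2 - \<beta>) * cross_cov s t * (indicator {0<..<1} a * a powr (2 * \<alpha>))" for a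
  proof (cases "a \<in> {0<..<1}")
    case True
    then have a: "0 < a" by simp
    have "(\<integral>\<omega>. euler_term s t a \<omega> \<partial>P) = (\<integral>\<omega>. (s * (a * s) powr ?\<kappa>) * (\<omega> (a * s) * Z_integral (a * t) \<omega>) \<partial>P)"
      using True by (intro Bochner_Integration.integral_cong) (auto simp: euler_term_def Z_integrand_def)
    also have "\<dots> = (s * (a * s) powr ?\<kappa>) * cross_cov (a * s) (a * t)" by (simp add: cross_cov_def)
    also have "\<dots> = ((s powr 1 * s powr ?\<kappa>) * (a powr ?\<kappa> * a powr (\<alpha> + \<beta> + 1/2))) * cross_cov s t"
      using a s t by (simp add: cross_cov_homogeneous powr_mult)
    also have "s powr 1 * s powr ?\<kappa> = s powr (\<alpha> + 1/2 - \<beta>)" by (rule powr_mult_powr) simp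
    also have "a powr ?\<kappa> * a powr (\<alpha> + \<beta> + 1/2) = a powr (2 * \<alpha>)" by (rule powr_mult_powr) simp
    finally show ?thesis using True by simp
  qed (simp add: euler_term_def)
  then have "(\<integral>a. (\<integral>\<omega>. euler_term s t a \<omega> \<partial>P) \<partial>lborel) = s powr (\<alpha> + 1/2 - \<beta>) * cross_cov s t * (1 / (2 * \<alpha> + 1))"
    using \<alpha>_gt by (simp add: integral_powr_unit_interval)
  then show "(\<integral>\<omega>. (\<integral>a. euler_term s t a \<omega> \<partial>lborel) \<partial>P) = s powr (\<alpha> + 1/2 - \<beta>) * cross_cov s t / (2 * \<alpha> + 1)"
    using F(2) by simp
  show "integrable P (\<lambda>\<omega>. \<integral>a. euler_term s t a \<omega> \<partial>lborel)" by (rule F(3))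
qed

lemma Z_integral_at_0:
  assumes "\<omega> \<in> Z_domain \<beta> \<alpha>"
  shows "((\<lambda>r. Z_integral r \<omega>) \<longlongrightarrow> 0) (at_right 0)"
proof -
  have int: "set_integrable lborel {0..1} (\<lambda>s. Z_integrand \<beta> \<alpha> s \<omega>)" using assms by (simp add: Z_domain_def)
  have "((\<lambda>r. Z_integral 1 \<omega> - (LBINT s:{r..1}. Z_integrand \<beta> \<alpha> s \<omega>)) \<longlongrightarrow> Z_integral 1 \<omega> - Z_integral 1 \<omega>) (at_right 0)"
    unfolding Z_integral_def by (intro tendsto_intros integral_from_0_tendsto int) simp
  moreover have "\<forall>\<^sub>F r in at_right 0. Z_integral 1 \<omega> - (LBINT s:{r..1}. Z_integrand \<beta> \<alpha> s \<omega>) = Z_integral r \<omega>"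
    using eventually_at_right_real[OF zero_less_one]
  proof eventually_elim
    case (elim r)
    then show ?case unfolding Z_integral_def using integral_from_0_split[OF int, of r] by auto
  qed
  ultimately have "((\<lambda>r. Z_integral r \<omega>) \<longlongrightarrow> Z_integral 1 \<omega> - Z_integral 1 \<omega>) (at_right 0)"
    by (rule Lim_transform_eventually)
  then show ?thesis by simp
qed

text \<open>The fundamental theorem of calculus for \<open>a \<mapsto> I (a s) * I (a t)\<close> on \<open>(0,1)\<close>; the lower boundary term is \<open>0\<close>.\<close>

lemma product_of_Z_integrals:
  assumes \<omega>: "\<omega> \<in> Z_domain \<beta> \<alpha>" and s: "0 < s" and t: "0 < t"
    and int: "integrable lborel (\<lambda>a. euler_term s t a \<omega>)" "integrable lborel (\<lambda>a. euler_term t s a \<omega>)"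
  shows "Z_integral s \<omega> * Z_integral t \<omega> = (\<integral>a. euler_term s t a \<omega> \<partial>lborel) + (\<integral>a. euler_term t s a \<omega> \<partial>lborel)"
proof -
  let ?I = "\<lambda>t. Z_integral t \<omega>" and ?z = "\<lambda>s. Z_integrand \<beta> \<alpha> s \<omega>"
  define F where "F a = ?I (a * s) * ?I (a * t)" for a
  define f where "f a = s * (?z (a * s) * ?I (a * t)) + t * (?z (a * t) * ?I (a * s))" for a
  have I': "(?I has_real_derivative ?z u) (at u)" if "0 < u" for u
    using Z_integral_has_derivative[OF \<omega> that] by (simp add: Z_integral_def)
  have der: "((\<lambda>a. ?I (a * c)) has_real_derivative ?z (a * c) * c) (at a)" if "0 < a" "0 < c" for a c
    by (rule DERIV_chain2[of ?I]) (use I'[of "a * c"] that in \<open>auto intro!: derivative_eq_intros\<close>)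
  have zc: "isCont ?z u" if "0 < u" for u
    using continuous_on_Z_integrand(1)[of \<omega> \<beta> \<alpha>] \<omega> that by (auto simp: Z_domain_def continuous_on_eq_continuous_at)
  have "(LBINT a=ereal 0..ereal 1. f a) = ?I s * ?I t - 0"
  proof (rule interval_integral_FTC_integrable)
    show "(F has_vector_derivative f x) (at x)" if "ereal 0 < ereal x" "ereal x < ereal 1" for x
    proof -
      have "(F has_real_derivative (?z (x * s) * s) * ?I (x * t) + (?z (x * t) * t) * ?I (x * s)) (at x)"
        unfolding F_def by (rule DERIV_mult[OF der der]) (use that s t in auto)
      then show ?thesis by (simp add: f_def mult_ac flip: has_real_derivative_iff_has_vector_derivative)
    qed
    show "isCont f x" if "ereal 0 < ereal x" "ereal x < ereal 1" for x
    proof -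
      have "isCont (\<lambda>a. ?z (a * c)) x" "isCont (\<lambda>a. ?I (a * c)) x" if "0 < c" for c
      proof -
        have "0 < x * c" using that \<open>ereal 0 < ereal x\<close> by simp
        then show "isCont (\<lambda>a. ?z (a * c)) x" by (intro isCont_o2[OF _ zc]) (auto intro: continuous_intros)
        show "isCont (\<lambda>a. ?I (a * c)) x" by (rule DERIV_isCont[OF der]) (use that \<open>ereal 0 < ereal x\<close> in auto)
      qed
      then show ?thesis unfolding f_def using s t by (intro continuous_intros) auto
    qed
    have "integrable lborel (\<lambda>a. euler_term s t a \<omega> + euler_term t s a \<omega>)" using int by simp
    moreover have "(\<lambda>a. euler_term s t a \<omega> + euler_term t s a \<omega>) = (\<lambda>a. indicator {0<..<1} a *\<^sub>R f a)"
      by (auto simp: euler_term_def f_def indicator_def)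
    moreover have "einterval (ereal 0) (ereal 1) = {0<..<1}" by (auto simp: einterval_def)
    ultimately show "set_integrable lborel (einterval (ereal 0) (ereal 1)) f" by (simp add: set_integrable_def)
    have lim: "((\<lambda>a. ?I (a * c)) \<longlongrightarrow> 0) (at_right 0)" if "0 < c" for c
    proof (rule filterlim_compose[OF Z_integral_at_0[OF \<omega>]])
      show "LIM a at_right 0. a * c :> at_right 0"
        by (subst mult.commute, rule filterlim_times_pos[OF filterlim_ident that]) simp
    qed
    have "(F \<longlongrightarrow> 0 * 0) (at_right 0)" unfolding F_def by (intro tendsto_mult lim s t)
    then show "((F \<circ> real_of_ereal) \<longlongrightarrow> 0) (at_right (ereal 0))" by (simp only: ereal_tendsto_simps) simp
    have "(F \<longlongrightarrow> F 1) (at_left 1)"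
    proof -
      have "isCont F 1" unfolding F_def using s t by (intro continuous_mult DERIV_isCont[OF der]) auto
      then show ?thesis by (auto simp: isCont_def filterlim_at_split)
    qed
    then show "((F \<circ> real_of_ereal) \<longlongrightarrow> ?I s * ?I t) (at_left (ereal 1))"
      by (simp only: ereal_tendsto_simps) (simp add: F_def)
  qed simp
  moreover have "(LBINT a=ereal 0..ereal 1. f a) = (\<integral>a. euler_term s t a \<omega> + euler_term t s a \<omega> \<partial>lborel)"
  proof -
    have "einterval (ereal 0) (ereal 1) = {0<..<1}" by (auto simp: einterval_def)
    then show ?thesis
      by (auto simp: interval_lebesgue_integral_def set_lebesgue_integral_def euler_term_def f_def indicator_def
          intro!: Bochner_Integration.integral_cong)
  qed
  ultimately show ?thesis using int by simp
qed

text \<open>Euler's identity \<open>s * \<partial>\<^sub>s G + t * \<partial>\<^sub>t G = (2\<alpha>+1) * G\<close> for \<open>G s t = E (I s * I t)\<close>, which is homogeneous of degree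
  \<open>2\<alpha>+1\<close>. It is obtained in integrated form, by taking expectations of the pathwise identity above, so
  that no partial derivative of an expectation is needed.\<close>

lemma Z_integral_euler:
  assumes s: "0 < s" and t: "0 < t"
  shows "(2 * \<alpha> + 1) * (\<integral>\<omega>. Z_integral s \<omega> * Z_integral t \<omega> \<partial>P)
    = s powr (\<alpha> + 1/2 - \<beta>) * cross_cov s t + t powr (\<alpha> + 1/2 - \<beta>) * cross_cov t s"
proof -
  have sq: "square_integrable P (Z_integral s)" "square_integrable P (Z_integral t)"
    using s t by (auto intro: square_integrable_Z_integral)
  have "(\<integral>\<omega>. Z_integral s \<omega> * Z_integral t \<omega> \<partial>P)
      = (\<integral>\<omega>. (\<integral>a. euler_term s t a \<omega> \<partial>lborel) + (\<integral>a. euler_term t s a \<omega> \<partial>lborel) \<partial>P)"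
  proof (rule integral_cong_AE)
    show "AE \<omega> in P. Z_integral s \<omega> * Z_integral t \<omega> = (\<integral>a. euler_term s t a \<omega> \<partial>lborel) + (\<integral>a. euler_term t s a \<omega> \<partial>lborel)"
      using AE_Z_domain euler_term_integral(1)[OF s t] euler_term_integral(1)[OF t s]
      by eventually_elim (rule product_of_Z_integrals[OF _ s t])
  qed (use square_integrable_mult[OF sq] euler_term_integral(3)[OF s t] euler_term_integral(3)[OF t s] in auto)
  also have "\<dots> = s powr (\<alpha> + 1/2 - \<beta>) * cross_cov s t / (2 * \<alpha> + 1) + t powr (\<alpha> + 1/2 - \<beta>) * cross_cov t s / (2 * \<alpha> + 1)"
    using euler_term_integral(3)[OF s t] euler_term_integral(3)[OF t s]
    by (simp add: euler_term_integral(2)[OF s t] euler_term_integral(2)[OF t s])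
  finally show ?thesis using \<alpha>_gt by (simp add: distrib_left)
qed

lemma Z_transform_eq: "0 < t \<Longrightarrow> Z_transform \<beta> \<alpha> \<omega> t = \<omega> t + (- ((2 * \<alpha> + 1) * t powr (\<beta> - \<alpha> - 1/2))) * Z_integral t \<omega>"
  by (simp add: Z_transform_def Z_integral_def)

lemma span_Z_transform:
  assumes "0 \<le> t" shows "span (\<lambda>\<omega>. Z_transform \<beta> \<alpha> \<omega> t)"
proof (cases "t = 0")
  case True
  then show ?thesis using span_coordinate[of 0 0] by (simp add: Z_transform_def)
next
  case False
  then have t: "0 < t" using assms by simp
  have "span (Z_integral t)" using span_Z_integral[OF t] by (simp add: Z_integral_def[abs_def])
  then show ?thesis unfolding Z_transform_eq[OF t]
    using span_coordinate[of t 1] assms by (intro span_add span_cmult) simp_all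
qed

text \<open>Expanding the product gives \<open>R s t\<close>, two cross terms and a multiple of \<open>E (I s * I t)\<close>; Euler's identity
  says that the last three cancel.\<close>

lemma Z_transform_covariance:
  assumes s: "0 \<le> s" and t: "0 \<le> t"
  shows "(\<integral>\<omega>. Z_transform \<beta> \<alpha> \<omega> s * Z_transform \<beta> \<alpha> \<omega> t \<partial>P) = R s t"
proof -
  have R0: "R u v = 0" if "u = 0 \<or> v = 0" "0 \<le> u" "0 \<le> v" for u v
  proof -
    have "AE \<omega> in P. \<omega> 0 = 0" using AE_Z_domain by eventually_elim (simp add: Z_domain_def)
    then have "AE \<omega> in P. \<omega> u * \<omega> v = 0" by eventually_elim (use that(1) in auto)
    then have "(\<integral>\<omega>. \<omega> u * \<omega> v \<partial>P) = 0" by (rule integral_eq_zero_AE)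
    then show ?thesis using covariance that by simp
  qed
  show ?thesis
  proof (cases "s = 0 \<or> t = 0")
    case True
    then have "(\<integral>\<omega>. Z_transform \<beta> \<alpha> \<omega> s * Z_transform \<beta> \<alpha> \<omega> t \<partial>P) = 0" by (auto simp: Z_transform_def)
    then show ?thesis using R0[OF True s t] by simp
  next
    case False
    then have s: "0 < s" and t: "0 < t" using s t by auto
    let ?c = "2 * \<alpha> + 1" and ?k = "\<beta> - \<alpha> - 1/2"
    let ?S = "?c * s powr ?k" and ?T = "?c * t powr ?k"
    note sq = square_integrable_coordinate[OF less_imp_le] square_integrable_Z_integral
    have int: "integrable P (\<lambda>\<omega>. \<omega> s * \<omega> t)" "integrable P (\<lambda>\<omega>. \<omega> s * Z_integral t \<omega>)"
      "integrable P (\<lambda>\<omega>. \<omega> t * Z_integral s \<omega>)" "integrable P (\<lambda>\<omega>. Z_integral s \<omega> * Z_integral t \<omega>)"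
      using s t by (auto intro!: square_integrable_mult sq)
    have "(\<integral>\<omega>. Z_transform \<beta> \<alpha> \<omega> s * Z_transform \<beta> \<alpha> \<omega> t \<partial>P)
       = (\<integral>\<omega>. \<omega> s * \<omega> t - ?T * (\<omega> s * Z_integral t \<omega>) - ?S * (\<omega> t * Z_integral s \<omega>) + ?S * ?T * (Z_integral s \<omega> * Z_integral t \<omega>) \<partial>P)"
      unfolding Z_transform_eq[OF s] Z_transform_eq[OF t]
      by (intro Bochner_Integration.integral_cong) (auto simp: algebra_simps)
    also have "\<dots> = R s t - ?T * cross_cov s t - ?S * cross_cov t s + ?S * ?T * (\<integral>\<omega>. Z_integral s \<omega> * Z_integral t \<omega> \<partial>P)"
      using int covariance[of s t] s t by (simp add: cross_cov_def)
    also have "?S * ?T * (\<integral>\<omega>. Z_integral s \<omega> * Z_integral t \<omega> \<partial>P) = ?S * t powr ?k * (?c * (\<integral>\<omega>. Z_integral s \<omega> * Z_integral t \<omega> \<partial>P))"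
      by simp
    also have "\<dots> = ?T * cross_cov s t * (s powr ?k * s powr (\<alpha> + 1/2 - \<beta>)) + ?S * cross_cov t s * (t powr ?k * t powr (\<alpha> + 1/2 - \<beta>))"
      unfolding Z_integral_euler[OF s t] by (simp only: distrib_left mult_ac)
    also have "s powr ?k * s powr (\<alpha> + 1/2 - \<beta>) = 1" using s powr_mult_powr[of ?k "\<alpha> + 1/2 - \<beta>" 0 s] by simp
    also have "t powr ?k * t powr (\<alpha> + 1/2 - \<beta>) = 1" using t powr_mult_powr[of ?k "\<alpha> + 1/2 - \<beta>" 0 t] by simp
    finally show ?thesis by simp
  qed
qed

lemma span_measurable: "span Y \<Longrightarrow> Y \<in> borel_measurable P"
  by (drule span_square_integrable) (simp add: square_integrable_def)

text \<open>Linear combinations of the \<open>Z_transform \<beta> \<alpha> \<omega> t\<close> lie in the Gaussian span, so their expected cosines depend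
  on their variances only, and these are determined by the covariance.\<close>

theorem distr_Z_transform:
  "distr P (Pi\<^sub>M {0..} (\<lambda>_. borel)) (Z_transform \<beta> \<alpha>) = distr P (Pi\<^sub>M {0..} (\<lambda>_. borel)) (\<lambda>\<omega>. \<omega>)"
proof -
  let ?Z = "\<lambda>t \<omega>. Z_transform \<beta> \<alpha> \<omega> t"
  have var: "(\<integral>\<omega>. (\<Sum>j\<in>J. c j * Y j \<omega>)\<^sup>2 \<partial>P) = (\<Sum>i\<in>J. \<Sum>j\<in>J. c i * (c j * R i j))"
    if J: "finite J" "J \<subseteq> {0..}" and Y: "\<And>j. j \<in> J \<Longrightarrow> span (Y j)"
      and cov: "\<And>i j. i \<in> J \<Longrightarrow> j \<in> J \<Longrightarrow> (\<integral>\<omega>. Y i \<omega> * Y j \<omega> \<partial>P) = R i j" for J c and Y :: "real \<Rightarrow> (real \<Rightarrow> real) \<Rightarrow> real"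
  proof -
    have int: "integrable P (\<lambda>\<omega>. c i * (c j * (Y i \<omega> * Y j \<omega>)))" if "i \<in> J" "j \<in> J" for i j
      using square_integrable_mult[OF span_square_integrable[OF Y[OF that(1)]] span_square_integrable[OF Y[OF that(2)]]] by simp
    have "(\<integral>\<omega>. (\<Sum>j\<in>J. c j * Y j \<omega>)\<^sup>2 \<partial>P) = (\<integral>\<omega>. (\<Sum>i\<in>J. \<Sum>j\<in>J. c i * (c j * (Y i \<omega> * Y j \<omega>))) \<partial>P)"
      by (intro Bochner_Integration.integral_cong) (auto simp: power2_eq_square sum_product mult_ac)
    also have "\<dots> = (\<Sum>i\<in>J. \<integral>\<omega>. (\<Sum>j\<in>J. c i * (c j * (Y i \<omega> * Y j \<omega>))) \<partial>P)"
      using int by (intro Bochner_Integration.integral_sum Bochner_Integration.integrable_sum)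
    also have "\<dots> = (\<Sum>i\<in>J. \<Sum>j\<in>J. \<integral>\<omega>. c i * (c j * (Y i \<omega> * Y j \<omega>)) \<partial>P)"
      using int by (intro sum.cong refl Bochner_Integration.integral_sum)
    also have "\<dots> = (\<Sum>i\<in>J. \<Sum>j\<in>J. c i * (c j * R i j))"
      using cov by (intro sum.cong refl) simp
    finally show ?thesis .
  qed
  have "distr P (Pi\<^sub>M {0..} (\<lambda>_. borel)) (\<lambda>\<omega>. \<lambda>t\<in>{0..}. ?Z t \<omega>) = distr P (Pi\<^sub>M {0..} (\<lambda>_. borel)) (\<lambda>\<omega>. \<lambda>t\<in>{0..}. \<omega> t)"
  proof (rule distr_PiM_eqI_cos[OF prob_space_axioms prob_space_axioms])
    fix t :: real assume "t \<in> {0..}"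
    then show "?Z t \<in> borel_measurable P" "(\<lambda>\<omega>. \<omega> t) \<in> borel_measurable P"
      using span_measurable[OF span_Z_transform] coordinate_measurable by auto
  next
    fix J :: "real set" and c \<phi> assume J: "finite J" "J \<subseteq> {0..}"
    then have J0: "\<And>j. j \<in> J \<Longrightarrow> 0 \<le> j" by auto
    have 1: "span (\<lambda>\<omega>. \<Sum>j\<in>J. c j * ?Z j \<omega>)" using J0 by (intro span_sum span_cmult span_Z_transform) auto
    have 2: "span (\<lambda>\<omega>. \<Sum>j\<in>J. c j * \<omega> j)" using J0 by (intro span_sum span_coordinate) auto
    have "(\<integral>\<omega>. (\<Sum>j\<in>J. c j * ?Z j \<omega>)\<^sup>2 \<partial>P) = (\<integral>\<omega>. (\<Sum>j\<in>J. c j * \<omega> j)\<^sup>2 \<partial>P)"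
      using var[OF J, of ?Z c] var[OF J, of "\<lambda>t \<omega>. \<omega> t" c] J0 Z_transform_covariance covariance
        span_Z_transform span_base by simp
    then show "(\<integral>\<omega>. cos ((\<Sum>j\<in>J. c j * ?Z j \<omega>) + \<phi>) \<partial>P) = (\<integral>\<omega>. cos ((\<Sum>j\<in>J. c j * \<omega> j) + \<phi>) \<partial>P)"
      unfolding expectation_cos_span[OF 1] expectation_cos_span[OF 2] by simp
  qed
  moreover have "(\<lambda>\<omega>. \<lambda>t\<in>{0..}. ?Z t \<omega>) = Z_transform \<beta> \<alpha>"
    using extensional_restrict[OF Z_transform_extensional(1)] by simp
  moreover have "distr P (Pi\<^sub>M {0..} (\<lambda>_. borel)) (\<lambda>\<omega>. \<lambda>t\<in>{0..}. \<omega> t) = distr P (Pi\<^sub>M {0..} (\<lambda>_. borel)) (\<lambda>\<omega>. \<omega>)"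
    by (rule distr_cong) (auto simp: space_P paths_def extensional_restrict)
  ultimately show ?thesis by simp
qed

end

section \<open>The automorphism of the coordinate space\<close>

text \<open>Convergence to \<open>0\<close> at \<open>0\<close> along the positive rationals: an event in countably many coordinates. The maximum
  with \<open>0\<close> only keeps the index in \<open>[0,\<infinity>)\<close>.\<close>

definition vanishes_at_0 :: "(real \<Rightarrow> real) \<Rightarrow> bool" where
  "vanishes_at_0 g \<longleftrightarrow> (\<forall>k::nat. \<exists>m::nat. \<forall>q::rat. 0 < q \<and> real_of_rat q < inverse (real (Suc m)) \<longrightarrow>
     \<bar>g (max 0 (real_of_rat q))\<bar> \<le> inverse (real (Suc k)))"

lemma vanishes_at_0_measurable: "{x \<in> space (Pi\<^sub>M {0..} (\<lambda>_. borel)). vanishes_at_0 x} \<in> sets (Pi\<^sub>M {0..} (\<lambda>_. borel))"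
proof -
  have [measurable]: "(\<lambda>x. x (max 0 (real_of_rat q))) \<in> borel_measurable (Pi\<^sub>M {0..} (\<lambda>_. borel :: real measure))" for q
    by (rule measurable_component_singleton) simp
  show ?thesis unfolding vanishes_at_0_def by measurable
qed

lemma continuous_on_iff_vanishes_at_0:
  assumes g: "continuous_on {0<..} g" "g 0 = 0"
  shows "continuous_on {0..} g \<longleftrightarrow> vanishes_at_0 g"
proof
  assume "continuous_on {0..} g"
  then have "(g \<longlongrightarrow> g 0) (at 0 within {0..})" unfolding continuous_on_def by (rule bspec) simp
  then have c0: "(g \<longlongrightarrow> 0) (at 0 within {0..})" using g(2) by simp
  show "vanishes_at_0 g" unfolding vanishes_at_0_def
  proof
    fix k :: nat
    have "\<forall>\<^sub>F x in at 0 within {0..}. dist (g x) 0 < inverse (real (Suc k))"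
      using c0 by (rule tendstoD) simp
    then obtain d where d: "d > 0" "\<And>x. 0 \<le> x \<Longrightarrow> x \<noteq> 0 \<Longrightarrow> dist x 0 < d \<Longrightarrow> dist (g x) 0 < inverse (real (Suc k))"
      unfolding eventually_at by auto
    obtain m where m: "inverse (real (Suc m)) < d" using reals_Archimedean[OF d(1)] by blast
    show "\<exists>m. \<forall>q. 0 < q \<and> real_of_rat q < inverse (real (Suc m)) \<longrightarrow> \<bar>g (max 0 (real_of_rat q))\<bar> \<le> inverse (real (Suc k))"
    proof (intro exI[of _ m] allI impI)
      fix q :: rat assume q: "0 < q \<and> real_of_rat q < inverse (real (Suc m))"
      then have "0 < real_of_rat q" by simp
      then show "\<bar>g (max 0 (real_of_rat q))\<bar> \<le> inverse (real (Suc k))"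
        using d(2)[of "real_of_rat q"] q m by (simp add: dist_real_def)
    qed
  qed
next
  assume v: "vanishes_at_0 g"
  have lim: "(g \<longlongrightarrow> 0) (at 0 within {0..})"
  proof (rule tendstoI)
    fix e :: real assume "e > 0"
    then obtain k where k: "inverse (real (Suc k)) < e" using reals_Archimedean by blast
    obtain m where m: "\<And>q::rat. 0 < q \<Longrightarrow> real_of_rat q < inverse (real (Suc m)) \<Longrightarrow> \<bar>g (max 0 (real_of_rat q))\<bar> \<le> inverse (real (Suc k))"
      using v unfolding vanishes_at_0_def by blast
    have small: "\<bar>g t\<bar> \<le> inverse (real (Suc k))" if t: "0 < t" "t < inverse (real (Suc m))" for t
    proof (rule ccontr)
      assume "\<not> ?thesis"
      then have "inverse (real (Suc k)) < \<bar>g t\<bar>" by simp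
      moreover have "((\<lambda>x. \<bar>g x\<bar>) \<longlongrightarrow> \<bar>g t\<bar>) (at t)"
        using g(1) t by (intro tendsto_rabs) (auto simp: continuous_on_eq_continuous_at isCont_def)
      ultimately have "\<forall>\<^sub>F x in at t. inverse (real (Suc k)) < \<bar>g x\<bar>" by (rule order_tendstoD(1)[rotated])
      then obtain d where d: "d > 0" "\<And>x. x \<noteq> t \<Longrightarrow> dist x t < d \<Longrightarrow> inverse (real (Suc k)) < \<bar>g x\<bar>"
        unfolding eventually_at by auto
      have "t < min (t + d) (inverse (real (Suc m)))" using t d by simp
      from of_rat_dense[OF this] obtain q where q: "t < real_of_rat q" "real_of_rat q < min (t + d) (inverse (real (Suc m)))"
        by blast
      then have q0: "0 < real_of_rat q" using t by linarith
      then have "\<bar>g (real_of_rat q)\<bar> \<le> inverse (real (Suc k))" using m[of q] q by simp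
      moreover have "inverse (real (Suc k)) < \<bar>g (real_of_rat q)\<bar>" using q by (intro d(2)) (auto simp: dist_real_def)
      ultimately show False by simp
    qed
    show "\<forall>\<^sub>F x in at 0 within {0..}. dist (g x) 0 < e"
      unfolding eventually_at
    proof (intro exI[of _ "inverse (real (Suc m))"] conjI ballI impI)
      fix x :: real assume "x \<in> {0..}" "x \<noteq> 0 \<and> dist x 0 < inverse (real (Suc m))"
      then have "\<bar>g x\<bar> \<le> inverse (real (Suc k))" by (intro small) (auto simp: dist_real_def)
      then show "dist (g x) 0 < e" using k by (simp add: dist_real_def)
    qed simp
  qed
  show "continuous_on {0..} g" unfolding continuous_on_def
  proof
    fix t :: real assume "t \<in> {0..}"
    show "(g \<longlongrightarrow> g t) (at t within {0..})"
    proof (cases "t = 0")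
      case True then show ?thesis using lim g(2) by simp
    next
      case False
      then have "isCont g t" using g(1) \<open>t \<in> {0..}\<close> by (auto simp: continuous_on_eq_continuous_at)
      then have "continuous (at t within {0..}) g" by (rule continuous_at_imp_continuous_at_within)
      then show ?thesis by (simp add: continuous_within)
    qed
  qed
qed

lemma path_evaluation_path_algebra: "(\<lambda>p. fst p (snd p)) \<in> borel_measurable (path_algebra \<Otimes>\<^sub>M lborel)"
  using measurable_path_evaluation[OF _ measurable_coordinate_path_algebra] by (simp add: case_prod_beta')

lemma sets_Z_domain: "Z_domain \<beta> \<alpha> \<in> sets path_algebra"
proof -
  define ev :: "(real \<Rightarrow> real) \<times> real \<Rightarrow> real" where "ev = (\<lambda>p. fst p (snd p))"
  have [measurable]: "ev \<in> borel_measurable (path_algebra \<Otimes>\<^sub>M lborel)" using path_evaluation_path_algebra by (simp add: ev_def)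
  note measurable_coordinate_path_algebra[of 0, simplified, measurable]
  have 1[measurable]: "Measurable.pred path_algebra (\<lambda>\<omega>. integrable lborel (\<lambda>s. indicator {0..t} s * (s powr (\<alpha> - \<beta> - 1/2) * ev (\<omega>, s))))" for t
    by measurable
  have 2[measurable]: "Measurable.pred path_algebra (\<lambda>\<omega>. integrable lborel (\<lambda>s. indicator {t..} s * (ev (\<omega>, s) * s powr (- \<beta> - \<alpha> - 3/2))))" for t
    by measurable
  have "{\<omega> \<in> space path_algebra. \<omega> 0 = 0 \<and> (\<forall>n. set_integrable lborel {0..real (Suc n)} (\<lambda>s. Z_integrand \<beta> \<alpha> s \<omega>)) \<and>
     (\<forall>n. set_integrable lborel {inverse (real (Suc n))..} (\<lambda>s. Z_inv_integrand \<beta> \<alpha> s \<omega>))} \<in> sets path_algebra"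
    unfolding set_integrable_def Z_integrand_def Z_inv_integrand_def real_scaleR_def
    using 1 2 unfolding ev_def fst_conv snd_conv by measurable
  then show ?thesis by (simp add: Z_domain_def all_integrable_iff_nat)
qed

lemma measurable_Z_transform:
  "Z_transform \<beta> \<alpha> \<in> path_algebra \<rightarrow>\<^sub>M Pi\<^sub>M {0..} (\<lambda>_. borel)"
  "Z_inv_transform \<beta> \<alpha> \<in> path_algebra \<rightarrow>\<^sub>M Pi\<^sub>M {0..} (\<lambda>_. borel)"
proof -
  define ev :: "(real \<Rightarrow> real) \<times> real \<Rightarrow> real" where "ev = (\<lambda>p. fst p (snd p))"
  have [measurable]: "ev \<in> borel_measurable (path_algebra \<Otimes>\<^sub>M lborel)" using path_evaluation_path_algebra by (simp add: ev_def)
  have 1: "(\<lambda>\<omega>. \<integral>s. indicator {0..t} s * (s powr (\<alpha> - \<beta> - 1/2) * ev (\<omega>, s)) \<partial>lborel) \<in> borel_measurable path_algebra" for t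
    by measurable
  have 2: "(\<lambda>\<omega>. \<integral>s. indicator {t..} s * (ev (\<omega>, s) * s powr (- \<beta> - \<alpha> - 3/2)) \<partial>lborel) \<in> borel_measurable path_algebra" for t
    by measurable
  have I: "(\<lambda>\<omega>. LBINT s:{0..t}. Z_integrand \<beta> \<alpha> s \<omega>) \<in> borel_measurable path_algebra"
    "(\<lambda>\<omega>. LBINT s:{t..}. Z_inv_integrand \<beta> \<alpha> s \<omega>) \<in> borel_measurable path_algebra" for t
    using 1[of t] 2[of t] by (simp_all add: set_lebesgue_integral_def Z_integrand_def Z_inv_integrand_def ev_def)
  note c = measurable_coordinate_path_algebra
  have "(\<lambda>\<omega>. \<lambda>t\<in>{0..}. if t = 0 then 0 else \<omega> t - (2 * \<alpha> + 1) * t powr (\<beta> - \<alpha> - 1/2) * (LBINT s:{0..t}. Z_integrand \<beta> \<alpha> s \<omega>))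
     \<in> path_algebra \<rightarrow>\<^sub>M Pi\<^sub>M {0..} (\<lambda>_. borel)"
  proof (rule measurable_restrict)
    fix t :: real assume t: "t \<in> {0..}"
    show "(\<lambda>\<omega>. if t = 0 then 0 else \<omega> t - (2 * \<alpha> + 1) * t powr (\<beta> - \<alpha> - 1/2) * (LBINT s:{0..t}. Z_integrand \<beta> \<alpha> s \<omega>)) \<in> borel_measurable path_algebra"
      using c[of t] I(1)[of t] t by simp
  qed
  then show "Z_transform \<beta> \<alpha> \<in> path_algebra \<rightarrow>\<^sub>M Pi\<^sub>M {0..} (\<lambda>_. borel)" by (simp add: Z_transform_def[abs_def])
  have "(\<lambda>\<omega>. \<lambda>t\<in>{0..}. if t = 0 then 0 else \<omega> t - (2 * \<alpha> + 1) * t powr (\<alpha> + \<beta> + 1/2) * (LBINT s:{t..}. Z_inv_integrand \<beta> \<alpha> s \<omega>))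
     \<in> path_algebra \<rightarrow>\<^sub>M Pi\<^sub>M {0..} (\<lambda>_. borel)"
  proof (rule measurable_restrict)
    fix t :: real assume t: "t \<in> {0..}"
    show "(\<lambda>\<omega>. if t = 0 then 0 else \<omega> t - (2 * \<alpha> + 1) * t powr (\<alpha> + \<beta> + 1/2) * (LBINT s:{t..}. Z_inv_integrand \<beta> \<alpha> s \<omega>)) \<in> borel_measurable path_algebra"
      using c[of t] I(2)[of t] t by simp
  qed
  then show "Z_inv_transform \<beta> \<alpha> \<in> path_algebra \<rightarrow>\<^sub>M Pi\<^sub>M {0..} (\<lambda>_. borel)" by (simp add: Z_inv_transform_def[abs_def])
qed

text \<open>Continuity of \<open>T \<omega>\<close> is not a measurable condition in the product space, but for \<open>\<omega> \<in> D\<close> only continuity at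
  \<open>0\<close> is in question, and that is \<^const>\<open>vanishes_at_0\<close>.\<close>

lemma path_transform_measurable:
  assumes D: "D \<in> sets path_algebra" "E \<in> sets path_algebra"
    and T: "T \<in> path_algebra \<rightarrow>\<^sub>M Pi\<^sub>M {0..} (\<lambda>_. borel)"
    and ext: "\<And>\<omega>. T \<omega> \<in> extensional {0..}" "\<And>\<omega>. T \<omega> 0 = 0" and cont: "\<And>\<omega>. \<omega> \<in> D \<Longrightarrow> continuous_on {0<..} (T \<omega>)"
  shows "{\<omega> \<in> D. T \<omega> \<in> E} \<in> sets path_algebra"
    and "T \<in> restrict_space path_algebra {\<omega> \<in> D. T \<omega> \<in> E} \<rightarrow>\<^sub>M path_algebra"
    and "\<And>\<omega>. \<omega> \<in> D \<Longrightarrow> T \<omega> \<in> paths \<longleftrightarrow> vanishes_at_0 (T \<omega>)"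
proof -
  have Dp: "D \<subseteq> paths" and Ep: "E \<subseteq> paths" using sets.sets_into_space[OF D(1)] sets.sets_into_space[OF D(2)] by simp_all
  show paths_iff: "T \<omega> \<in> paths \<longleftrightarrow> vanishes_at_0 (T \<omega>)" if "\<omega> \<in> D" for \<omega>
    using continuous_on_iff_vanishes_at_0[OF cont[OF that] ext(2)] ext(1)[of \<omega>] by (simp add: paths_def)
  let ?L = "{x \<in> space (Pi\<^sub>M {0..} (\<lambda>_. borel)). vanishes_at_0 x}"
  let ?C = "{\<omega> \<in> D. T \<omega> \<in> paths}"
  have "?C = D \<inter> (T -` ?L \<inter> space path_algebra)"
    using Dp paths_iff measurable_space[OF T] by auto
  then have C: "?C \<in> sets path_algebra"
    using D(1) measurable_sets[OF T vanishes_at_0_measurable] by auto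
  have TC: "T \<in> restrict_space path_algebra ?C \<rightarrow>\<^sub>M path_algebra"
  proof -
    have "T \<in> restrict_space path_algebra ?C \<rightarrow>\<^sub>M restrict_space (Pi\<^sub>M {0..} (\<lambda>_. borel)) paths"
      by (rule measurable_restrict_space2[OF _ measurable_restrict_space1[OF T]]) (auto simp: space_restrict_space)
    then show ?thesis by (simp add: path_algebra_def[symmetric])
  qed
  have eq: "{\<omega> \<in> D. T \<omega> \<in> E} = T -` E \<inter> space (restrict_space path_algebra ?C)"
    using Ep Dp C by (auto simp: space_restrict_space)
  have "{\<omega> \<in> D. T \<omega> \<in> E} \<in> sets (restrict_space path_algebra ?C)"
    unfolding eq by (rule measurable_sets[OF TC D(2)])
  then obtain Y where "Y \<in> sets path_algebra" "{\<omega> \<in> D. T \<omega> \<in> E} = ?C \<inter> Y" by (auto simp: sets_restrict_space)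
  then show A: "{\<omega> \<in> D. T \<omega> \<in> E} \<in> sets path_algebra" using C by simp
  have "T \<in> restrict_space path_algebra {\<omega> \<in> D. T \<omega> \<in> E} \<rightarrow>\<^sub>M restrict_space (Pi\<^sub>M {0..} (\<lambda>_. borel)) paths"
    using Ep by (intro measurable_restrict_space2[OF _ measurable_restrict_space1[OF T]]) (auto simp: space_restrict_space)
  then show "T \<in> restrict_space path_algebra {\<omega> \<in> D. T \<omega> \<in> E} \<rightarrow>\<^sub>M path_algebra"
    by (simp add: path_algebra_def[symmetric])
qed

lemma measurable_completion_restrict:
  assumes A: "A \<in> sets M" and f: "f \<in> restrict_space M A \<rightarrow>\<^sub>M M"
    and null: "\<And>N. N \<in> null_sets M \<Longrightarrow> f -` N \<inter> A \<in> null_sets M"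
  shows "f \<in> restrict_space (completion M) A \<rightarrow>\<^sub>M completion M"
proof (rule measurableI)
  have spA: "space (restrict_space M A) = A" "space (restrict_space (completion M) A) = A"
    using A by (simp_all add: space_restrict_space2)
  show "f x \<in> space (completion M)" if "x \<in> space (restrict_space (completion M) A)" for x
    using measurable_space[OF f] that spA by simp
  fix S assume "S \<in> sets (completion M)"
  then obtain S1 N N' where S: "S = S1 \<union> N" "N \<subseteq> N'" "N' \<in> null_sets M" "S1 \<in> sets M" by (rule sets_completionE)
  have "f -` S1 \<inter> A \<in> sets M"
    using measurable_sets[OF f S(4)] A spA by (simp add: sets_restrict_space_iff)
  then have "f -` S \<inter> A \<in> sets (completion M)"
    by (intro sets_completionI[of _ "f -` S1 \<inter> A" "f -` N \<inter> A" "f -` N' \<inter> A"]) (use S null in auto)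
  then show "f -` S \<inter> space (restrict_space (completion M) A) \<in> sets (restrict_space (completion M) A)"
    using A spA by (simp add: sets_restrict_space_iff)
qed

text \<open>An inverse of a measure-preserving map preserves null sets, so both maps stay measurable when the
  \<open>\<sigma>\<close>-algebra is completed. A set of the completion lies between two measurable sets of equal measure,
  which carries the invariance over.\<close>

lemma automorphism_between_completion:
  assumes P: "P = completion M" and A: "A \<in> sets M" "AE x in M. x \<in> A" and B: "B \<in> sets M" "AE x in M. x \<in> B"
    and T: "T \<in> restrict_space M A \<rightarrow>\<^sub>M M" and T': "T' \<in> restrict_space M B \<rightarrow>\<^sub>M M"
    and AB: "\<And>x. x \<in> A \<Longrightarrow> T x \<in> B" "\<And>x. x \<in> A \<Longrightarrow> T' (T x) = x"
    and BA: "\<And>y. y \<in> B \<Longrightarrow> T' y \<in> A" "\<And>y. y \<in> B \<Longrightarrow> T (T' y) = y"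
    and pres: "\<And>S. S \<in> sets M \<Longrightarrow> emeasure M (T -` S \<inter> A) = emeasure M S"
  shows "automorphism_between P A B T" and "\<And>y. y \<in> B \<Longrightarrow> the_inv_into A T y = T' y"
proof -
  have inj: "inj_on T A" using AB(2) by (rule inj_on_inverseI)
  have img: "T ` A = B" using AB BA by (metis image_eqI subsetI subset_antisym image_subset_iff)
  show inv: "the_inv_into A T y = T' y" if "y \<in> B" for y
    using the_inv_into_f_f[OF inj BA(1)[OF that]] by (simp only: BA(2)[OF that])
  have spA: "space (restrict_space M A) = A" and spB: "space (restrict_space M B) = B"
    using A B by (simp_all add: space_restrict_space2)
  have TS: "T -` S \<inter> A \<in> sets M" if "S \<in> sets M" for S
    using measurable_sets[OF T that] A spA by (simp add: sets_restrict_space_iff)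
  have TS': "T' -` S \<inter> B \<in> sets M" if "S \<in> sets M" for S
    using measurable_sets[OF T' that] B spB by (simp add: sets_restrict_space_iff)
  have Tm: "T \<in> restrict_space P A \<rightarrow>\<^sub>M P" unfolding P
  proof (rule measurable_completion_restrict[OF A(1) T])
    show "T -` N \<inter> A \<in> null_sets M" if "N \<in> null_sets M" for N
      using TS[of N] pres[of N] that by (simp add: null_sets_def)
  qed
  have T'm: "T' \<in> restrict_space P B \<rightarrow>\<^sub>M P" unfolding P
  proof (rule measurable_completion_restrict[OF B(1) T'])
    fix N assume N: "N \<in> null_sets M"
    have "T -` (T' -` N \<inter> B) \<inter> A = N \<inter> A" using AB by auto
    then have "emeasure M (T' -` N \<inter> B) = emeasure M (N \<inter> A)"
      using pres[OF TS'[of N]] N by auto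
    also have "\<dots> = 0" using N A by (intro null_setsD1 null_set_Int2) auto
    finally show "T' -` N \<inter> B \<in> null_sets M" using TS'[of N] N by auto
  qed
  have "the_inv_into A T \<in> restrict_space P B \<rightarrow>\<^sub>M P"
    using T'm by (rule measurable_cong[THEN iffD1, rotated]) (use inv in \<open>auto simp: space_restrict_space\<close>)
  moreover have "distr (restrict_space P A) P T = P"
  proof (rule measure_eqI)
    fix S assume S': "S \<in> sets (distr (restrict_space P A) P T)"
    then obtain S1 N N' where S: "S = S1 \<union> N" "N \<subseteq> N'" "N' \<in> null_sets M" "S1 \<in> sets M"
      unfolding P by (auto elim: sets_completionE)
    have SP: "S \<in> sets P" using S' by simp
    have AP: "A \<in> sets P" using A by (simp add: P)
    have N'0: "emeasure M (S1 \<union> N') = emeasure M S1" using S by (simp add: emeasure_Un_null_set)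
    have S1N: "S1 \<union> N' \<in> sets M" using S by auto
    have TSP: "T -` S \<inter> A \<in> sets P"
      using measurable_sets[OF Tm SP] AP A by (simp add: sets_restrict_space_iff space_restrict_space2)
    have "emeasure (distr (restrict_space P A) P T) S = emeasure P (T -` S \<inter> A)"
      using Tm SP AP by (simp add: emeasure_distr emeasure_restrict_space space_restrict_space2)
    also have "\<dots> = emeasure M S1"
    proof (rule antisym)
      have "emeasure P (T -` S \<inter> A) \<le> emeasure P (T -` (S1 \<union> N') \<inter> A)"
        using S TS[OF S1N] by (intro emeasure_mono) (auto simp: P)
      also have "\<dots> = emeasure M S1" using TS[OF S1N] pres[OF S1N] N'0 by (simp add: P)
      finally show "emeasure P (T -` S \<inter> A) \<le> emeasure M S1" .
      have "emeasure M S1 = emeasure P (T -` S1 \<inter> A)" using TS[OF S(4)] pres[OF S(4)] by (simp add: P)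
      also have "\<dots> \<le> emeasure P (T -` S \<inter> A)" using S TSP by (intro emeasure_mono) auto
      finally show "emeasure M S1 \<le> emeasure P (T -` S \<inter> A)" .
    qed
    also have "emeasure M S1 = emeasure P S"
    proof (rule antisym)
      have "emeasure P S1 \<le> emeasure P S" using S SP by (intro emeasure_mono) auto
      then show "emeasure M S1 \<le> emeasure P S" using S by (simp add: P)
      have "emeasure P S \<le> emeasure P (S1 \<union> N')" using S S1N by (intro emeasure_mono) (auto simp: P)
      then show "emeasure P S \<le> emeasure M S1" using S1N N'0 by (simp add: P)
    qed
    finally show "emeasure (distr (restrict_space P A) P T) S = emeasure P S" .
  qed simp
  moreover have "bij_betw T A B" using inj img by (simp add: bij_betw_def)
  moreover have "AE x in P. x \<in> A" "AE x in P. x \<in> B" using A(2) B(2) unfolding P by (auto intro: AE_completion)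
  moreover have "A \<in> sets P" "B \<in> sets P" using A B by (simp_all add: P)
  ultimately show "automorphism_between P A B T"
    using Tm by (simp add: automorphism_between_def)
qed

context self_similar_coordinate_process
begin

text \<open>That \<open>\<omega>\<close> lies in the domain does not make \<open>Z \<omega>\<close> continuous at \<open>0\<close>, but \<open>Z\<close> and the identity have the
  same law on the product space, so it is almost surely continuous there because the paths
  themselves are. In the same way \<open>Z \<omega>\<close> lies almost surely in the domain. Restricting both maps to
  the points whose image is in the domain makes them mutually inverse bijections \<open>A \<rightarrow> B\<close> and
  \<open>B \<rightarrow> A\<close>. That \<open>B\<close> has full measure requires no separate study of the inverse: \<open>Z\<close> maps
  \<open>A\<close> into \<open>B\<close> and preserves the law.\<close>

lemma Z_automorphism:
  assumes P0: "P = completion P0" "sets P0 = sets path_algebra"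
  shows "\<exists>A B. automorphism_between P A B (Z_transform \<beta> \<alpha>) \<and>
    (\<forall>\<omega>\<in>B. the_inv_into A (Z_transform \<beta> \<alpha>) \<omega> = Z_inv_transform \<beta> \<alpha> \<omega>)"
proof -
  let ?Z = "Z_transform \<beta> \<alpha>" and ?Z' = "Z_inv_transform \<beta> \<alpha>" and ?D = "Z_domain \<beta> \<alpha>"
  let ?N = "Pi\<^sub>M {0::real..} (\<lambda>_. borel :: real measure)"
  define A where "A = {\<omega> \<in> ?D. ?Z \<omega> \<in> ?D}"
  define B where "B = {\<eta> \<in> ?D. ?Z' \<eta> \<in> ?D}"
  have mP: "f \<in> P \<rightarrow>\<^sub>M N" if "f \<in> path_algebra \<rightarrow>\<^sub>M N" for f and N :: "(real \<Rightarrow> real) measure"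
    using that measurable_cong_sets[OF P0(2) refl] by (auto simp: P0(1) intro: measurable_completion)
  have ZN: "?Z \<in> P \<rightarrow>\<^sub>M ?N" by (rule mP[OF measurable_Z_transform(1)])
  have idN: "(\<lambda>\<omega>. \<omega>) \<in> P \<rightarrow>\<^sub>M ?N"
    by (rule mP) (simp add: path_algebra_def measurable_restrict_space1)
  note fA = path_transform_measurable[OF sets_Z_domain sets_Z_domain measurable_Z_transform(1) Z_transform_extensional(1,3) continuous_on_Z_transform(1)]
  note fB = path_transform_measurable[OF sets_Z_domain sets_Z_domain measurable_Z_transform(2) Z_transform_extensional(2,4) continuous_on_Z_transform(2)]
  have A: "A \<in> sets path_algebra" unfolding A_def by (rule fA(1))
  have B: "B \<in> sets path_algebra" unfolding B_def by (rule fB(1))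
  have TA: "?Z \<in> restrict_space path_algebra A \<rightarrow>\<^sub>M path_algebra" unfolding A_def by (rule fA(2))
  have TB: "?Z' \<in> restrict_space path_algebra B \<rightarrow>\<^sub>M path_algebra" unfolding B_def by (rule fB(2))
  have transfer: "(AE \<omega> in P. Q (?Z \<omega>)) \<longleftrightarrow> (AE \<omega> in P. Q \<omega>)" if "{x \<in> space ?N. Q x} \<in> sets ?N" for Q
  proof -
    have "(AE x in distr P ?N ?Z. Q x) \<longleftrightarrow> (AE x in distr P ?N (\<lambda>\<omega>. \<omega>). Q x)" by (simp only: distr_Z_transform)
    then show ?thesis using AE_distr_iff[OF ZN that] AE_distr_iff[OF idN that] by (simp only:)
  qed
  have trace: "\<exists>S'\<in>sets ?N. S = paths \<inter> S'" if "S \<in> sets path_algebra" for S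
    using that by (auto simp: path_algebra_def sets_restrict_space)
  have "AE \<omega> in P. vanishes_at_0 \<omega>"
    using AE_Z_domain
  proof eventually_elim
    case (elim \<omega>)
    then have "continuous_on {0..} \<omega>" "\<omega> 0 = 0" by (auto simp: Z_domain_def paths_def)
    moreover from this have "continuous_on {0<..} \<omega>" by (auto intro: continuous_on_subset)
    ultimately show ?case using continuous_on_iff_vanishes_at_0[of \<omega>] by blast
  qed
  then have "AE \<omega> in P. vanishes_at_0 (?Z \<omega>)" using transfer[OF vanishes_at_0_measurable] by simp
  then have Zpaths: "AE \<omega> in P. ?Z \<omega> \<in> paths"
    using AE_Z_domain by eventually_elim (simp add: fA(3))
  have transfer_path: "(AE \<omega> in P. ?Z \<omega> \<in> S) \<longleftrightarrow> (AE \<omega> in P. \<omega> \<in> S)" if S: "S \<in> sets path_algebra" for S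
  proof -
    obtain S' where S': "S' \<in> sets ?N" "S = paths \<inter> S'" using trace[OF S] by blast
    have "{x \<in> space ?N. x \<in> S'} = S'" using sets.sets_into_space[OF S'(1)] by auto
    then have "(AE \<omega> in P. ?Z \<omega> \<in> S') \<longleftrightarrow> (AE \<omega> in P. \<omega> \<in> S')" using S'(1) by (intro transfer) simp
    moreover have "(AE \<omega> in P. ?Z \<omega> \<in> S) \<longleftrightarrow> (AE \<omega> in P. ?Z \<omega> \<in> S')"
      using Zpaths unfolding S'(2) by auto
    moreover have "(AE \<omega> in P. \<omega> \<in> S) \<longleftrightarrow> (AE \<omega> in P. \<omega> \<in> S')"
      using AE_space[of P, unfolded space_P] unfolding S'(2) by auto
    ultimately show ?thesis by simp
  qed
  have "AE \<omega> in P. ?Z \<omega> \<in> ?D" using transfer_path[OF sets_Z_domain] AE_Z_domain by simp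
  then have AE_A: "AE \<omega> in P. \<omega> \<in> A" using AE_Z_domain by eventually_elim (simp add: A_def)
  have ZA: "?Z \<omega> \<in> B" "?Z' (?Z \<omega>) = \<omega>" if "\<omega> \<in> A" for \<omega>
    using that Z_inv_transform_Z_transform[of \<alpha> \<omega> \<beta>] \<alpha>_gt by (auto simp: A_def B_def)
  have ZB: "?Z' \<omega> \<in> A" "?Z (?Z' \<omega>) = \<omega>" if "\<omega> \<in> B" for \<omega>
    using that Z_transform_Z_inv_transform[of \<alpha> \<omega> \<beta>] \<alpha>_gt by (auto simp: A_def B_def)
  have "AE \<omega> in P. ?Z \<omega> \<in> B" using AE_A by eventually_elim (rule ZA)
  then have AE_B: "AE \<omega> in P. \<omega> \<in> B" using transfer_path[OF B] by simp
  have pres: "emeasure P0 (?Z -` S \<inter> A) = emeasure P0 S" if S: "S \<in> sets P0" for S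
  proof -
    have S0: "S \<in> sets path_algebra" using S P0 by simp
    obtain S' where S': "S' \<in> sets ?N" "S = paths \<inter> S'" using trace[OF S0] by blast
    have ZA': "?Z -` S \<inter> A \<in> sets P0"
    proof -
      have "?Z -` S \<inter> A \<in> sets (restrict_space path_algebra A)"
        using measurable_sets[OF TA S0] A by (simp add: space_restrict_space2)
      then obtain Y where "Y \<in> sets path_algebra" "?Z -` S \<inter> A = A \<inter> Y" by (auto simp: sets_restrict_space)
      then show ?thesis using A P0(2) by simp
    qed
    have "emeasure P0 (?Z -` S \<inter> A) = emeasure P (?Z -` S \<inter> A)" using ZA' by (simp add: P0)
    also have "\<dots> = emeasure P (?Z -` S' \<inter> space P)"
    proof (rule emeasure_eq_AE)
      show "AE \<omega> in P. \<omega> \<in> ?Z -` S \<inter> A \<longleftrightarrow> \<omega> \<in> ?Z -` S' \<inter> space P"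
        using AE_A Zpaths AE_space by eventually_elim (auto simp: S'(2))
    qed (use ZA' measurable_sets[OF ZN S'(1)] in \<open>simp_all add: P0(1)\<close>)
    also have "\<dots> = emeasure (distr P ?N ?Z) S'" using ZN S'(1) by (simp add: emeasure_distr)
    also have "\<dots> = emeasure P ((\<lambda>\<omega>. \<omega>) -` S' \<inter> space P)"
      unfolding distr_Z_transform using idN S'(1) by (simp add: emeasure_distr)
    also have "(\<lambda>\<omega>. \<omega>) -` S' \<inter> space P = S" by (auto simp: S'(2) space_P)
    also have "emeasure P S = emeasure P0 S" using S by (simp add: P0)
    finally show ?thesis .
  qed
  have T: "?Z \<in> restrict_space P0 A \<rightarrow>\<^sub>M P0" and T': "?Z' \<in> restrict_space P0 B \<rightarrow>\<^sub>M P0"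
    using TA TB measurable_cong_sets[OF sets_restrict_space_cong[OF P0(2)] P0(2)] by simp_all
  have AE0: "AE \<omega> in P0. \<omega> \<in> A" "AE \<omega> in P0. \<omega> \<in> B"
    using subst[OF P0(1), of "\<lambda>M. AE \<omega> in M. \<omega> \<in> A"] subst[OF P0(1), of "\<lambda>M. AE \<omega> in M. \<omega> \<in> B"] AE_A AE_B
    unfolding AE_completion_iff by blast+
  have "A \<in> sets P0" "B \<in> sets P0" using A B P0 by simp_all
  note aut = automorphism_between_completion[OF P0(1) this(1) AE0(1) this(2) AE0(2) T T' ZA ZB pres]
  show ?thesis by (intro exI[of _ A] exI[of _ B] conjI ballI aut)
qed

end

section \<open>The automorphism theorem\<close>

theorem theorem2p1:
  fixes M :: "'a measure" and W X :: "real \<Rightarrow> 'a \<Rightarrow> real" and z :: "real \<Rightarrow> real \<Rightarrow> real"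
    and \<beta> \<alpha> :: real and P :: "(real \<Rightarrow> real) measure"
  assumes "\<beta> > 0"
    and "volterra_gaussian_process M W z X"
    and "continuous_process M X"
    and "self_similar M \<beta> X"
    and "nondegenerate_kernel z"
    and "is_coordinate_space (volterra_covariance z) P"
    and "\<alpha> > - 1/2"
  shows "(AE \<omega> in P. \<forall>t>0. set_integrable lborel {0..t} (\<lambda>s. Z_integrand \<beta> \<alpha> s \<omega>)) \<and>
    (AE \<omega> in P. \<forall>t>0. set_integrable lborel {t..} (\<lambda>s. Z_inv_integrand \<beta> \<alpha> s \<omega>)) \<and>
    (\<exists>A B. automorphism_between P A B (Z_transform \<beta> \<alpha>) \<and>
       (\<forall>\<omega>\<in>B. the_inv_into A (Z_transform \<beta> \<alpha>) \<omega> = Z_inv_transform \<beta> \<alpha> \<omega>)) \<and>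
    (\<forall>t>0. L2_riemann_integral_from_0 P (Z_integrand \<beta> \<alpha>) t
       (\<lambda>\<omega>. LBINT s:{0..t}. Z_integrand \<beta> \<alpha> s \<omega>)) \<and>
    (\<forall>t>0. L2_riemann_integral_to_infinity P (Z_inv_integrand \<beta> \<alpha>) t
       (\<lambda>\<omega>. LBINT s:{t..}. Z_inv_integrand \<beta> \<alpha> s \<omega>))"
proof -
  obtain P0 where P0: "sets P0 = sets path_algebra" "P = completion P0"
    using assms(6) by (auto simp: is_coordinate_space_def)
  have prob: "prob_space P" and gauss: "centered_gaussian_process P (\<lambda>t \<omega>. \<omega> t) (volterra_covariance z)"
    using assms(6) by (simp_all add: is_coordinate_space_def)
  have space: "space P = paths"
    using sets_eq_imp_space_eq[OF P0(1)] by (simp add: P0(2))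
  interpret P: prob_space P by (rule prob)
  interpret self_similar_coordinate_process P "volterra_covariance z" \<beta> \<alpha>
    by unfold_locales (use space gauss assms(1,7) volterra_covariance_homogeneous[OF assms(2,4)] in simp_all)
  show ?thesis
    using AE_all_integrable Z_automorphism[OF P0(2,1)] L2_riemann_integral_from_0_Z L2_riemann_integral_to_infinity_Z_inv
    by blast
qed

end
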